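(* The diffusion $X$ is $m$-symmetric. The Dirichlet space (form domain in $L^2(m)$) associated with $X$ is the function space \[ \mathcal{F}=\left\{F\in L^2(m):\ dF\ll dS,\ \frac{dF}{dS}\in L^2(dS)\right\}, \] and the Dirichlet form associated with $X$ has the expression \[ \mathcal{E}(F,F)=\int_{-\infty}^\infty \left(\frac{dF}{dS}\right)^2(x)\,dS(x), \qquad F\in\mathcal{F}. \]
   Context: $X=(X_t)_{t\ge 0}$ is a regular linear continuous strong Markov process with state space $\mathbb{R}$ (a one-dimensional diffusion in the sense of Revuz–Yor, Chapter VII), conservative (infinite lifetime) and positively recurrent ($\mathbb{E}_x T_y<\infty$ for all $x,y$, where $T_y=\inf\{t\ge0:X_t=y\}$). $\mathbb{P}_x,\mathbb{E}_x$ denote law and expectation when $X_0=x$. $S$ is a scale function of $X$ (continuous, strictly increasing, with $\mathbb{P}_x[T_b<T_a]=\frac{S(x)-S(a)}{S(b)-S(a)}$ for $a<x<b$), and $m$ is the speed measure associated with $S$, i.e. the Borel measure such that for $a<x<b$ and Borel $f\ge 0$, $\mathbb{E}_x\int_0^{T_a\wedge T_b}f(X_t)\,dt=\int_a^b G(a,b,x,y)f(y)\,dm(y)$, where $G(a,b,x,y)=\frac{(S(b)-S(x\vee y))(S(x\wedge y)-S(a))}{S(b)-S(a)}$. The measure $m$ charges every nonempty open set. By positive recurrence $\lim_{x\to\pm\infty}S(x)=\pm\infty$ and $m(\mathbb{R})<\infty$. $dS$ denotes the Stieltjes measure induced by $S$. For a real function $F$ on $\mathbb{R}$ write $dF\ll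 dS$ if there is a locally $dS$-integrable function $f$ with $\int_u^v f\,dS=F(v)-F(u)$ for all $u<v$; then $f$ is denoted $\frac{dF}{dS}$. Elements of $L^2(m)$ are understood up to $m$-a.e. equality. The Dirichlet form associated with an $m$-symmetric process is the closed symmetric form on $L^2(m)$ associated with its $L^2(m)$-transition semigroup. *)

theory Defs
  imports "HOL-Probability.Probability"
begin

section \<open>Linear diffusions\<close>

text \<open>
  A family \<open>P x\<close> of laws on one measurable space \<open>M\<close>; only the values \<open>X t \<omega>\<close> with
  \<open>0 \<le> t\<close> matter. Filtrations are indexed by \<^typ>\<open>ennreal\<close>, so that the notions
  \<^const>\<open>stopping_time\<close> and \<^const>\<open>filtration.pre_sigma\<close> cover stopping times with values
  in \<open>[0,\<infinity>]\<close>; the index \<open>\<infinity>\<close> gives the \<open>\<sigma>\<close>-algebra of the whole path.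
\<close>

definition natural_filtration ::
    "'w measure \<Rightarrow> (real \<Rightarrow> 'w \<Rightarrow> real) \<Rightarrow> ennreal \<Rightarrow> 'w measure" where
  "natural_filtration M X t =
     sigma (space M) {X s -` B \<inter> space M | s B. 0 \<le> s \<and> ennreal s \<le> t \<and> B \<in> sets borel}"

text \<open>
  The right-continuous filtration generated by \<open>X\<close>. The inserted index \<open>\<infinity>\<close> changes nothing
  for \<open>t < \<infinity>\<close>; it only avoids an empty intersection at \<open>t = \<infinity>\<close>.
\<close>

definition right_filtration ::
    "'w measure \<Rightarrow> (real \<Rightarrow> 'w \<Rightarrow> real) \<Rightarrow> ennreal \<Rightarrow> 'w measure" where
  "right_filtration M X t =
     sigma (space M) (\<Inter>s\<in>insert \<infinity> {t<..}. sets (natural_filtration M X s))"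

lemma sets_natural_filtration_mono:
  "s \<le> t \<Longrightarrow> sets (natural_filtration M X s) \<subseteq> sets (natural_filtration M X t)"
  unfolding natural_filtration_def
  by (subst (1 2) sets_measure_of) (auto intro!: sigma_sets_mono' dest: order_trans)

lemma sets_right_filtration:
  "sets (right_filtration M X t) = (\<Inter>s\<in>insert \<infinity> {t<..}. sets (natural_filtration M X s))"
proof -
  have sp: "space (natural_filtration M X s) = space M" for s
    unfolding natural_filtration_def by (intro space_measure_of) auto
  have "sigma_algebra (space M) (\<Inter>s\<in>insert \<infinity> {t<..}. sets (natural_filtration M X s))"
    unfolding sigma_algebra_iff2
    using sets.space_closed[of "natural_filtration M X \<infinity>"] sets.top[of "natural_filtration M X _"]
      sets.compl_sets[of _ "natural_filtration M X _"]
    by (auto simp: sp intro!: sets.countable_UN)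
  then show ?thesis
    unfolding right_filtration_def by (rule sigma_algebra.sets_measure_of_eq)
qed

lemma filtration_right_filtration: "filtration (space M) (right_filtration M X)"
proof
  have "(\<Inter>s\<in>insert \<infinity> {t<..}. sets (natural_filtration M X s)) \<subseteq> Pow (space M)" for t
    using sets.space_closed[of "natural_filtration M X \<infinity>"]
    by (auto simp: natural_filtration_def space_measure_of_conv)
  then show "space (right_filtration M X t) = space M" for t
    unfolding right_filtration_def by (rule space_measure_of)
  show "sets (right_filtration M X s) \<subseteq> sets (right_filtration M X t)" if "s \<le> t" for s t
    using that unfolding sets_right_filtration by (auto dest: le_less_trans)
qed

definition path_from :: "(real \<Rightarrow> 'w \<Rightarrow> real) \<Rightarrow> real \<Rightarrow> 'w \<Rightarrow> real \<Rightarrow> real" where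
  "path_from X s \<omega> = (\<lambda>t\<in>{0..}. X (s + t) \<omega>)"

definition hitting_time :: "(real \<Rightarrow> 'w \<Rightarrow> real) \<Rightarrow> real \<Rightarrow> 'w \<Rightarrow> ennreal" where
  "hitting_time X y \<omega> = (INF t\<in>{t. 0 \<le> t \<and> X t \<omega> = y}. ennreal t)"

text \<open>
  Conservativeness is built in: \<open>X\<close> is real-valued at all times. The last two axioms are the
  strong Markov property
  \<open>P\<^sub>x[X\<^bsub>T+\<cdot>\<^esub> \<in> B | \<F>\<^sub>T] = P\<^bsub>X\<^sub>T\<^esub>[X \<in> B]\<close> on \<open>{T < \<infinity>}\<close> and regularity.
\<close>

locale linear_diffusion =
  fixes M :: "'w measure"
    and P :: "real \<Rightarrow> 'w measure"
    and X :: "real \<Rightarrow> 'w \<Rightarrow> real"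
  assumes prob_space_P: "prob_space (P x)"
    and sets_P: "sets (P x) = sets M"
    and measurable_X: "0 \<le> t \<Longrightarrow> X t \<in> borel_measurable M"
    and continuous_paths: "\<omega> \<in> space M \<Longrightarrow> continuous_on {0..} (\<lambda>t. X t \<omega>)"
    and kernel_P: "A \<in> sets (natural_filtration M X \<infinity>) \<Longrightarrow>
          (\<lambda>x. emeasure (P x) A) \<in> borel_measurable borel"
    and start: "AE \<omega> in P x. X 0 \<omega> = x"
    and strong_markov:
      "\<lbrakk>stopping_time (right_filtration M X) T;
        A \<in> sets (filtration.pre_sigma (space M) (right_filtration M X) T);
        B \<in> sets (PiM {0..} (\<lambda>_. borel))\<rbrakk> \<Longrightarrow>
       emeasure (P x) {\<omega> \<in> A. T \<omega> < \<infinity> \<and> path_from X (enn2real (T \<omega>)) \<omega> \<in> B} =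
         (\<integral>\<^sup>+\<omega>\<in>{\<omega> \<in> A. T \<omega> < \<infinity>}.
            emeasure (P (X (enn2real (T \<omega>)) \<omega>)) {\<omega>' \<in> space M. path_from X 0 \<omega>' \<in> B} \<partial>P x)"
    and regular: "emeasure (P x) {\<omega> \<in> space M. hitting_time X y \<omega> < \<infinity>} > 0"

definition positively_recurrent ::
    "(real \<Rightarrow> 'w measure) \<Rightarrow> (real \<Rightarrow> 'w \<Rightarrow> real) \<Rightarrow> bool" where
  "positively_recurrent P X \<longleftrightarrow> (\<forall>x y. (\<integral>\<^sup>+\<omega>. hitting_time X y \<omega> \<partial>P x) < \<infinity>)"

definition scale_function ::
    "(real \<Rightarrow> 'w measure) \<Rightarrow> (real \<Rightarrow> 'w \<Rightarrow> real) \<Rightarrow> (real \<Rightarrow> real) \<Rightarrow> bool" where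
  "scale_function P X S \<longleftrightarrow>
     continuous_on UNIV S \<and> strict_mono S \<and>
     (\<forall>a x b. a < x \<and> x < b \<longrightarrow>
        measure (P x) {\<omega> \<in> space (P x). hitting_time X b \<omega> < hitting_time X a \<omega>} =
          (S x - S a) / (S b - S a))"

definition green :: "(real \<Rightarrow> real) \<Rightarrow> real \<Rightarrow> real \<Rightarrow> real \<Rightarrow> real \<Rightarrow> real" where
  "green S a b x y = (S b - S (max x y)) * (S (min x y) - S a) / (S b - S a)"

definition speed_measure ::
    "(real \<Rightarrow> 'w measure) \<Rightarrow> (real \<Rightarrow> 'w \<Rightarrow> real) \<Rightarrow> (real \<Rightarrow> real) \<Rightarrow> real measure \<Rightarrow> bool" where
  "speed_measure P X S m \<longleftrightarrow>
     sets m = sets borel \<and>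
     (\<forall>a x b. \<forall>f \<in> borel_measurable borel. a < x \<and> x < b \<longrightarrow>
        (\<integral>\<^sup>+\<omega>. (\<integral>\<^sup>+t\<in>{t. 0 \<le> t \<and> ennreal t < min (hitting_time X a \<omega>) (hitting_time X b \<omega>)}.
                 f (X t \<omega>) \<partial>lborel) \<partial>P x) =
        (\<integral>\<^sup>+y\<in>{a<..<b}. ennreal (green S a b x y) * f y \<partial>m))"

section \<open>Symmetry and the Dirichlet form of a process\<close>

definition m_symmetric ::
    "real measure \<Rightarrow> (real \<Rightarrow> 'w measure) \<Rightarrow> (real \<Rightarrow> 'w \<Rightarrow> real) \<Rightarrow> bool" where
  "m_symmetric m P X \<longleftrightarrow>
     (\<forall>t\<ge>0. \<forall>f \<in> borel_measurable borel. \<forall>g \<in> borel_measurable borel.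
        (\<integral>\<^sup>+x. (\<integral>\<^sup>+\<omega>. f (X t \<omega>) \<partial>P x) * g x \<partial>m) =
        (\<integral>\<^sup>+x. f x * (\<integral>\<^sup>+\<omega>. g (X t \<omega>) \<partial>P x) \<partial>m))"

text \<open>
  Elements of \<open>L\<^sup>2\<close> are represented by functions; the constructions below do not depend on the
  representative.
\<close>

definition L2 :: "'a measure \<Rightarrow> ('a \<Rightarrow> real) set" where
  "L2 m = {F \<in> borel_measurable m. integrable m (\<lambda>x. (F x)\<^sup>2)}"

definition L2_inner :: "'a measure \<Rightarrow> ('a \<Rightarrow> real) \<Rightarrow> ('a \<Rightarrow> real) \<Rightarrow> real" where
  "L2_inner m F G = (\<integral>x. F x * G x \<partial>m)"

text \<open>
  For an \<open>m\<close>-symmetric process and \<open>F \<in> L\<^sup>2(m)\<close>, the expectation exists for \<open>m\<close>-almost every \<open>x\<close>.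
\<close>

definition transition ::
    "(real \<Rightarrow> 'w measure) \<Rightarrow> (real \<Rightarrow> 'w \<Rightarrow> real) \<Rightarrow> real \<Rightarrow> (real \<Rightarrow> real) \<Rightarrow> real \<Rightarrow> real" where
  "transition P X t F x = (\<integral>\<omega>. F (X t \<omega>) \<partial>P x)"

text \<open>
  The closed symmetric form associated with a symmetric strongly continuous contraction
  semigroup \<open>T\<close> on \<open>L\<^sup>2(m)\<close>, in the standard way through the approximating forms
  \<open>\<E>\<^sub>t(F,G) = (F - T\<^sub>t F, G) / t\<close>:
  \<open>\<E>(F,G) = lim \<E>\<^sub>t(F,G)\<close> as \<open>t \<down> 0\<close>, with domain \<open>{F. lim \<E>\<^sub>t(F,F) < \<infinity>}\<close>. The quantity
  \<open>\<E>\<^sub>t(F,F)\<close> is nonnegative and increases as \<open>t \<down> 0\<close>, so it always has a limit in \<open>[0,\<infinity>]\<close>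
  and existence of a real limit means that this limit is finite.
\<close>

definition approximating_form ::
    "'a measure \<Rightarrow> (real \<Rightarrow> ('a \<Rightarrow> real) \<Rightarrow> 'a \<Rightarrow> real) \<Rightarrow> real \<Rightarrow> ('a \<Rightarrow> real) \<Rightarrow> ('a \<Rightarrow> real) \<Rightarrow> real" where
  "approximating_form m T t F G = L2_inner m (\<lambda>x. F x - T t F x) G / t"

definition form_domain ::
    "'a measure \<Rightarrow> (real \<Rightarrow> ('a \<Rightarrow> real) \<Rightarrow> 'a \<Rightarrow> real) \<Rightarrow> ('a \<Rightarrow> real) set" where
  "form_domain m T =
     {F \<in> L2 m. \<exists>l. ((\<lambda>t. approximating_form m T t F F) \<longlongrightarrow> l) (at_right 0)}"

definition form ::
    "'a measure \<Rightarrow> (real \<Rightarrow> ('a \<Rightarrow> real) \<Rightarrow> 'a \<Rightarrow> real) \<Rightarrow> ('a \<Rightarrow> real) \<Rightarrow> ('a \<Rightarrow> real) \<Rightarrow> real" where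
  "form m T F G = Lim (at_right 0) (\<lambda>t. approximating_form m T t F G)"

definition dirichlet_space ::
    "real measure \<Rightarrow> (real \<Rightarrow> 'w measure) \<Rightarrow> (real \<Rightarrow> 'w \<Rightarrow> real) \<Rightarrow> (real \<Rightarrow> real) set" where
  "dirichlet_space m P X = form_domain m (transition P X)"

definition dirichlet_form ::
    "real measure \<Rightarrow> (real \<Rightarrow> 'w measure) \<Rightarrow> (real \<Rightarrow> 'w \<Rightarrow> real) \<Rightarrow>
      (real \<Rightarrow> real) \<Rightarrow> (real \<Rightarrow> real) \<Rightarrow> real" where
  "dirichlet_form m P X = form m (transition P X)"

section \<open>Absolute continuity with respect to the scale\<close>

text \<open>\<open>dF \<ll> dS\<close> with \<open>dF/dS = f\<close>, where \<open>dS\<close> is \<^term>\<open>interval_measure S\<close>.\<close>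

definition has_scale_derivative ::
    "(real \<Rightarrow> real) \<Rightarrow> (real \<Rightarrow> real) \<Rightarrow> (real \<Rightarrow> real) \<Rightarrow> bool" where
  "has_scale_derivative S F f \<longleftrightarrow>
     (\<forall>u v. u < v \<longrightarrow>
        set_integrable (interval_measure S) {u..v} f \<and>
        set_lebesgue_integral (interval_measure S) {u..v} f = F v - F u)"

text \<open>
  Since elements of \<open>L\<^sup>2(m)\<close> are equivalence classes, \<open>F\<close> belongs to the space as soon as some
  \<open>m\<close>-version \<open>F'\<close> of it satisfies \<open>dF' \<ll> dS\<close>.
\<close>

definition scale_space :: "(real \<Rightarrow> real) \<Rightarrow> real measure \<Rightarrow> (real \<Rightarrow> real) set" where
  "scale_space S m =
     {F \<in> L2 m. \<exists>F' f. (AE x in m. F x = F' x) \<and> has_scale_derivative S F' f \<and>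
        f \<in> L2 (interval_measure S)}"

end

theory Submission
  imports Defs "HOL-Real_Asymp.Real_Asymp"
begin

text \<open>
  Let \<open>Q(F) = \<integral>(dF/dS)\<^sup>2 dS\<close>, and let \<open>U\<^sub>\<lambda>\<close> be \<open>\<lambda>\<close> times the resolvent of \<open>X\<close>. For \<open>X\<close> killed at the
  exit from \<open>(-n,n)\<close> the Markov property gives \<open>u = U\<^sub>\<lambda>F = G(\<lambda>(F - u))\<close> with the Green operator \<open>G\<close>.
  Integrating the explicit Green function by parts yields \<open>Q(u,v) = \<lambda>(F - u,v)\<close> for \<open>v\<close> vanishing
  outside \<open>(-n,n)\<close>. Hence the killed resolvents are \<open>m\<close>-symmetric; letting \<open>n \<rightarrow> \<infinity>\<close> and inverting the
  Laplace transform, so is the semigroup.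

  The form \<open>Q\<close> is lower semicontinuous on \<open>L\<^sup>2(m)\<close>. Therefore \<open>Q(U\<^sub>\<lambda>F) \<le> \<lambda>(F - U\<^sub>\<lambda>F,U\<^sub>\<lambda>F)\<close>, and if the
  approximating forms \<open>\<E>\<^sub>t(F,F)\<close> are bounded by \<open>L\<close>, then so are their exponential averages
  \<open>\<lambda>(F - U\<^sub>\<lambda>F,F)\<close>, whence \<open>U\<^sub>\<lambda>F \<rightarrow> F\<close> and \<open>Q(F) \<le> L\<close>. Conversely \<open>\<lambda>(v - U\<^sub>\<lambda>v,v) \<le> Q(v)\<close> for compactly
  supported \<open>v\<close>, which gives \<open>\<E>\<^sub>t(v,v) \<le> Q(v)\<close> by the convexity of \<open>t \<mapsto> (P\<^sub>tv,v)\<close>; a cut-off, cheap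
  because \<open>S(\<plusminus>\<infinity>) = \<plusminus>\<infinity>\<close>, extends this to all \<open>F\<close>.
\<close>

section \<open>Square-integrable functions\<close>

text \<open>All that is known about \<open>X\<close> analytically is the Green function of each
  bounded interval. Identities are therefore first proved for the killed process and bounded
  functions, where \<open>m\<close> is finite and potentials have a bounded derivative supported in
  the interval. The form, in contrast, is defined by the semigroup near \<open>t = 0\<close>. The
  bridge is one scalar function for each \<open>F\<close>, namely
  \<open>h(t) = (F - T\<^sub>tF,F)\<close>, which is nonnegative, increasing and satisfies
  \<open>h(n t) \<le> n h(t)\<close>. These properties make \<open>h(t)/t\<close> converge to its
  supremum as \<open>t\<close> tends to 0, and let bounds pass in both directions between
  \<open>h(t)/t\<close> and the exponential averages of \<open>h\<close>, which are computed by the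
  resolvent. A second obstacle is that L2(m) consists of classes, while \<open>dF/dS\<close> belongs
  to a particular version of \<open>F\<close>. The limit argument must therefore construct such a
  version, and its uniqueness rests on the fact that \<open>m\<close> charges every interval. This
  fact and the finiteness of \<open>m\<close> are derived from the Green function and from positive
  recurrence.\<close>

abbreviation L2_sq :: "'a measure \<Rightarrow> ('a \<Rightarrow> real) \<Rightarrow> real" where
  "L2_sq m F \<equiv> L2_inner m F F"

lemma L2_D:
  assumes "F \<in> L2 m"
  shows "F \<in> borel_measurable m" "integrable m (\<lambda>x. (F x)\<^sup>2)"
  using assms by (auto simp: L2_def)

lemma L2_integrable_mult:
  assumes "F \<in> L2 m" "G \<in> L2 m"
  shows "integrable m (\<lambda>x. F x * G x)"
proof (rule Bochner_Integration.integrable_bound)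
  show "integrable m (\<lambda>x. (F x)\<^sup>2 + (G x)\<^sup>2)" using assms by (auto dest: L2_D)
  show "(\<lambda>x. F x * G x) \<in> borel_measurable m" using L2_D(1)[OF assms(1)] L2_D(1)[OF assms(2)] by simp
  have "\<bar>a * b\<bar> \<le> a\<^sup>2 + b\<^sup>2" for a b :: real
  proof -
    have "0 \<le> \<bar>a\<bar> * \<bar>b\<bar>" by simp
    then show ?thesis using sum_squares_bound[of "\<bar>a\<bar>" "\<bar>b\<bar>"] unfolding abs_mult power2_abs by linarith
  qed
  then show "AE x in m. norm (F x * G x) \<le> norm ((F x)\<^sup>2 + (G x)\<^sup>2)" by simp
qed

lemma L2_nn:
  assumes "F \<in> borel_measurable m"
  shows "F \<in> L2 m \<longleftrightarrow> (\<integral>\<^sup>+x. ennreal ((F x)\<^sup>2) \<partial>m) < \<infinity>"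
  using assms by (auto simp: L2_def integrable_iff_bounded)

lemma L2_scale: "F \<in> L2 m \<Longrightarrow> (\<lambda>x. c * F x) \<in> L2 m"
  by (auto simp: L2_def power_mult_distrib)

lemma L2_add:
  assumes "F \<in> L2 m" "G \<in> L2 m"
  shows "(\<lambda>x. F x + G x) \<in> L2 m"
  using assms L2_integrable_mult[OF assms] unfolding L2_def
  by (auto simp: power2_sum mult.assoc)

lemma L2_diff:
  assumes "F \<in> L2 m" "G \<in> L2 m"
  shows "(\<lambda>x. F x - G x) \<in> L2 m"
  using L2_add[OF assms(1) L2_scale[OF assms(2), of "-1"]] by simp

lemma L2_bound:
  assumes "F \<in> L2 m" "G \<in> borel_measurable m" "AE x in m. \<bar>G x\<bar> \<le> \<bar>F x\<bar>"
  shows "G \<in> L2 m"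
  unfolding L2_def
proof (safe intro!: assms(2))
  show "integrable m (\<lambda>x. (G x)\<^sup>2)"
    by (rule Bochner_Integration.integrable_bound[OF L2_D(2)[OF assms(1)]])
      (use assms in \<open>auto simp: abs_le_square_iff\<close>)
qed

lemma L2_cong_AE:
  assumes "F \<in> L2 m" "G \<in> borel_measurable m" "AE x in m. F x = G x"
  shows "G \<in> L2 m"
  using assms(3) by (intro L2_bound[OF assms(1,2)]) auto

lemma L2_abs: "F \<in> L2 m \<Longrightarrow> (\<lambda>x. \<bar>F x\<bar>) \<in> L2 m"
  by (auto simp: L2_def)

lemma L2_pos_part:
  assumes "F \<in> L2 m"
  shows "(\<lambda>x. max (F x) 0) \<in> L2 m" "(\<lambda>x. max (- F x) 0) \<in> L2 m"
  using L2_D[OF assms] by (intro L2_bound[OF assms]; auto simp: max_def)+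

lemma pos_part_diff: "(\<lambda>x. max (F x) 0 - max (- F x) 0) = (F :: 'a \<Rightarrow> real)"
  by (auto simp: fun_eq_iff max_def)

lemma (in finite_measure) L2_bounded:
  assumes "F \<in> borel_measurable M" "\<And>x. \<bar>F x\<bar> \<le> B"
  shows "F \<in> L2 M"
proof -
  have "(\<lambda>x. B) \<in> L2 M" by (auto simp: L2_def)
  then show ?thesis by (rule L2_bound) (use assms in \<open>auto intro: order_trans[OF _ abs_ge_self]\<close>)
qed

lemma L2_inner_commute: "L2_inner m F G = L2_inner m G F"
  by (simp add: L2_inner_def mult.commute)

lemma L2_inner_cong_AE:
  assumes "F \<in> borel_measurable m" "F' \<in> borel_measurable m" "G \<in> borel_measurable m"
    "G' \<in> borel_measurable m"
    and "AE x in m. F x = F' x" "AE x in m. G x = G' x"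
  shows "L2_inner m F G = L2_inner m F' G'"
  unfolding L2_inner_def using assms by (intro integral_cong_AE) auto

lemma L2_inner_diff_left:
  assumes "F \<in> L2 m" "G \<in> L2 m" "H \<in> L2 m"
  shows "L2_inner m (\<lambda>x. F x - G x) H = L2_inner m F H - L2_inner m G H"
  using L2_integrable_mult[OF assms(1,3)] L2_integrable_mult[OF assms(2,3)]
  by (simp add: L2_inner_def left_diff_distrib)

lemma L2_inner_diff_right:
  assumes "F \<in> L2 m" "G \<in> L2 m" "H \<in> L2 m"
  shows "L2_inner m H (\<lambda>x. F x - G x) = L2_inner m H F - L2_inner m H G"
  using L2_inner_diff_left[OF assms] by (simp add: L2_inner_commute)

lemma L2_inner_scale_left: "L2_inner m (\<lambda>x. c * F x) G = c * L2_inner m F G"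
  by (simp add: L2_inner_def mult.assoc)

lemma L2_inner_nonneg: "0 \<le> L2_sq m F"
  by (simp add: L2_inner_def)

lemma L2_inner_diff_self:
  assumes "F \<in> L2 m" "G \<in> L2 m"
  shows "L2_sq m (\<lambda>x. F x - G x)
    = L2_sq m F - 2 * L2_inner m F G + L2_sq m G"
  using assms by (simp add: L2_inner_diff_left L2_inner_diff_right L2_diff L2_inner_commute[of m G F])

lemma L2_inner_add_self:
  assumes "F \<in> L2 m" "G \<in> L2 m"
  shows "L2_sq m (\<lambda>x. F x + G x)
    = L2_sq m F + 2 * L2_inner m F G + L2_sq m G"
  using L2_inner_diff_self[OF assms(1) L2_scale[OF assms(2), of "-1"]]
  by (simp add: L2_inner_def)

lemma L2_inner_young:
  assumes "F \<in> L2 m" "G \<in> L2 m"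
  shows "2 * L2_inner m F G \<le> L2_sq m F + L2_sq m G"
  using L2_inner_diff_self[OF assms] L2_inner_nonneg[of m "\<lambda>x. F x - G x"] by simp

lemma L2_inner_Cauchy_Schwarz:
  assumes "F \<in> L2 m" "G \<in> L2 m"
  shows "\<bar>L2_inner m F G\<bar> \<le> sqrt (L2_sq m F) * sqrt (L2_sq m G)"
proof -
  let ?a = "L2_sq m F" and ?b = "L2_inner m F G" and ?c = "L2_sq m G"
  have q: "0 \<le> ?a - 2 * r * ?b + r\<^sup>2 * ?c" for r
  proof -
    have "0 \<le> L2_sq m (\<lambda>x. F x - r * G x)" by (rule L2_inner_nonneg)
    also have "\<dots> = ?a - 2 * r * ?b + r\<^sup>2 * ?c"
    proof -
      have "L2_inner m F (\<lambda>x. r * G x) = r * ?b"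
        by (subst (1 2) L2_inner_commute) (rule L2_inner_scale_left)
      moreover have "L2_sq m (\<lambda>x. r * G x) = r\<^sup>2 * ?c"
        by (simp add: L2_inner_def power2_eq_square ac_simps flip: integral_mult_right_zero)
      ultimately show ?thesis
        using L2_inner_diff_self[OF assms(1) L2_scale[OF assms(2), of r]] by simp
    qed
    finally show ?thesis .
  qed
  have "?b\<^sup>2 \<le> ?a * ?c"
  proof (cases "?c = 0")
    case True
    have "?b = 0"
    proof (rule ccontr)
      assume "?b \<noteq> 0"
      \<comment> \<open>With \<open>?c = 0\<close> the quadratic is affine in \<open>r\<close>; this
        value of \<open>r\<close> would make it equal to \<open>-1\<close>.\<close>
      then have "2 * ((?a + 1) / (2 * ?b)) * ?b = ?a + 1" by simp
      then have "?a - 2 * ((?a + 1) / (2 * ?b)) * ?b = -1" by linarith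
      with q[of "(?a + 1) / (2 * ?b)"] True show False by simp
    qed
    then show ?thesis using True by simp
  next
    case False
    then have c: "?c > 0" using L2_inner_nonneg[of m G] by simp
    have "0 \<le> (?a - 2 * (?b / ?c) * ?b + (?b / ?c)\<^sup>2 * ?c) * ?c"
      using q[of "?b / ?c"] c by simp
    also have "\<dots> = ?a * ?c - ?b\<^sup>2" using c
      by (simp add: power2_eq_square left_diff_distrib distrib_right)
    finally show ?thesis by linarith
  qed
  then have "sqrt (?b\<^sup>2) \<le> sqrt (?a * ?c)" by (rule real_sqrt_le_mono)
  then show ?thesis by (simp add: real_sqrt_mult)
qed

section \<open>Convergence and completeness in L2\<close>

definition L2_tendsto :: "'a measure \<Rightarrow> (nat \<Rightarrow> 'a \<Rightarrow> real) \<Rightarrow> ('a \<Rightarrow> real) \<Rightarrow> bool" where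
  "L2_tendsto m F G \<longleftrightarrow> (\<lambda>n. L2_sq m (\<lambda>x. F n x - G x)) \<longlonglongrightarrow> 0"

lemma L2_inner_tendsto_left:
  assumes "\<And>n. F n \<in> L2 m" "G \<in> L2 m" "H \<in> L2 m" "L2_tendsto m F G"
  shows "(\<lambda>n. L2_inner m (F n) H) \<longlonglongrightarrow> L2_inner m G H"
proof (rule LIM_zero_cancel, rule Lim_null_comparison)
  show "\<forall>\<^sub>F n in sequentially. norm (L2_inner m (F n) H - L2_inner m G H)
     \<le> sqrt (L2_sq m (\<lambda>x. F n x - G x)) * sqrt (L2_sq m H)"
    using L2_inner_Cauchy_Schwarz[OF L2_diff[OF assms(1,2)] assms(3)]
    by (simp add: L2_inner_diff_left assms)
  show "(\<lambda>n. sqrt (L2_sq m (\<lambda>x. F n x - G x)) * sqrt (L2_sq m H)) \<longlonglongrightarrow> 0"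
    using assms(4) unfolding L2_tendsto_def
    by (intro tendsto_mult_left_zero) (use tendsto_real_sqrt in fastforce)
qed

lemma L2_inner_tendsto:
  assumes "\<And>n. F n \<in> L2 m" "F' \<in> L2 m" "\<And>n. G n \<in> L2 m" "G' \<in> L2 m" "L2_tendsto m F F'"
    "L2_tendsto m G G'"
  shows "(\<lambda>n. L2_inner m (F n) (G n)) \<longlonglongrightarrow> L2_inner m F' G'"
proof -
  let ?F = "\<lambda>n x. F n x - F' x" and ?G = "\<lambda>n x. G n x - G' x"
  have 1: "(\<lambda>n. L2_inner m (F n) G') \<longlonglongrightarrow> L2_inner m F' G'"
    by (intro L2_inner_tendsto_left assms)
  have 2: "(\<lambda>n. L2_inner m (G n) F') \<longlonglongrightarrow> L2_inner m G' F'"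
    by (intro L2_inner_tendsto_left assms)
  have 3: "(\<lambda>n. L2_inner m (?F n) (?G n)) \<longlonglongrightarrow> 0"
  proof (rule Lim_null_comparison)
    show "\<forall>\<^sub>F n in sequentially. norm (L2_inner m (?F n) (?G n))
      \<le> sqrt (L2_sq m (?F n)) * sqrt (L2_sq m (?G n))"
      using L2_inner_Cauchy_Schwarz[OF L2_diff[OF assms(1,2)] L2_diff[OF assms(3,4)]] by simp
    have "(\<lambda>n. sqrt (L2_sq m (?F n)) * sqrt (L2_sq m (?G n))) \<longlonglongrightarrow> sqrt 0 * sqrt 0"
      using assms(5,6) unfolding L2_tendsto_def by (intro tendsto_mult tendsto_real_sqrt)
    then show "(\<lambda>n. sqrt (L2_sq m (?F n)) * sqrt (L2_sq m (?G n))) \<longlonglongrightarrow> 0" by simp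
  qed
  have "L2_inner m (F n) (G n) = L2_inner m (?F n) (?G n) + L2_inner m (F n) G' + L2_inner m (G n) F' -
    L2_inner m F' G'" for n
    by (simp add: L2_inner_diff_left L2_inner_diff_right assms L2_diff L2_inner_commute[of m F'])
  moreover have "(\<lambda>n. L2_inner m (?F n) (?G n) + L2_inner m (F n) G' + L2_inner m (G n) F' - L2_inner m
    F' G')
    \<longlonglongrightarrow> 0 + L2_inner m F' G' + L2_inner m G' F' - L2_inner m F' G'"
    by (intro tendsto_intros 1 2 3)
  ultimately show ?thesis by (simp add: L2_inner_commute[of m G'])
qed

lemma L2_tendsto_diff:
  assumes "\<And>n. F n \<in> L2 m" "F' \<in> L2 m" "\<And>n. G n \<in> L2 m" "G' \<in> L2 m" "L2_tendsto m F F'"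
    "L2_tendsto m G G'"
  shows "L2_tendsto m (\<lambda>n x. F n x - G n x) (\<lambda>x. F' x - G' x)"
  unfolding L2_tendsto_def
proof (rule tendsto_sandwich[OF _ _ tendsto_const])
  let ?F = "\<lambda>n x. F n x - F' x" and ?G = "\<lambda>n x. G n x - G' x"
  show "(\<lambda>n. 2 * L2_sq m (?F n) + 2 * L2_sq m (?G n)) \<longlonglongrightarrow> 0"
    using tendsto_add[OF tendsto_mult_left[OF assms(5)[unfolded L2_tendsto_def], of 2]
      tendsto_mult_left[OF assms(6)[unfolded L2_tendsto_def], of 2]] by simp
  have "L2_sq m (\<lambda>x. F n x - G n x - (F' x - G' x))
     = L2_sq m (\<lambda>x. ?F n x - ?G n x)" for n
    by (simp add: algebra_simps)
  \<comment> \<open>The parallelogram law, with the nonnegative norm of the sum dropped.\<close>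
  also have "\<dots> n \<le> 2 * L2_sq m (?F n) + 2 * L2_sq m (?G n)" for n
    using L2_inner_diff_self[OF L2_diff[OF assms(1,2)] L2_diff[OF assms(3,4)], of n n]
      L2_inner_add_self[OF L2_diff[OF assms(1,2)] L2_diff[OF assms(3,4)], of n n]
      L2_inner_nonneg[of m "\<lambda>x. ?F n x + ?G n x"] by simp
  finally show "\<forall>\<^sub>F n in sequentially. L2_sq m (\<lambda>x. F n x - G n x - (F' x - G' x))
      \<le> 2 * L2_sq m (?F n) + 2 * L2_sq m (?G n)" by simp
qed (simp add: L2_inner_nonneg)

lemma L2_tendsto_dominated:
  assumes "\<And>n. F n \<in> borel_measurable m" "G \<in> borel_measurable m" "H \<in> L2 m"
    and lim: "AE x in m. (\<lambda>n. F n x) \<longlonglongrightarrow> G x" and dom: "\<And>n. AE x in m. \<bar>F n x\<bar> \<le> H x"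
  shows "\<And>n. F n \<in> L2 m" "G \<in> L2 m" "L2_tendsto m F G"
proof -
  show F: "F n \<in> L2 m" for n
    using dom[of n] by (intro L2_bound[OF assms(3) assms(1)]) auto
  have domG: "AE x in m. \<bar>G x\<bar> \<le> H x"
  proof -
    have "AE x in m. \<forall>n. \<bar>F n x\<bar> \<le> H x" using dom by (simp add: AE_all_countable)
    with lim show ?thesis
    proof eventually_elim
      case (elim x)
      show ?case by (rule tendsto_upperbound[OF tendsto_rabs[OF elim(1)]]) (use elim(2) in auto)
    qed
  qed
  show "G \<in> L2 m" using domG by (intro L2_bound[OF assms(3,2)]) auto
  have "(\<lambda>n. \<integral>x. (F n x - G x)\<^sup>2 \<partial>m) \<longlonglongrightarrow> (\<integral>x. 0 \<partial>m)"
  proof (rule integral_dominated_convergence[where w="\<lambda>x. 4 * (H x)\<^sup>2"])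
    show "integrable m (\<lambda>x. 4 * (H x)\<^sup>2)" using L2_D[OF assms(3)] by simp
    show "(\<lambda>x. (F n x - G x)\<^sup>2) \<in> borel_measurable m" for n using assms by simp
    show "AE x in m. (\<lambda>n. (F n x - G x)\<^sup>2) \<longlonglongrightarrow> 0"
      using lim
    proof eventually_elim
      case (elim x)
      from tendsto_power[OF LIM_zero[OF elim], of 2] show ?case by simp
    qed
    show "AE x in m. norm ((F n x - G x)\<^sup>2) \<le> 4 * (H x)\<^sup>2" for n
      using dom[of n] domG
    proof eventually_elim
      case (elim x)
      have "\<bar>F n x - G x\<bar> \<le> \<bar>2 * H x\<bar>" using elim by linarith
      then have "(F n x - G x)\<^sup>2 \<le> (2 * H x)\<^sup>2" by (simp only: abs_le_square_iff)
      then show ?case by (simp add: power_mult_distrib)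
    qed
  qed simp
  then show "L2_tendsto m F G" by (simp add: L2_tendsto_def L2_inner_def power2_eq_square)
qed

lemma L2_tendsto_AE_subseq:
  assumes "\<And>n. F n \<in> L2 m" "G \<in> L2 m" "L2_tendsto m F G"
  shows "\<exists>r::nat\<Rightarrow>nat. strict_mono r \<and> (AE x in m. (\<lambda>n. F (r n) x) \<longlonglongrightarrow> G x)"
proof -
  have "\<exists>r::nat\<Rightarrow>nat. strict_mono r \<and> (AE x in m. (\<lambda>n. (F (r n) x - G x)\<^sup>2) \<longlonglongrightarrow> 0)"
  proof (rule tendsto_L1_AE_subseq)
    show "integrable m (\<lambda>x. (F n x - G x)\<^sup>2)" for n using L2_D(2)[OF L2_diff[OF assms(1,2)]] .
    show "(\<lambda>n. \<integral>x. norm ((F n x - G x)\<^sup>2) \<partial>m) \<longlonglongrightarrow> 0"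
      using assms(3) by (simp add: L2_tendsto_def L2_inner_def power2_eq_square)
  qed
  then obtain r :: "nat \<Rightarrow> nat" where r: "strict_mono r" "AE x in m. (\<lambda>n. (F (r n) x - G x)\<^sup>2) \<longlonglongrightarrow> 0"
    by blast
  from r(2) have "AE x in m. (\<lambda>n. F (r n) x) \<longlonglongrightarrow> G x"
  proof eventually_elim
    case (elim x)
    from tendsto_real_sqrt[OF elim] have "(\<lambda>n. \<bar>F (r n) x - G x\<bar>) \<longlonglongrightarrow> 0" by simp
    then show ?case by (simp add: tendsto_rabs_zero_iff LIM_zero_cancel)
  qed
  with r(1) show ?thesis by blast
qed

text \<open>The weighted inequality \<open>2 |d| \<le> 2^k d^2 + 2^(-k)\<close> trades a geometric
  weight for a square, so L2 bounds on increments give absolute summability.\<close>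

lemma summable_if_pow2_squares_summable:
  fixes d :: "nat \<Rightarrow> real"
  assumes "summable (\<lambda>k. 2 ^ k * (d k)\<^sup>2)"
  shows "summable d"
proof -
  have le: "2 * \<bar>d k\<bar> \<le> 2 ^ k * (d k)\<^sup>2 + (1/2) ^ k" for k
  proof -
    define q where "q = sqrt (2 ^ k)"
    have q: "q > 0" "q\<^sup>2 = 2 ^ k" by (auto simp: q_def)
    have "0 \<le> (q * \<bar>d k\<bar> - 1 / q)\<^sup>2" by simp
    also have "\<dots> = 2 ^ k * (d k)\<^sup>2 + (1/2) ^ k - 2 * \<bar>d k\<bar>"
      using q(1) unfolding power2_diff power_mult_distrib power_divide q(2) by simp
    finally show ?thesis by simp
  qed
  have "summable (\<lambda>k. 2 ^ k * (d k)\<^sup>2 + (1/2) ^ k)"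
    by (intro summable_add assms summable_geometric) simp
  then have "summable (\<lambda>k. 2 * \<bar>d k\<bar>)"
    by (rule summable_comparison_test'[where N=0]) (use le in simp)
  then have "summable (\<lambda>k. \<bar>d k\<bar>)" using summable_mult[of "\<lambda>k. 2 * \<bar>d k\<bar>" "1/2"] by simp
  then show ?thesis by (rule summable_rabs_cancel)
qed

text \<open>Riesz-Fischer: along a subsequence with squared increments at most \<open>4^(-j)\<close>
  the squares weighted by \<open>2^j\<close> have a finite integral, which gives almost everywhere
  convergence. Fatou's lemma then bounds the distance of the whole sequence from that limit.\<close>

lemma L2_complete:
  assumes G: "\<And>n. G n \<in> L2 m"
    and Cauchy: "\<And>e. 0 < e \<Longrightarrow> \<exists>N. \<forall>n\<ge>N. \<forall>k\<ge>N. L2_sq m (\<lambda>x. G n x - G k x) \<le> e"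
  obtains g where "g \<in> L2 m" "L2_tendsto m G g"
proof -
  have [measurable]: "G n \<in> borel_measurable m" for n using G by (auto dest: L2_D)
  have int: "integrable m (\<lambda>x. (G n x - G k x)\<^sup>2)" for n k using L2_D(2)[OF L2_diff[OF G G]] .
  have inn: "(\<integral>\<^sup>+x. ennreal ((G n x - G k x)\<^sup>2) \<partial>m) = ennreal (L2_sq m (\<lambda>x. G n x - G k x))" for n k
    using int[of n k] by (subst nn_integral_eq_integral) (auto simp: L2_inner_def power2_eq_square)
  obtain N where N: "\<And>j n k. n \<ge> N j \<Longrightarrow> k \<ge> N j \<Longrightarrow>
      L2_sq m (\<lambda>x. G n x - G k x) \<le> (1/4) ^ j"
    using Cauchy[of "(1/4) ^ j" for j]
      by (metis zero_less_power zero_less_divide_1_iff zero_less_numeral)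
  \<comment> \<open>Summing over \<open>i \<le> j\<close> makes both \<open>r j\<close> and
    \<open>r (Suc j)\<close> at least \<open>N j\<close>; the summand \<open>j\<close> drives
    \<open>r\<close> to infinity.\<close>
  define r where "r j = (\<Sum>i\<le>j. N i) + j" for j
  have rN: "r j \<ge> N j" "r (Suc j) \<ge> N j" "r j \<ge> j" for j
    unfolding r_def using member_le_sum[of j "{..j}" N] member_le_sum[of j "{..Suc j}" N] by auto
  let ?d = "\<lambda>j x. G (r (Suc j)) x - G (r j) x"
  have "(\<integral>\<^sup>+x. (\<Sum>j. ennreal (2 ^ j * (?d j x)\<^sup>2)) \<partial>m)
    = (\<Sum>j. ennreal (2 ^ j) * (\<integral>\<^sup>+x. ennreal ((?d j x)\<^sup>2) \<partial>m))"
    by (subst nn_integral_suminf) (auto simp: ennreal_mult nn_integral_cmult)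
  also have "\<dots> \<le> (\<Sum>j. ennreal ((1/2) ^ j))"
  proof (rule suminf_le)
    show "ennreal (2 ^ j) * (\<integral>\<^sup>+x. ennreal ((?d j x)\<^sup>2) \<partial>m) \<le> ennreal ((1/2) ^ j)" for j
    proof -
      have "ennreal (2 ^ j) * (\<integral>\<^sup>+x. ennreal ((?d j x)\<^sup>2) \<partial>m) \<le> ennreal (2 ^ j) * ennreal ((1/4) ^ j)"
        unfolding inn using N[OF rN(2,1)] by (intro mult_left_mono ennreal_leI) auto
      also have "\<dots> = ennreal ((1/2) ^ j)"
        by (simp flip: ennreal_mult add: power_mult_distrib[symmetric])
      finally show ?thesis .
    qed
  qed auto
  also have "\<dots> < \<infinity>"
    using summable_geometric[of "1/2::real"] by (subst suminf_ennreal2) auto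
  finally have "AE x in m. (\<Sum>j. ennreal (2 ^ j * (?d j x)\<^sup>2)) \<noteq> \<infinity>"
    by (intro nn_integral_PInf_AE) auto
  then have conv: "AE x in m. convergent (\<lambda>j. G (r j) x)"
  proof eventually_elim
    case (elim x)
    then have "summable (\<lambda>j. 2 ^ j * (?d j x)\<^sup>2)"
      by (intro summable_suminf_not_top) auto
    then have "summable (\<lambda>j. ?d j x)" by (rule summable_if_pow2_squares_summable)
    then have "convergent (\<lambda>n. \<Sum>j<n. ?d j x)" by (simp add: summable_iff_convergent)
    then have "convergent (\<lambda>n. (G (r n) x - G (r 0) x))"
      using sum_lessThan_telescope[of "\<lambda>j. G (r j) x"] by (simp only:)
    then show ?case using convergent_add[OF _ convergent_const[of "G (r 0) x"]] by fastforce
  qed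
  define g where "g x = lim (\<lambda>j. G (r j) x)" for x
  have [measurable]: "g \<in> borel_measurable m" unfolding g_def by measurable
  have lim: "AE x in m. (\<lambda>j. G (r j) x) \<longlonglongrightarrow> g x"
    using conv by eventually_elim (simp add: g_def convergent_LIMSEQ_iff)
  have fatou: "(\<integral>\<^sup>+x. ennreal ((G n x - g x)\<^sup>2) \<partial>m) \<le> ennreal e"
    if e: "0 < e" and n: "\<forall>k\<ge>K. L2_sq m (\<lambda>x. G n x - G k x) \<le> e" for n e K
  proof -
    have "(\<integral>\<^sup>+x. ennreal ((G n x - g x)\<^sup>2) \<partial>m)
      = (\<integral>\<^sup>+x. liminf (\<lambda>j. ennreal ((G n x - G (r j) x)\<^sup>2)) \<partial>m)"
    proof (rule nn_integral_cong_AE, use lim in eventually_elim)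
      case (elim x)
      then have "(\<lambda>j. ennreal ((G n x - G (r j) x)\<^sup>2)) \<longlonglongrightarrow> ennreal ((G n x - g x)\<^sup>2)"
        by (intro tendsto_ennrealI tendsto_intros)
      from lim_imp_Liminf[OF _ this] show ?case by simp
    qed
    also have "\<dots> \<le> liminf (\<lambda>j. \<integral>\<^sup>+x. ennreal ((G n x - G (r j) x)\<^sup>2) \<partial>m)"
      by (rule nn_integral_liminf) measurable
    also have "\<dots> \<le> ennreal e"
    proof (rule Liminf_le)
      show "\<forall>\<^sub>F j in sequentially. (\<integral>\<^sup>+x. ennreal ((G n x - G (r j) x)\<^sup>2) \<partial>m) \<le> ennreal e"
        using eventually_ge_at_top[of K]
      proof eventually_elim
        case (elim j)
        then have "r j \<ge> K" using rN(3)[of j] by simp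
        with n show ?case unfolding inn by (intro ennreal_leI) auto
      qed
    qed simp
    finally show ?thesis .
  qed
  have g: "g \<in> L2 m"
  proof -
    from Cauchy[of 1] obtain K where K: "\<forall>n\<ge>K. \<forall>k\<ge>K. L2_sq m (\<lambda>x. G n x - G k x) \<le> 1" by auto
    then have "(\<integral>\<^sup>+x. ennreal ((G K x - g x)\<^sup>2) \<partial>m) \<le> ennreal 1" by (intro fatou[where K=K]) auto
    then have "(\<lambda>x. G K x - g x) \<in> L2 m" by (subst L2_nn) (auto intro: le_less_trans)
    from L2_diff[OF G[of K] this] show ?thesis by simp
  qed
  moreover have "L2_tendsto m G g" unfolding L2_tendsto_def
  proof (rule LIMSEQ_I)
    fix e :: real assume "0 < e"
    then obtain K where K: "\<forall>n\<ge>K. \<forall>k\<ge>K. L2_sq m (\<lambda>x. G n x - G k x) \<le> e/2"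
      using Cauchy[of "e/2"] by auto
    show "\<exists>no. \<forall>n\<ge>no. norm (L2_sq m (\<lambda>x. G n x - g x) - 0) < e"
    proof (intro exI[of _ K] allI impI)
      fix n assume "n \<ge> K"
      then have "(\<integral>\<^sup>+x. ennreal ((G n x - g x)\<^sup>2) \<partial>m) \<le> ennreal (e/2)"
        using K \<open>0 < e\<close> by (intro fatou[where K=K]) auto
      moreover have "(\<integral>\<^sup>+x. ennreal ((G n x - g x)\<^sup>2) \<partial>m) = ennreal (L2_sq m (\<lambda>x. G n x - g x))"
        using L2_D(2)[OF L2_diff[OF G g]]
          by (subst nn_integral_eq_integral) (auto simp: L2_inner_def power2_eq_square)
      ultimately have "L2_sq m (\<lambda>x. G n x - g x) \<le> e/2"
        using \<open>0 < e\<close> by (simp add: ennreal_le_iff)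
      then show "norm (L2_sq m (\<lambda>x. G n x - g x) - 0) < e"
        using \<open>0 < e\<close> L2_inner_nonneg[of m "\<lambda>x. G n x - g x"] by simp
    qed
  qed
  ultimately show thesis by (rule that)
qed

section \<open>The scale derivative and the Green function\<close>

locale scale =
  fixes S :: "real \<Rightarrow> real"
  assumes continuous_S: "continuous_on UNIV S" and strict_mono_S: "strict_mono S"
begin

abbreviation "dS \<equiv> interval_measure S"

lemma S_le_iff [simp]: "S x \<le> S y \<longleftrightarrow> x \<le> y"
  using strict_mono_S by (rule strict_mono_less_eq)

lemma S_less_iff [simp]: "S x < S y \<longleftrightarrow> x < y"
  using strict_mono_S by (rule strict_mono_less)

lemma S_measurable [measurable]: "S \<in> borel_measurable borel"
  using continuous_S by (rule borel_measurable_continuous_onI)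

lemma right_continuous_S: "continuous (at_right a) S"
  using continuous_S by (auto intro: continuous_within_subset simp: continuous_on_eq_continuous_within)

lemma emeasure_dS_Icc: "a \<le> b \<Longrightarrow> emeasure dS {a..b} = ennreal (S b - S a)"
  using continuous_S by (intro emeasure_interval_measure_Icc) auto

lemma measure_dS_Ioc: "a \<le> b \<Longrightarrow> measure dS {a<..b} = S b - S a"
  by (intro measure_interval_measure_Ioc right_continuous_S) auto

lemma emeasure_dS_Ioc: "emeasure dS {a<..b} < \<infinity>"
  by (subst emeasure_interval_measure_Ioc_eq) (auto intro: right_continuous_S)

text \<open>Continuity of \<open>S\<close> leaves \<open>dS\<close> without atoms, so closed and
  half-open intervals can be exchanged under the integral.\<close>

lemma AE_dS_neq: "AE x in dS. x \<noteq> c"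
proof -
  have "{c} \<in> null_sets dS" using emeasure_dS_Icc[of c c] by (simp add: null_sets_def)
  then have "AE x in dS. x \<notin> {c}" by (rule AE_not_in)
  then show ?thesis by simp
qed

lemma sigma_finite_dS: "sigma_finite_measure dS"
  by (intro sigma_finite_interval_measure right_continuous_S) auto

lemma L2_indicator_Ioc: "(\<lambda>x. c * indicator {a<..b} x) \<in> L2 dS"
proof -
  have "(\<lambda>x. indicator {a<..b} x :: real) \<in> L2 dS"
    using emeasure_dS_Ioc by (simp add: L2_def power2_eq_square flip: indicator_inter_arith)
  then show ?thesis by (rule L2_scale)
qed

lemma scale_derivative_integrable_Ioc:
  assumes "has_scale_derivative S F f"
  shows "set_integrable dS {u<..v} f"
proof (cases "u < v")
  case True
  then show ?thesis using assms unfolding has_scale_derivative_def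
    by (auto intro: set_integrable_subset[where A="{u..v}"])
qed (simp add: set_integrable_def)

lemma set_integral_Icc_eq_Ioc:
  fixes f :: "real \<Rightarrow> real"
  assumes "f \<in> borel_measurable borel"
  shows "set_lebesgue_integral dS {u..v} f = set_lebesgue_integral dS {u<..v} f"
  unfolding set_lebesgue_integral_def
  using assms AE_dS_neq[of u] by (intro integral_cong_AE) (auto split: split_indicator)

lemma scale_derivative_measurable:
  assumes "has_scale_derivative S F f"
  shows "f \<in> borel_measurable borel"
proof (rule borel_measurable_LIMSEQ_real)
  show "(\<lambda>x. indicator {- real n<..real n} x *\<^sub>R f x) \<in> borel_measurable borel" for n
    using scale_derivative_integrable_Ioc[OF assms, of "- real n" "real n"]
    by (auto simp: set_integrable_def dest: borel_measurable_integrable)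
  show "(\<lambda>n. indicator {- real n<..real n} x *\<^sub>R f x) \<longlonglongrightarrow> f x" for x
  proof (rule tendsto_eventually)
    obtain N where "\<bar>x\<bar> < real N" using reals_Archimedean2 by blast
    then show "\<forall>\<^sub>F n in sequentially. indicator {- real n<..real n} x *\<^sub>R f x = f x"
      by (intro eventually_sequentiallyI[of N]) (auto simp: indicator_def)
  qed
qed

lemma scale_derivative_Ioc:
  assumes "has_scale_derivative S F f" "u \<le> v"
  shows "set_lebesgue_integral dS {u<..v} f = F v - F u"
proof (cases "u = v")
  case False
  with assms show ?thesis
    unfolding set_integral_Icc_eq_Ioc[OF scale_derivative_measurable[OF assms(1)], symmetric]
    by (auto simp: has_scale_derivative_def)
qed (simp add: set_lebesgue_integral_def)

lemma has_scale_derivativeI: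
  assumes "f \<in> borel_measurable borel"
    and "\<And>u v. u < v \<Longrightarrow> set_integrable dS {u<..v} f"
    and "\<And>u v. u < v \<Longrightarrow> set_lebesgue_integral dS {u<..v} f = F v - F u"
  shows "has_scale_derivative S F f"
  unfolding has_scale_derivative_def
proof (intro allI impI conjI)
  fix u v :: real assume uv: "u < v"
  show "set_integrable dS {u..v} f"
    by (rule set_integrable_subset[OF assms(2)[of "u - 1" v]]) (use uv in auto)
  show "set_lebesgue_integral dS {u..v} f = F v - F u"
    unfolding set_integral_Icc_eq_Ioc[OF assms(1)] by (rule assms(3)[OF uv])
qed

lemma scale_derivative_diff:
  assumes "has_scale_derivative S F f" "has_scale_derivative S G g"
  shows "has_scale_derivative S (\<lambda>x. F x - G x) (\<lambda>x. f x - g x)"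
  using assms unfolding has_scale_derivative_def by (auto simp: set_integral_diff)

lemma scale_derivative_average:
  assumes "has_scale_derivative S F f" "has_scale_derivative S G g"
  shows "has_scale_derivative S (\<lambda>x. 1/2 * (F x + G x)) (\<lambda>x. 1/2 * (f x + g x))"
  using assms unfolding has_scale_derivative_def
  by (auto simp: set_integral_add add_divide_distrib diff_divide_distrib)

text \<open>Locally \<open>F\<close> is an indefinite integral against a measure without atoms, so
  dominated convergence applies. Clipping at \<open>a + 1\<close> supplies one dominating function
  for the whole sequence.\<close>

lemma scale_derivative_continuous:
  assumes F: "has_scale_derivative S F f"
  shows "continuous_on UNIV F"
  unfolding continuous_on_sequentially
proof (intro allI ballI impI, elim conjE)
  fix x :: "nat \<Rightarrow> real" and a assume lim: "x \<longlonglongrightarrow> a"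
  note [measurable] = scale_derivative_measurable[OF F]
  have ev: "\<forall>\<^sub>F n in sequentially. x n \<in> {a - 1<..<a + 1}"
    using lim by (rule topological_tendstoD) auto
  have "(\<lambda>n. \<integral>z. indicator {a - 1<..min (x n) (a + 1)} z *\<^sub>R f z \<partial>dS)
    \<longlonglongrightarrow> (\<integral>z. indicator {a - 1<..min a (a + 1)} z *\<^sub>R f z \<partial>dS)"
  proof (rule integral_dominated_convergence[where w="\<lambda>z. \<bar>indicator {a - 1<..a + 1} z *\<^sub>R f z\<bar>"])
    show "integrable dS (\<lambda>z. \<bar>indicator {a - 1<..a + 1} z *\<^sub>R f z\<bar>)"
      using scale_derivative_integrable_Ioc[OF F, of "a - 1" "a + 1"] unfolding set_integrable_def
        by simp
    show "AE z in dS. (\<lambda>n. indicator {a - 1<..min (x n) (a + 1)} z *\<^sub>R f z)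
        \<longlonglongrightarrow> indicator {a - 1<..min a (a + 1)} z *\<^sub>R f z"
      using AE_dS_neq[of a]
    proof eventually_elim
      case (elim z)
      have "\<forall>\<^sub>F n in sequentially. (z \<le> x n) = (z \<le> a)"
      proof (cases "z < a")
        case True
        with order_tendstoD(1)[OF lim True] show ?thesis by (auto elim!: eventually_mono)
      next
        case False
        with elim have "a < z" by simp
        from order_tendstoD(2)[OF lim this] this show ?thesis by (auto elim!: eventually_mono)
      qed
      then have "\<forall>\<^sub>F n in sequentially. indicator {a - 1<..min (x n) (a + 1)} z *\<^sub>R f z
        = indicator {a - 1<..min a (a + 1)} z *\<^sub>R f z"
        by eventually_elim (auto simp: indicator_def)
      then show ?case by (rule tendsto_eventually)
    qed
    show "AE z in dS. norm (indicator {a - 1<..min (x n) (a + 1)} z *\<^sub>R f z)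
      \<le> \<bar>indicator {a - 1<..a + 1} z *\<^sub>R f z\<bar>" for n
      by (auto simp: indicator_def)
  qed auto
  moreover have "\<forall>\<^sub>F n in sequentially. (\<integral>z. indicator {a - 1<..min (x n) (a + 1)} z *\<^sub>R f z \<partial>dS)
    = F (x n) - F (a - 1)"
    using ev
  proof eventually_elim
    case (elim n)
    then show ?case using scale_derivative_Ioc[OF F, of "a - 1" "x n"]
      by (simp add: set_lebesgue_integral_def min_absorb1)
  qed
  moreover have "(\<integral>z. indicator {a - 1<..min a (a + 1)} z *\<^sub>R f z \<partial>dS) = F a - F (a - 1)"
    using scale_derivative_Ioc[OF F, of "a - 1" a] by (simp add: set_lebesgue_integral_def)
  ultimately have "(\<lambda>n. F (x n) - F (a - 1)) \<longlonglongrightarrow> F a - F (a - 1)"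
    using tendsto_cong by force
  from tendsto_add[OF this tendsto_const[of "F (a - 1)"]] show "(F \<circ> x) \<longlonglongrightarrow> F a"
    by (simp add: o_def)
qed

text \<open>On a bounded interval the positive and the negative part of \<open>d\<close> are
  densities of measures that are finite and equal on all half-lines \<open>{x<..}\<close>. The two
  measures therefore agree, and so do their densities.\<close>

lemma scale_derivative_zero_unique:
  assumes d: "has_scale_derivative S (\<lambda>x. c) d"
  shows "AE x in dS. d x = 0"
proof -
  note [measurable] = scale_derivative_measurable[OF d]
  have "AE x in dS. x \<in> {-real n<..real n} \<longrightarrow> d x = 0" for n
  proof -
    let ?p = "\<lambda>x. ennreal (indicator {-real n<..real n} x * d x)"
    let ?q = "\<lambda>x. ennreal (- (indicator {-real n<..real n} x * d x))"
    have eq: "(\<integral>\<^sup>+z. ?p z * indicator {x<..} z \<partial>dS) = (\<integral>\<^sup>+z. ?q z * indicator {x<..} z \<partial>dS) \<and>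
      (\<integral>\<^sup>+z. ?p z * indicator {x<..} z \<partial>dS) < \<infinity>" for x
    proof -
      let ?d = "\<lambda>z. indicator {max x (-real n)<..real n} z *\<^sub>R d z"
      have int: "integrable dS ?d"
        using scale_derivative_integrable_Ioc[OF d] unfolding set_integrable_def .
      have "integral\<^sup>L dS ?d = 0"
      proof (cases "max x (-real n) \<le> real n")
        case True
        show ?thesis using scale_derivative_Ioc[OF d True] unfolding set_lebesgue_integral_def by simp
      qed simp
      then have eq: "enn2real (\<integral>\<^sup>+z. ennreal (?d z) \<partial>dS) = enn2real (\<integral>\<^sup>+z. ennreal (- ?d z) \<partial>dS)"
        using real_lebesgue_integral_def[OF int] by simp
      have fin: "(\<integral>\<^sup>+z. ennreal (?d z) \<partial>dS) < \<infinity>" "(\<integral>\<^sup>+z. ennreal (- ?d z) \<partial>dS) < \<infinity>"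
        using int by (auto simp: real_integrable_def top.not_eq_extremum)
      have enn: "a = b" if "enn2real a = enn2real b" "a < \<infinity>" "b < \<infinity>" for a b :: ennreal
        using that by (cases a; cases b) auto
      have "(\<integral>\<^sup>+z. ennreal (?d z) \<partial>dS) = (\<integral>\<^sup>+z. ennreal (- ?d z) \<partial>dS)"
        by (rule enn[OF eq fin])
      moreover have "?p z * indicator {x<..} z = ennreal (?d z)"
        "?q z * indicator {x<..} z = ennreal (- ?d z)" for z
        by (auto simp: indicator_def)
      ultimately show ?thesis using fin by simp
    qed
    have "density dS ?p = density dS ?q"
    proof (rule measure_eqI_lessThan)
      show "emeasure (density dS ?p) {x<..} < \<infinity>" for x using conjunct2[OF eq[of x]]
        by (simp add: emeasure_density)
      show "emeasure (density dS ?p) {x<..} = emeasure (density dS ?q) {x<..}" for x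
        using eq[of x] by (simp add: emeasure_density)
    qed auto
    then have "AE x in dS. ?p x = ?q x"
      by (intro sigma_finite_measure.density_unique[OF sigma_finite_dS]) auto
    then show ?thesis
    proof eventually_elim
      case (elim x)
      have "c = 0" if "ennreal c = ennreal (- c)" for c
        using that by (cases "0 \<le> c") (auto simp: ennreal_eq_0_iff ennreal_neg)
      from this[OF elim] show ?case by (auto simp: indicator_def split: if_splits)
    qed
  qed
  then have "AE x in dS. \<forall>n. x \<in> {-real n<..real n} \<longrightarrow> d x = 0" unfolding AE_all_countable by blast
  then show ?thesis
  proof eventually_elim
    case (elim x)
    obtain N where "\<bar>x\<bar> < real N" using reals_Archimedean2 by blast
    then have "x \<in> {-real N<..real N}" by auto
    with elim show ?case by blast
  qed
qed

lemma scale_derivative_unique: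
  assumes "has_scale_derivative S F f" "has_scale_derivative S F g"
  shows "AE x in dS. f x = g x"
proof -
  have "AE x in dS. f x - g x = 0"
    using scale_derivative_diff[OF assms] by (intro scale_derivative_zero_unique[where c=0]) simp
  then show ?thesis by simp
qed

section \<open>The energy bound and its lower semicontinuity\<close>

definition energy_le :: "real measure \<Rightarrow> real \<Rightarrow> (real \<Rightarrow> real) \<Rightarrow> bool" where
  "energy_le m C F \<longleftrightarrow> F \<in> L2 m \<and> (\<exists>F' f. (AE x in m. F x = F' x) \<and> has_scale_derivative S F' f \<and>
     f \<in> L2 dS \<and> L2_sq dS f \<le> C)"

lemma energy_le_mono: "energy_le m C F \<Longrightarrow> C \<le> C' \<Longrightarrow> energy_le m C' F"
  unfolding energy_le_def by (meson order_trans)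

lemma energy_le_lsc:
  assumes sets_m: "sets m = sets borel" and m0: "emeasure m UNIV \<noteq> 0" and F: "F \<in> L2 m"
    and ex: "\<And>e. 0 < e \<Longrightarrow> \<exists>G g. G \<in> L2 m \<and> has_scale_derivative S G g \<and> g \<in> L2 dS \<and>
      L2_sq m (\<lambda>x. G x - F x) \<le> e \<and> L2_sq dS g \<le> C + e"
  shows "energy_le m C F"
proof -
  \<comment> \<open>By the parallelogram law near-minimisers of the energy over the decreasing convex sets \<open>K n\<close> form
    a Cauchy sequence; this avoids weak compactness.\<close>
  define K where "K n = {(G, g). G \<in> L2 m \<and> has_scale_derivative S G g \<and> g \<in> L2 dS \<and>
      L2_sq m (\<lambda>x. G x - F x) \<le> 1 / real (Suc n)}" for n
  define d where "d n = (INF p\<in>K n. L2_sq dS (snd p))" for n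
  have bdd: "bdd_below ((\<lambda>p. L2_sq dS (snd p)) ` K n)" for n
    by (rule bdd_belowI2[of _ 0]) (rule L2_inner_nonneg)
  have approx: "\<exists>p\<in>K n. L2_sq dS (snd p) \<le> C + e" if e: "0 < e" for n e
  proof -
    from ex[of "min e (1 / real (Suc n))"] e obtain G g where
      "G \<in> L2 m" "has_scale_derivative S G g" "g \<in> L2 dS"
      "L2_sq m (\<lambda>x. G x - F x) \<le> min e (1 / real (Suc n))" "L2_sq dS g \<le> C + min e (1 / real (Suc n))"
      by auto
    then show ?thesis by (intro bexI[of _ "(G, g)"]) (auto simp: K_def)
  qed
  have K_ne: "K n \<noteq> {}" for n using approx[of 1 n] by auto
  have d_le: "d n \<le> L2_sq dS (snd p)" if "p \<in> K n" for n p
    unfolding d_def using bdd that by (rule cINF_lower)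
  have dC: "d n \<le> C" for n
  proof (rule field_le_epsilon)
    fix e :: real assume "0 < e"
    from approx[OF this, of n] d_le[of _ n] show "d n \<le> C + e" by (meson order_trans)
  qed
  have K_mono: "K k \<subseteq> K n" if "n \<le> k" for n k
  proof -
    have "1 / real (Suc k) \<le> 1 / real (Suc n)" using that by (simp add: frac_le)
    then show ?thesis by (auto simp: K_def)
  qed
  have "incseq d"
    unfolding incseq_def d_def by (intro allI impI cINF_superset_mono K_ne bdd K_mono) auto
  with dC obtain D where D: "d \<longlonglongrightarrow> D" using incseq_convergent by blast
  have "\<exists>p\<in>K n. L2_sq dS (snd p) < d n + 1 / real (Suc n)" for n
    using cINF_less_iff[OF K_ne bdd, of n "d n + 1 / real (Suc n)"] by (simp add: d_def[symmetric])
  then obtain p where p: "\<And>n. p n \<in> K n" "\<And>n. L2_sq dS (snd (p n)) < d n + 1 / real (Suc n)"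
    by metis
  define G where "G n = fst (p n)" for n
  define g where "g n = snd (p n)" for n
  have G: "G n \<in> L2 m" "has_scale_derivative S (G n) (g n)" "g n \<in> L2 dS"
    "L2_sq m (\<lambda>x. G n x - F x) \<le> 1 / real (Suc n)" for n
    using p(1)[of n] by (auto simp: K_def G_def g_def)
  have g_le: "L2_sq dS (g n) \<le> d n + 1 / real (Suc n)" for n
    using p(2)[of n] by (simp add: g_def)
  have par: "L2_sq dS (\<lambda>x. g n x - g k x)
      \<le> 2 * (d k - d n) + 2 / real (Suc n) + 2 / real (Suc k)" if nk: "n \<le> k" for n k
  proof -
    \<comment> \<open>Convexity keeps the midpoint in \<open>K n\<close>, so \<open>4 * d n\<close>
      bounds the energy of the sum from below; the parallelogram law then bounds the energy of the
      difference.\<close>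
    have mid: "((\<lambda>x. 1/2 * (G n x + G k x)), (\<lambda>x. 1/2 * (g n x + g k x))) \<in> K n"
      unfolding K_def
    proof (clarify, intro conjI)
      show "(\<lambda>x. 1/2 * (G n x + G k x)) \<in> L2 m" by (intro L2_scale L2_add G)
      show "(\<lambda>x. 1/2 * (g n x + g k x)) \<in> L2 dS" by (intro L2_scale L2_add G)
      show "has_scale_derivative S (\<lambda>x. 1/2 * (G n x + G k x)) (\<lambda>x. 1/2 * (g n x + g k x))"
        by (intro scale_derivative_average G)
      let ?A = "\<lambda>x. 1/2 * (G n x - F x)" and ?B = "\<lambda>x. 1/2 * (G k x - F x)"
      have AB: "?A \<in> L2 m" "?B \<in> L2 m" by (intro L2_scale L2_diff G F)+
      have sc: "L2_sq m (\<lambda>x. 1/2 * H x) = 1/4 * L2_sq m H" for H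
        using L2_inner_scale_left[of m "1/4" H H]
          by (simp add: L2_inner_def mult.assoc mult.left_commute)
      have "L2_sq m (\<lambda>x. 1/2 * (G n x + G k x) - F x)
        = L2_sq m (\<lambda>x. ?A x + ?B x)"
      proof -
        have "(\<lambda>x. 1/2 * (G n x + G k x) - F x) = (\<lambda>x. ?A x + ?B x)" by (auto simp: field_simps)
        then show ?thesis by simp
      qed
      also have "\<dots> \<le> 2 * (L2_sq m ?A + L2_sq m ?B)"
        unfolding L2_inner_add_self[OF AB] using L2_inner_young[OF AB] by simp
      also have "\<dots> \<le> 1/2 * (1 / real (Suc n)) + 1/2 * (1 / real (Suc k))"
      proof -
        have "A \<le> e \<Longrightarrow> B \<le> f \<Longrightarrow> 2 * (1/4 * A + 1/4 * B) \<le> 1/2 * e + 1/2 * f" for A B e f :: real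
          by (simp add: field_simps)
        from this[OF G(4)[of n] G(4)[of k]] show ?thesis unfolding sc .
      qed
      also have "\<dots> \<le> 1 / real (Suc n)"
      proof -
        have "1 / real (Suc k) \<le> 1 / real (Suc n)" using nk by (simp add: frac_le)
        moreover have "f \<le> e \<Longrightarrow> 1/2 * e + 1/2 * f \<le> e" for e f :: real by simp
        ultimately show ?thesis by blast
      qed
      finally show "L2_sq m (\<lambda>x. 1/2 * (G n x + G k x) - F x) \<le> 1 / real (Suc n)" .
    qed
    have "d n \<le> L2_sq dS (\<lambda>x. 1/2 * (g n x + g k x))"
      using d_le[OF mid] by simp
    also have "\<dots> = 1/4 * L2_sq dS (\<lambda>x. g n x + g k x)"
      using L2_inner_scale_left[of dS "1/4" "\<lambda>x. g n x + g k x" "\<lambda>x. g n x + g k x"]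
      by (simp add: L2_inner_def mult.assoc mult.left_commute)
    finally have "4 * d n \<le> L2_sq dS (\<lambda>x. g n x + g k x)" by simp
    moreover have "a \<le> x + e \<Longrightarrow> b \<le> y + f \<Longrightarrow> D = a - 2 * c + b \<Longrightarrow> E = a + 2 * c + b \<Longrightarrow> 4 * x \<le> E \<Longrightarrow>
      D \<le> 2 * (y - x) + 2 * e + 2 * f" for a b c x y e f D E :: real by argo
    ultimately have "L2_sq dS (\<lambda>x. g n x - g k x)
      \<le> 2 * (d k - d n) + 2 * (1 / real (Suc n)) + 2 * (1 / real (Suc k))"
      using g_le[of n] g_le[of k] L2_inner_diff_self[OF G(3,3), of n k]
        L2_inner_add_self[OF G(3,3), of n k]
      by blast
    then show ?thesis by simp
  qed
  have dist_small: "\<exists>N. \<forall>n\<ge>N. \<forall>k\<ge>N. L2_sq dS (\<lambda>x. g n x - g k x) \<le> e" if e: "0 < e" for e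
  proof -
    from D have "Cauchy d" by (intro LIMSEQ_imp_Cauchy)
    then obtain N1 where N1: "\<And>n k. n \<ge> N1 \<Longrightarrow> k \<ge> N1 \<Longrightarrow> \<bar>d k - d n\<bar> < e/8"
      using e by (metis Cauchy_def dist_real_def zero_less_divide_iff zero_less_numeral)
    obtain N2 where N2: "inverse (real (Suc N2)) < e/8" using e reals_Archimedean[of "e/8"] by auto
    have inv: "1 / real (Suc n) \<le> e/8" if "n \<ge> N2" for n
    proof -
      have "1 / real (Suc n) \<le> 1 / real (Suc N2)" using that by (simp add: frac_le)
      with N2 show ?thesis by (simp add: inverse_eq_divide)
    qed
    have main: "L2_sq dS (\<lambda>x. g n x - g k x) \<le> e"
      if nk: "n \<ge> max N1 N2" "k \<ge> max N1 N2" "n \<le> k" for n k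
    proof -
      have "\<bar>d k - d n\<bar> < e/8" "1 / real (Suc n) \<le> e/8" "1 / real (Suc k) \<le> e/8"
        by (rule N1 inv; use nk in simp)+
      moreover have "2 / real (Suc n) = 2 * (1 / real (Suc n))"
        "2 / real (Suc k) = 2 * (1 / real (Suc k))" by simp_all
      ultimately show ?thesis using par[OF nk(3)] e by argo
    qed
    have sym: "L2_sq dS (\<lambda>x. g n x - g k x) = L2_sq dS (\<lambda>x. g k x - g n x)" for n k
      by (simp add: L2_inner_def algebra_simps)
    show ?thesis using main sym by (metis nle_le)
  qed
  obtain g' where g': "g' \<in> L2 dS" "L2_tendsto dS g g'"
    by (rule L2_complete[of g dS]) (use G(3) dist_small in auto)
  have int_lim: "(\<lambda>n. set_lebesgue_integral dS {u<..v} (g n)) \<longlonglongrightarrow> set_lebesgue_integral dS {u<..v} g'"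
    for u v
    using L2_inner_tendsto_left[OF G(3) g'(1) L2_indicator_Ioc[of 1 u v] g'(2)]
    by (simp add: L2_inner_def set_lebesgue_integral_def mult.commute)
  have inv_lim: "(\<lambda>n. 1 / real (Suc n)) \<longlonglongrightarrow> 0" by (rule LIMSEQ_Suc[OF lim_1_over_n])
  have "L2_tendsto m G F"
    unfolding L2_tendsto_def
    by (rule tendsto_sandwich[OF _ _ tendsto_const inv_lim]) (use G(4) in \<open>auto simp: L2_inner_nonneg\<close>)
  from L2_tendsto_AE_subseq[OF G(1) F this]
  obtain r :: "nat \<Rightarrow> nat" where r: "strict_mono r" "AE x in m. (\<lambda>n. G (r n) x) \<longlonglongrightarrow> F x" by blast
  \<comment> \<open>One point of convergence serves as integration constant: increments converge
    everywhere, because the derivatives converge in L2. Such a point exists since \<open>m\<close>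
    is not the zero measure.\<close>
  obtain x0 where x0: "(\<lambda>n. G (r n) x0) \<longlonglongrightarrow> F x0"
  proof (rule ccontr)
    assume "\<not> thesis"
    with that have none: "\<not> (\<lambda>n. G (r n) x) \<longlonglongrightarrow> F x" for x by blast
    have "AE x in m. False" using r(2) by eventually_elim (use none in auto)
    moreover have "space m = UNIV" using sets_eq_imp_space_eq[OF sets_m] by simp
    ultimately show False using m0
      by (simp add: AE_iff_measurable[OF _ refl] eventually_False trivial_limit_def[symmetric]
        ae_filter_eq_bot_iff)
  qed
  have G_diff: "G n v - G n u = set_lebesgue_integral dS {u<..v} (g n)" if "u \<le> v" for n u v
    using scale_derivative_Ioc[OF G(2) that, of n] by simp
  have int_lim_r: "(\<lambda>n. set_lebesgue_integral dS {u<..v} (g (r n)))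
    \<longlonglongrightarrow> set_lebesgue_integral dS {u<..v} g'" for u v
    using LIMSEQ_subseq_LIMSEQ[OF int_lim r(1)] by (simp add: o_def)
  have conv: "convergent (\<lambda>n. G (r n) v)" for v
  proof (cases "x0 \<le> v")
    case True
    have "(\<lambda>n. G (r n) x0 + set_lebesgue_integral dS {x0<..v} (g (r n)))
      \<longlonglongrightarrow> F x0 + set_lebesgue_integral dS {x0<..v} g'"
      by (intro tendsto_add x0 int_lim_r)
    then show ?thesis using G_diff[OF True, symmetric] by (auto simp: convergent_def)
  next
    case False
    then have "v \<le> x0" by simp
    have "(\<lambda>n. G (r n) x0 - set_lebesgue_integral dS {v<..x0} (g (r n)))
      \<longlonglongrightarrow> F x0 - set_lebesgue_integral dS {v<..x0} g'"
      by (intro tendsto_diff x0 int_lim_r)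
    then show ?thesis using G_diff[OF \<open>v \<le> x0\<close>, symmetric] by (auto simp: convergent_def)
  qed
  define F' where "F' v = lim (\<lambda>n. G (r n) v)" for v
  have F': "(\<lambda>n. G (r n) v) \<longlonglongrightarrow> F' v" for v
    using conv[of v] by (simp add: F'_def convergent_LIMSEQ_iff)
  have "AE x in m. F x = F' x"
    using r(2) by eventually_elim (use F' LIMSEQ_unique in blast)
  moreover have "has_scale_derivative S F' g'"
  proof (rule has_scale_derivativeI)
    show "g' \<in> borel_measurable borel" using L2_D(1)[OF g'(1)] by simp
    fix u v :: real assume "u < v"
    show "set_integrable dS {u<..v} g'"
      using L2_integrable_mult[OF L2_indicator_Ioc[of 1 u v] g'(1)] by (simp add: set_integrable_def)
    have "(\<lambda>n. G (r n) v - G (r n) u) \<longlonglongrightarrow> F' v - F' u" by (intro tendsto_diff F')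
    with int_lim_r[of u v] \<open>u < v\<close> show "set_lebesgue_integral dS {u<..v} g' = F' v - F' u"
      by (simp add: G_diff LIMSEQ_unique)
  qed
  moreover have "L2_sq dS g' \<le> C"
  proof (rule LIMSEQ_le)
    show "(\<lambda>n. L2_sq dS (g n)) \<longlonglongrightarrow> L2_sq dS g'"
      by (intro L2_inner_tendsto G g')
    show "(\<lambda>n. C + 1 / real (Suc n)) \<longlonglongrightarrow> C" using tendsto_add[OF tendsto_const inv_lim] by simp
    show "\<exists>N. \<forall>n\<ge>N. L2_sq dS (g n) \<le> C + 1 / real (Suc n)"
      using g_le dC by (metis add_right_mono order_trans)
  qed
  ultimately show ?thesis unfolding energy_le_def using F g'(1) by blast
qed

text \<open>\<open>energy_le\<close> speaks of classes, whereas \<open>energy_le_lsc\<close> asks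
  for approximants that have a derivative themselves. Each \<open>Fn n\<close> is replaced by its
  version \<open>F'\<close>, which has the same distance from \<open>F\<close>.\<close>

lemma energy_le_limit:
  assumes "sets m = sets borel" "emeasure m UNIV \<noteq> 0" "F \<in> L2 m"
    and Fn: "\<And>n. energy_le m (c n) (Fn n)" and lim: "L2_tendsto m Fn F" "c \<longlonglongrightarrow> C"
  shows "energy_le m C F"
proof (rule energy_le_lsc[OF assms(1-3)])
  fix e :: real assume e: "0 < e"
  have "\<forall>\<^sub>F n in sequentially. L2_sq m (\<lambda>x. Fn n x - F x) < e"
    using lim(1) e unfolding L2_tendsto_def by (rule order_tendstoD(2))
  moreover have "\<forall>\<^sub>F n in sequentially. c n < C + e"
    using lim(2) e by (intro order_tendstoD(2)) auto
  ultimately have "\<forall>\<^sub>F n in sequentially. L2_sq m (\<lambda>x. Fn n x - F x) < e \<and> c n < C + e"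
    by (rule eventually_conj)
  then obtain n where n: "L2_sq m (\<lambda>x. Fn n x - F x) < e" "c n < C + e"
    by (auto simp: eventually_sequentially)
  from Fn[of n] obtain F' f where F': "Fn n \<in> L2 m" "AE x in m. Fn n x = F' x"
    "has_scale_derivative S F' f" "f \<in> L2 dS" "L2_sq dS f \<le> c n"
    unfolding energy_le_def by blast
  have meas: "F' \<in> borel_measurable m"
    using borel_measurable_continuous_onI[OF scale_derivative_continuous[OF F'(3)]] assms(1)
      measurable_cong_sets by blast
  have [measurable]: "Fn n \<in> borel_measurable m" "F \<in> borel_measurable m" "F' \<in> borel_measurable m"
    using F'(1) assms(3) meas by (auto dest: L2_D)
  have "L2_sq m (\<lambda>x. F' x - F x) = L2_sq m (\<lambda>x. Fn n x - F x)"
    using F'(2) by (intro L2_inner_cong_AE) auto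
  then show "\<exists>G g. G \<in> L2 m \<and> has_scale_derivative S G g \<and> g \<in> L2 dS \<and>
      L2_sq m (\<lambda>x. G x - F x) \<le> e \<and> L2_sq dS g \<le> C + e"
    using n F' L2_cong_AE[OF F'(1) meas F'(2)] by (intro exI[of _ F'] exI[of _ f]) auto
qed

section \<open>The Green function and its potentials\<close>

lemma green_eq:
  assumes "a < b" "x \<in> {a..b}" "y \<in> {a..b}"
  shows "green S a b x y = S (min x y) - S a - (S x - S a) * (S y - S a) / (S b - S a)"
proof -
  have "S b - S a \<noteq> 0" using assms(1) by (metis S_less_iff less_irrefl right_minus_eq)
  then show ?thesis
    unfolding green_def by (cases "x \<le> y") (simp_all add: max_def min_def field_simps)
qed

lemma green_nonneg: "a < b \<Longrightarrow> x \<in> {a..b} \<Longrightarrow> y \<in> {a..b} \<Longrightarrow> 0 \<le> green S a b x y"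
  unfolding green_def by (intro divide_nonneg_nonneg mult_nonneg_nonneg) (auto simp: max_def min_def)

lemma green_le:
  assumes "a < b" "x \<in> {a..b}" "y \<in> {a..b}"
  shows "green S a b x y \<le> S b - S a"
proof -
  have "0 \<le> (S x - S a) * (S y - S a) / (S b - S a)"
    using assms by (intro divide_nonneg_nonneg mult_nonneg_nonneg) auto
  moreover have "S (min x y) \<le> S b" using assms by (auto simp: min_def)
  ultimately show ?thesis unfolding green_eq[OF assms] by linarith
qed

lemma green_measurable [measurable]: "(\<lambda>y. green S a b x y) \<in> borel_measurable borel"
  unfolding green_def by measurable

lemma green_integrable:
  assumes m: "finite_measure m" "sets m = sets borel"
    and ab: "a < b" and x: "x \<in> {a..b}" and g: "g \<in> borel_measurable borel" "\<And>y. \<bar>g y\<bar> \<le> B"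
  shows "integrable m (\<lambda>y. indicator {a<..<b} y * green S a b x y * g y)"
proof (rule finite_measure.integrable_const_bound[OF m(1), where B="(S b - S a) * B"])
  note [measurable] = g(1)
  note [measurable_cong] = m(2)
  have B: "0 \<le> B" using g(2)[of 0] by linarith
  show "AE y in m. norm (indicator {a<..<b} y * green S a b x y * g y) \<le> (S b - S a) * B"
  proof (rule AE_I2)
    fix y
    show "norm (indicator {a<..<b} y * green S a b x y * g y) \<le> (S b - S a) * B"
    proof (cases "a < y \<and> y < b")
      case True
      then have "\<bar>green S a b x y\<bar> * \<bar>g y\<bar> \<le> (S b - S a) * B"
        using green_nonneg[OF ab x, of y] green_le[OF ab x, of y] g(2) ab B by (intro mult_mono) auto
      with True show ?thesis by (simp add: abs_mult)
    qed (use ab B in auto)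
  qed
  show "(\<lambda>y. indicator {a<..<b} y * green S a b x y * g y) \<in> borel_measurable m" by measurable
qed

text \<open>The derivative \<open>\<partial>G(a,b,z,y)/\<partial>S(z)\<close> of the Green function.\<close>

definition green_deriv :: "real \<Rightarrow> real \<Rightarrow> real \<Rightarrow> real \<Rightarrow> real" where
  "green_deriv a b z y = indicator {a<..<b} z * indicator {a<..<b} y *
     (indicator {z<..} y - (S y - S a) / (S b - S a))"

lemma green_deriv_measurable [measurable]:
  "(\<lambda>p. green_deriv a b (fst p) (snd p)) \<in> borel_measurable (borel \<Otimes>\<^sub>M borel)"
proof -
  have "green_deriv a b (fst p) (snd p) = indicator {a<..<b} (fst p) * indicator {a<..<b} (snd p) *
     ((if fst p < snd p then 1 else 0) - (S (snd p) - S a) / (S b - S a))" for p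
    by (auto simp: green_deriv_def indicator_def)
  then show ?thesis by simp
qed

lemma abs_green_deriv_le:
  assumes "a < b"
  shows "\<bar>green_deriv a b z y\<bar> \<le> indicator {a<..<b} z * indicator {a<..<b} y"
proof (cases "z \<in> {a<..<b} \<and> y \<in> {a<..<b}")
  case True
  then have "0 \<le> (S y - S a) / (S b - S a)" "(S y - S a) / (S b - S a) \<le> 1"
    using assms by (auto simp: divide_le_eq)
  then show ?thesis using True by (auto simp: green_deriv_def indicator_def)
qed (auto simp: green_deriv_def)

lemma abs_green_deriv_le_Ioc:
  assumes "a < b"
  shows "\<bar>green_deriv a b z y\<bar> \<le> indicator {a<..b} z"
  using abs_green_deriv_le[OF assms, of z y]
  by (rule order_trans) (auto simp: indicator_def)

text \<open>Integration by parts for a single kernel: the indicator accumulates \<open>h\<close> up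
  to \<open>y\<close>, and the other term subtracts the interpolation of \<open>v\<close> between
  \<open>a\<close> and \<open>b\<close> that is affine in \<open>S\<close>. If \<open>v\<close>
  vanishes at both endpoints, only \<open>v y\<close> is left.\<close>

lemma integral_green_deriv:
  assumes ab: "a < b" and v: "has_scale_derivative S v h" and y: "a < y" "y < b"
  shows "(\<integral>z. green_deriv a b z y * h z \<partial>dS) = v y - v a - (S y - S a) / (S b - S a) * (v b - v a)"
proof -
  note [measurable] = scale_derivative_measurable[OF v]
  have "(\<integral>z. green_deriv a b z y * h z \<partial>dS) =
    (\<integral>z. indicator {a<..y} z *\<^sub>R h z - (S y - S a) / (S b - S a) * (indicator {a<..b} z *\<^sub>R h z) \<partial>dS)"
  proof (rule integral_cong_AE)
    show "AE z in dS. green_deriv a b z y * h z =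
        indicator {a<..y} z *\<^sub>R h z - (S y - S a) / (S b - S a) * (indicator {a<..b} z *\<^sub>R h z)"
      using AE_dS_neq[of y] AE_dS_neq[of b]
      by eventually_elim (use y in \<open>auto simp: green_deriv_def indicator_def algebra_simps\<close>)
    show "(\<lambda>z. green_deriv a b z y * h z) \<in> borel_measurable dS"
      using measurable_compose[OF _ green_deriv_measurable, of "\<lambda>z. (z, y)" borel a b] by simp
  qed simp
  also have "\<dots> = v y - v a - (S y - S a) / (S b - S a) * (v b - v a)"
    using scale_derivative_integrable_Ioc[OF v, of a y] scale_derivative_integrable_Ioc[OF v, of a b]
      scale_derivative_Ioc[OF v, of a y] scale_derivative_Ioc[OF v, of a b] y
    by (subst Bochner_Integration.integral_diff)
      (auto simp: set_integrable_def set_lebesgue_integral_def)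
  finally show ?thesis .
qed

lemma scale_derivative_S: "has_scale_derivative S S (\<lambda>_. 1)"
proof (rule has_scale_derivativeI)
  fix u v :: real assume uv: "u < v"
  show "set_integrable dS {u<..v} (\<lambda>_. 1::real)"
    using L2_D[OF L2_indicator_Ioc[of 1 u v]]
      by (simp add: set_integrable_def power2_eq_square flip: indicator_inter_arith)
  show "set_lebesgue_integral dS {u<..v} (\<lambda>_. 1::real) = S v - S u"
    using measure_dS_Ioc[of u v] uv by (simp add: set_lebesgue_integral_def)
qed simp

text \<open>Functions frozen outside an interval are used twice: a clamped \<open>S\<close> tests
  the Green potential, and clamped pieces make up the cut-off functions.\<close>

lemma scale_derivative_clamp:
  assumes F: "has_scale_derivative S F f" and pq: "p \<le> q"
  shows "has_scale_derivative S (\<lambda>x. F (min q (max p x))) (\<lambda>x. indicator {p<..q} x * f x)"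
proof (rule has_scale_derivativeI)
  note [measurable] = scale_derivative_measurable[OF F]
  show "(\<lambda>x. indicator {p<..q} x * f x) \<in> borel_measurable borel" by measurable
  fix u v :: real assume uv: "u < v"
  have eq: "(\<lambda>x. indicator {u<..v} x *\<^sub>R (indicator {p<..q} x * f x))
    = (\<lambda>x. indicator {max u p<..min v q} x *\<^sub>R f x)"
    by (auto simp: indicator_def fun_eq_iff)
  show "set_integrable dS {u<..v} (\<lambda>x. indicator {p<..q} x * f x)"
    using scale_derivative_integrable_Ioc[OF F] unfolding set_integrable_def eq .
  show "set_lebesgue_integral dS {u<..v} (\<lambda>x. indicator {p<..q} x * f x)
    = F (min q (max p v)) - F (min q (max p u))"
  proof (cases "max u p \<le> min v q")
    case True
    then have "p \<le> v" "u \<le> q" by auto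
    then have *: "min q (max p v) = min v q" "min q (max p u) = max u p" using pq
      by (auto simp: min_def max_def)
    show ?thesis using scale_derivative_Ioc[OF F True] unfolding set_lebesgue_integral_def eq * .
  next
    case False
    then have "min q (max p v) = min q (max p u)" using pq uv
      by (auto simp: min_def max_def split: if_splits)
    then show ?thesis unfolding set_lebesgue_integral_def eq using False by simp
  qed
qed

lemma scale_derivative_scale:
  assumes "has_scale_derivative S F f"
  shows "has_scale_derivative S (\<lambda>x. c * F x) (\<lambda>x. c * f x)"
  using assms unfolding has_scale_derivative_def by (auto simp: right_diff_distrib)

lemma scale_derivative_add:
  assumes "has_scale_derivative S F f" "has_scale_derivative S G g"
  shows "has_scale_derivative S (\<lambda>x. F x + G x) (\<lambda>x. f x + g x)"
  using assms unfolding has_scale_derivative_def by (auto simp: set_integral_add)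

lemma scale_derivative_add_const:
  assumes "has_scale_derivative S F f"
  shows "has_scale_derivative S (\<lambda>x. F x + c) f"
  using assms unfolding has_scale_derivative_def by auto

text \<open>The formula \<open>green\<close> has no meaning for \<open>x\<close> outside
  \<open>[a,b]\<close>, hence the outer indicator. Since \<open>green\<close> vanishes at
  \<open>x = a\<close> and \<open>x = b\<close>, the indicator causes no jump.\<close>

definition green_potential :: "real measure \<Rightarrow> real \<Rightarrow> real \<Rightarrow> (real \<Rightarrow> real) \<Rightarrow> real \<Rightarrow> real" where
  "green_potential m a b g x
    = indicator {a<..<b} x * (\<integral>y. indicator {a<..<b} y * green S a b x y * g y \<partial>m)"

definition green_potential_deriv :: "real measure \<Rightarrow> real \<Rightarrow> real \<Rightarrow> (real \<Rightarrow> real) \<Rightarrow> real \<Rightarrow> real" where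
  "green_potential_deriv m a b g z = (\<integral>y. green_deriv a b z y * g y \<partial>m)"

text \<open>Fubini applied to \<open>integral_green_deriv\<close>. Integrability on the product
  comes from the boundedness of \<open>g\<close> and of the kernel, the finiteness of
  \<open>m\<close> and the local integrability of \<open>h\<close>.\<close>

lemma integral_green_potential_deriv:
  assumes m: "finite_measure m" "sets m = sets borel" and ab: "a < b"
    and g: "g \<in> borel_measurable borel" "\<And>y. \<bar>g y\<bar> \<le> B" and v: "has_scale_derivative S v h"
  shows "integrable dS (\<lambda>z. green_potential_deriv m a b g z * h z)"
    and "(\<integral>z. green_potential_deriv m a b g z * h z \<partial>dS) =
      (\<integral>y. indicator {a<..<b} y * g y * (v y - v a - (S y - S a) / (S b - S a) * (v b - v a)) \<partial>m)"
proof -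
  interpret m: finite_measure m by fact
  interpret dS: sigma_finite_measure dS by (rule sigma_finite_dS)
  interpret pair_sigma_finite dS m ..
  note [measurable] = scale_derivative_measurable[OF v] g(1)
  note [measurable_cong] = m(2)
  let ?\<psi> = "\<lambda>p. green_deriv a b (fst p) (snd p) * g (snd p) * h (fst p)"
  have B: "0 \<le> B" using g(2)[of 0] by linarith
  have int_h: "integrable dS (\<lambda>z. indicator {a<..b} z *\<^sub>R h z)"
    using scale_derivative_integrable_Ioc[OF v] by (simp add: set_integrable_def)
  have int: "integrable (dS \<Otimes>\<^sub>M m) ?\<psi>"
  proof (rule integrableI_bounded)
    show "?\<psi> \<in> borel_measurable (dS \<Otimes>\<^sub>M m)" by measurable
    have "(\<integral>\<^sup>+p. ennreal (norm (?\<psi> p)) \<partial>(dS \<Otimes>\<^sub>M m)) \<le>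
      (\<integral>\<^sup>+p. ennreal (B * \<bar>indicator {a<..b} (fst p) *\<^sub>R h (fst p)\<bar>) \<partial>(dS \<Otimes>\<^sub>M m))"
    proof (intro nn_integral_mono ennreal_leI)
      fix p
      have "\<bar>green_deriv a b (fst p) (snd p)\<bar> * \<bar>g (snd p)\<bar> \<le> indicator {a<..b} (fst p) * B"
        by (intro mult_mono abs_green_deriv_le_Ioc ab g(2)) auto
      then have "\<bar>green_deriv a b (fst p) (snd p)\<bar> * \<bar>g (snd p)\<bar> * \<bar>h (fst p)\<bar>
        \<le> indicator {a<..b} (fst p) * B * \<bar>h (fst p)\<bar>"
        by (rule mult_right_mono) simp
      then show "norm (?\<psi> p) \<le> B * \<bar>indicator {a<..b} (fst p) *\<^sub>R h (fst p)\<bar>"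
        by (simp add: abs_mult ac_simps)
    qed
    also have "\<dots> = (\<integral>\<^sup>+z. ennreal (B * \<bar>indicator {a<..b} z *\<^sub>R h z\<bar>) * emeasure m (space m) \<partial>dS)"
      by (subst m.nn_integral_fst[symmetric]) (simp_all add: nn_integral_const)
    also have "\<dots> = ennreal B * (\<integral>\<^sup>+z. ennreal (norm (indicator {a<..b} z *\<^sub>R h z)) \<partial>dS) * emeasure m
      (space m)"
      using B by (simp add: nn_integral_multc ennreal_mult nn_integral_cmult)
    also have "\<dots> < \<infinity>"
      using int_h m.emeasure_finite[of "space m"]
      by (auto simp: integrable_iff_bounded ennreal_mult_eq_top_iff less_top[symmetric])
    finally show "(\<integral>\<^sup>+p. ennreal (norm (?\<psi> p)) \<partial>(dS \<Otimes>\<^sub>M m)) < \<infinity>" .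
  qed
  have eq: "green_potential_deriv m a b g z * h z = (\<integral>y. ?\<psi> (z, y) \<partial>m)" for z
    by (simp add: green_potential_deriv_def)
  show "integrable dS (\<lambda>z. green_potential_deriv m a b g z * h z)"
    unfolding eq using integrable_fst'[OF int] .
  have "(\<integral>z. green_potential_deriv m a b g z * h z \<partial>dS) = (\<integral>y. \<integral>z. ?\<psi> (z, y) \<partial>dS \<partial>m)"
    unfolding eq using Fubini_integral[of "\<lambda>z y. ?\<psi> (z, y)"] int by (simp add: case_prod_unfold)
  also have "\<dots> = (\<integral>y. indicator {a<..<b} y * g y * (v y - v a - (S y - S a) / (S b - S a) * (v b - v a))
    \<partial>m)"
  proof (rule Bochner_Integration.integral_cong[OF refl])
    fix y
    show "(\<integral>z. ?\<psi> (z, y) \<partial>dS) = indicator {a<..<b} y * g y *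
      (v y - v a - (S y - S a) / (S b - S a) * (v b - v a))"
    proof (cases "a < y \<and> y < b")
      case True
      have "(\<integral>z. ?\<psi> (z, y) \<partial>dS) = (\<integral>z. g y * (green_deriv a b z y * h z) \<partial>dS)"
        by (simp add: ac_simps)
      also have "\<dots> = g y * (\<integral>z. green_deriv a b z y * h z \<partial>dS)" by simp
      finally show ?thesis using True integral_green_deriv[OF ab v, of y] by simp
    qed (auto simp: green_deriv_def)
  qed
  finally show "(\<integral>z. green_potential_deriv m a b g z * h z \<partial>dS) =
      (\<integral>y. indicator {a<..<b} y * g y * (v y - v a - (S y - S a) / (S b - S a) * (v b - v a)) \<partial>m)" .
qed

lemma green_potential_clamp:
  assumes "a < b"
  shows "green_potential m a b g x
    = (\<integral>y. indicator {a<..<b} y * green S a b (min b (max a x)) y * g y \<partial>m)"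
proof (cases "a < x \<and> x < b")
  case False
  then have "green S a b (min b (max a x)) y = 0" if "a < y" "y < b" for y
    using that assms by (auto simp: green_def min_def max_def)
  then have "(\<lambda>y. indicator {a<..<b} y * green S a b (min b (max a x)) y * g y) = (\<lambda>_. 0)"
    by (auto simp: indicator_def fun_eq_iff)
  with False show ?thesis by (auto simp: green_potential_def)
qed (simp add: green_potential_def)

text \<open>The integral of the derivative over \<open>{u<..v}\<close> is its pairing with the
  derivative of a clamped \<open>S\<close>, so \<open>integral_green_potential_deriv\<close>
  evaluates it. By \<open>green_eq\<close>, where only \<open>min\<close> keeps the order of the
  arguments, the resulting integrand is a difference of two Green functions.\<close>

lemma scale_derivative_green_potential:
  assumes m: "finite_measure m" "sets m = sets borel" and ab: "a < b"
    and g: "g \<in> borel_measurable borel" "\<And>y. \<bar>g y\<bar> \<le> B"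
  shows "has_scale_derivative S (green_potential m a b g) (green_potential_deriv m a b g)"
    and "green_potential_deriv m a b g \<in> L2 dS"
proof -
  interpret m: finite_measure m by fact
  note [measurable] = g(1)
  note [measurable_cong] = m(2)
  have B: "0 \<le> B" using g(2)[of 0] by linarith
  show meas: "green_potential_deriv m a b g \<in> L2 dS"
  proof (rule L2_bound[OF L2_indicator_Ioc[of "B * measure m (space m)" a b]])
    show "green_potential_deriv m a b g \<in> borel_measurable dS"
      unfolding green_potential_deriv_def by measurable
    show "AE z in dS. \<bar>green_potential_deriv m a b g z\<bar>
      \<le> \<bar>B * measure m (space m) * indicator {a<..b} z\<bar>"
    proof (rule AE_I2)
      fix z
      have "\<bar>green_potential_deriv m a b g z\<bar> \<le> (\<integral>y. B * indicator {a<..b} z \<partial>m)"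
        unfolding green_potential_deriv_def
      proof (rule order_trans[OF integral_abs_bound integral_mono_AE'])
        show "AE y in m. \<bar>green_deriv a b z y * g y\<bar> \<le> B * indicator {a<..b} z"
        proof (rule AE_I2)
          fix y
          have "\<bar>green_deriv a b z y\<bar> * \<bar>g y\<bar> \<le> indicator {a<..b} z * B"
            by (intro mult_mono abs_green_deriv_le_Ioc ab g(2)) auto
          then show "\<bar>green_deriv a b z y * g y\<bar> \<le> B * indicator {a<..b} z"
            by (simp add: abs_mult ac_simps)
        qed
      qed (use B in auto)
      then show "\<bar>green_potential_deriv m a b g z\<bar> \<le> \<bar>B * measure m (space m) * indicator {a<..b} z\<bar>"
        using B by (simp add: ac_simps)
    qed
  qed
  show "has_scale_derivative S (green_potential m a b g) (green_potential_deriv m a b g)"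
  proof (rule has_scale_derivativeI)
    show "green_potential_deriv m a b g \<in> borel_measurable borel" using L2_D(1)[OF meas] by simp
    fix u v :: real assume uv: "u < v"
    show "set_integrable dS {u<..v} (green_potential_deriv m a b g)"
      using L2_integrable_mult[OF L2_indicator_Ioc[of 1 u v] meas] by (simp add: set_integrable_def)
    define p q where "p = min b (max a u)" and "q = min b (max a v)"
    have pq: "p \<le> q" "p \<in> {a..b}" "q \<in> {a..b}" using uv ab by (auto simp: p_def q_def)
    let ?v = "\<lambda>x. S (min q (max p x))"
    have "set_lebesgue_integral dS {u<..v} (green_potential_deriv m a b g) =
      (\<integral>z. green_potential_deriv m a b g z * indicator {p<..q} z \<partial>dS)"
      unfolding set_lebesgue_integral_def
    proof (rule integral_cong_AE)
      show "AE z in dS. indicator {u<..v} z *\<^sub>R green_potential_deriv m a b g z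
        = green_potential_deriv m a b g z * indicator {p<..q} z"
      proof (rule AE_I2)
        fix z
        have "green_potential_deriv m a b g z = 0" if "\<not> (a < z \<and> z < b)"
        proof -
          have "green_deriv a b z y = 0" for y using that by (auto simp: green_deriv_def)
          then show ?thesis by (simp add: green_potential_deriv_def)
        qed
        then show "indicator {u<..v} z *\<^sub>R green_potential_deriv m a b g z
          = green_potential_deriv m a b g z * indicator {p<..q} z"
          by (cases "a < z \<and> z < b") (auto simp: p_def q_def indicator_def)
      qed
    qed (use L2_D(1)[OF meas] in auto)
    also have "\<dots> = (\<integral>y. indicator {a<..<b} y * g y *
      (?v y - ?v a - (S y - S a) / (S b - S a) * (?v b - ?v a)) \<partial>m)"
      using integral_green_potential_deriv(2)[OF m ab g
        scale_derivative_clamp[OF scale_derivative_S pq(1)]] by simp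
    also have "\<dots> = (\<integral>y. indicator {a<..<b} y * green S a b q y * g y - indicator {a<..<b} y * green S a
      b p y * g y \<partial>m)"
    proof (rule Bochner_Integration.integral_cong[OF refl])
      fix y
      show "indicator {a<..<b} y * g y * (?v y - ?v a - (S y - S a) / (S b - S a) * (?v b - ?v a)) =
        indicator {a<..<b} y * green S a b q y * g y - indicator {a<..<b} y * green S a b p y * g y"
      proof (cases "a < y \<and> y < b")
        case True
        then have y: "y \<in> {a..b}" by simp
        have "?v a = S p" "?v b = S q" using pq by (auto simp: min_def max_def)
        have "?v y - S p = S (min q y) - S (min p y)" using pq(1) by (auto simp: min_def max_def)
        have "?v y - ?v a - (S y - S a) / (S b - S a) * (?v b - ?v a) =
          green S a b q y - green S a b p y"
        proof -
          define r where "r = (S y - S a) / (S b - S a)"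
          have r: "(S x - S a) * (S y - S a) / (S b - S a) = (S x - S a) * r" for x by (simp add: r_def)
          from \<open>?v y - S p = _\<close> show ?thesis
            unfolding green_eq[OF ab pq(2) y] green_eq[OF ab pq(3) y] r r_def[symmetric] \<open>?v a
              = S p\<close> \<open>?v b = S q\<close>
            by (simp add: algebra_simps)
        qed
        then have "g y * (?v y - ?v a - (S y - S a) / (S b - S a) * (?v b - ?v a)) =
          g y * (green S a b q y - green S a b p y)" by (rule arg_cong)
        with True show ?thesis by (simp add: right_diff_distrib mult.commute[of "g y"])
      qed simp
    qed
    also have "\<dots> = green_potential m a b g v - green_potential m a b g u"
    proof -
      note int = green_integrable[OF m ab _ g]
      show ?thesis
        unfolding green_potential_clamp[OF ab] p_def[symmetric] q_def[symmetric]
        by (rule Bochner_Integration.integral_diff[OF int[OF pq(3)] int[OF pq(2)]])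
    qed
    finally show "set_lebesgue_integral dS {u<..v} (green_potential_deriv m a b g)
      = green_potential m a b g v - green_potential m a b g u" .
  qed
qed

text \<open>The weak equation \<open>Q(Gg,v) = (g,v)\<close>: zero boundary values of the test
  function remove the interpolation term.\<close>

lemma energy_green_potential:
  assumes m: "finite_measure m" "sets m = sets borel" and ab: "a < b"
    and g: "g \<in> borel_measurable borel" "\<And>y. \<bar>g y\<bar> \<le> B"
    and v: "has_scale_derivative S v h" and v0: "\<And>x. x \<notin> {a<..<b} \<Longrightarrow> v x = 0"
  shows "L2_inner dS (green_potential_deriv m a b g) h = L2_inner m g v"
proof -
  have "L2_inner dS (green_potential_deriv m a b g) h =
      (\<integral>y. indicator {a<..<b} y * g y * (v y - v a - (S y - S a) / (S b - S a) * (v b - v a)) \<partial>m)"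
    unfolding L2_inner_def by (rule integral_green_potential_deriv(2)[OF m ab g v])
  also have "\<dots> = L2_inner m g v"
    unfolding L2_inner_def using v0
      by (intro Bochner_Integration.integral_cong) (auto simp: indicator_def)
  finally show ?thesis .
qed

end

section \<open>Symmetric Markov kernels\<close>

text \<open>Compatibility with differences in both arguments reduces an identity to nonnegative
  functions, where it can be proved by Tonelli without integrability questions.\<close>

lemma L2_bilinear_eqI:
  fixes A B :: "('a \<Rightarrow> real) \<Rightarrow> ('a \<Rightarrow> real) \<Rightarrow> real"
  assumes A1: "\<And>F F' G. F \<in> L2 m \<Longrightarrow> F' \<in> L2 m \<Longrightarrow> G \<in> L2 m \<Longrightarrow> A (\<lambda>x. F x - F' x) G = A F G - A F' G"
    and A2: "\<And>F F' G. F \<in> L2 m \<Longrightarrow> F' \<in> L2 m \<Longrightarrow> G \<in> L2 m \<Longrightarrow> A G (\<lambda>x. F x - F' x) = A G F - A G F'"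
    and B1: "\<And>F F' G. F \<in> L2 m \<Longrightarrow> F' \<in> L2 m \<Longrightarrow> G \<in> L2 m \<Longrightarrow> B (\<lambda>x. F x - F' x) G = B F G - B F' G"
    and B2: "\<And>F F' G. F \<in> L2 m \<Longrightarrow> F' \<in> L2 m \<Longrightarrow> G \<in> L2 m \<Longrightarrow> B G (\<lambda>x. F x - F' x) = B G F - B G F'"
    and eq: "\<And>F G. F \<in> L2 m \<Longrightarrow> G \<in> L2 m \<Longrightarrow> (\<And>x. 0 \<le> F x) \<Longrightarrow> (\<And>x. 0 \<le> G x) \<Longrightarrow> A F G = B F G"
    and FG: "F \<in> L2 m" "G \<in> L2 m"
  shows "A F G = B F G"
proof -
  note pos = L2_pos_part(1) and neg = L2_pos_part(2)
  have half: "A F' G = B F' G" if F': "F' \<in> L2 m" "\<And>x. 0 \<le> F' x" for F'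
  proof -
    have "A F' (\<lambda>x. max (G x) 0 - max (- G x) 0) = B F' (\<lambda>x. max (G x) 0 - max (- G x) 0)"
      unfolding A2[OF pos[OF FG(2)] neg[OF FG(2)] F'(1)] B2[OF pos[OF FG(2)] neg[OF FG(2)] F'(1)]
      by (simp add: eq pos[OF FG(2)] neg[OF FG(2)] F')
    then show ?thesis by (simp only: pos_part_diff)
  qed
  have "A (\<lambda>x. max (F x) 0 - max (- F x) 0) G = B (\<lambda>x. max (F x) 0 - max (- F x) 0) G"
    unfolding A1[OF pos[OF FG(1)] neg[OF FG(1)] FG(2)] B1[OF pos[OF FG(1)] neg[OF FG(1)] FG(2)]
    by (simp add: half pos[OF FG(1)] neg[OF FG(1)])
  then show ?thesis by (simp only: pos_part_diff)
qed

definition kernel_op :: "('a \<Rightarrow> 'b measure) \<Rightarrow> ('b \<Rightarrow> real) \<Rightarrow> 'a \<Rightarrow> real" where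
  "kernel_op \<kappa> F x = (\<integral>y. F y \<partial>\<kappa> x)"

text \<open>Symmetry is required for functions with values in \<open>[0,\<infinity>]\<close>, where
  it makes sense before any integrability is known; the action on L2 is derived from it.\<close>

locale symmetric_kernel = finite_measure m for m :: "real measure" +
  fixes \<kappa> :: "real \<Rightarrow> real measure"
  assumes sets_m [measurable_cong]: "sets m = sets borel"
    and prob_kernel: "prob_space (\<kappa> x)"
    and kernel [measurable]: "\<kappa> \<in> borel \<rightarrow>\<^sub>M subprob_algebra borel"
    and symmetric: "f \<in> borel_measurable borel \<Longrightarrow> g \<in> borel_measurable borel \<Longrightarrow>
      (\<integral>\<^sup>+x. (\<integral>\<^sup>+y. f y \<partial>\<kappa> x) * g x \<partial>m) = (\<integral>\<^sup>+x. f x * (\<integral>\<^sup>+y. g y \<partial>\<kappa> x) \<partial>m)"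
begin

lemma space_m: "space m = UNIV"
  using sets_eq_imp_space_eq[OF sets_m] by simp

lemma sets_kernel [simp, measurable_cong]: "sets (\<kappa> x) = sets borel"
  using kernel by (rule sets_kernel) simp

lemma nn_measurable [measurable]:
  "f \<in> borel_measurable borel \<Longrightarrow> (\<lambda>x. \<integral>\<^sup>+y. f y \<partial>\<kappa> x) \<in> borel_measurable borel"
  by (rule measurable_compose[OF kernel nn_integral_measurable_subprob_algebra])

lemma kernel_op_measurable [measurable]:
  "F \<in> borel_measurable borel \<Longrightarrow> kernel_op \<kappa> F \<in> borel_measurable borel"
  unfolding kernel_op_def by (rule measurable_compose[OF kernel integral_measurable_subprob_algebra])

lemma L2_measurable: "F \<in> L2 m \<Longrightarrow> F \<in> borel_measurable borel"
  using L2_D(1)[of F m] measurable_cong_sets[OF sets_m refl, of borel] by simp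

text \<open>Symmetry against the constant \<open>1\<close>: as the kernel has total mass 1,
  \<open>m\<close> is invariant.\<close>

lemma nn_invariant:
  assumes [measurable]: "f \<in> borel_measurable borel"
  shows "(\<integral>\<^sup>+x. (\<integral>\<^sup>+y. f y \<partial>\<kappa> x) \<partial>m) = (\<integral>\<^sup>+x. f x \<partial>m)"
  using symmetric[of f "\<lambda>_. 1"] prob_space.emeasure_space_1[OF prob_kernel] by simp

text \<open>Invariance makes the integral of \<open>F^2\<close> under \<open>\<kappa> x\<close>
  finite for almost every \<open>x\<close>. At the remaining points \<open>kernel_op\<close> may
  take the default value 0 of the integral, so linearity below holds only almost everywhere.\<close>

lemma AE_square_integrable:
  assumes F: "F \<in> L2 m"
  shows "AE x in m. integrable (\<kappa> x) (\<lambda>y. (F y)\<^sup>2) \<and> integrable (\<kappa> x) F"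
proof -
  note [measurable] = L2_measurable[OF F]
  have "(\<integral>\<^sup>+x. (\<integral>\<^sup>+y. ennreal ((F y)\<^sup>2) \<partial>\<kappa> x) \<partial>m) < \<infinity>"
    using F L2_nn[of F m] by (simp add: nn_invariant)
  then have "AE x in m. (\<integral>\<^sup>+y. ennreal ((F y)\<^sup>2) \<partial>\<kappa> x) \<noteq> \<infinity>"
    by (intro nn_integral_PInf_AE) auto
  then show ?thesis
  proof eventually_elim
    case (elim x)
    interpret prob_space "\<kappa> x" by (rule prob_kernel)
    have "F \<in> L2 (\<kappa> x)" using elim by (subst L2_nn) (auto simp: top.not_eq_extremum)
    moreover have "(\<lambda>_. 1) \<in> L2 (\<kappa> x)" by (simp add: L2_def)
    ultimately have "integrable (\<kappa> x) (\<lambda>y. F y * 1)" by (rule L2_integrable_mult)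
    with \<open>F \<in> L2 (\<kappa> x)\<close> show ?case by (simp add: L2_def)
  qed
qed

lemma kernel_op_Jensen:
  assumes "integrable (\<kappa> x) (\<lambda>y. (F y)\<^sup>2)" "integrable (\<kappa> x) F"
  shows "(kernel_op \<kappa> F x)\<^sup>2 \<le> (\<integral>y. (F y)\<^sup>2 \<partial>\<kappa> x)"
proof -
  interpret prob_space "\<kappa> x" by (rule prob_kernel)
  have "0 \<le> variance F" by (rule integral_nonneg_AE) simp
  then show ?thesis using variance_eq[OF assms(2,1)] by (simp add: kernel_op_def)
qed

lemma kernel_op_contraction:
  assumes F: "F \<in> L2 m"
  shows "kernel_op \<kappa> F \<in> L2 m" "L2_sq m (kernel_op \<kappa> F) \<le> L2_sq m F"
proof -
  note [measurable] = L2_measurable[OF F]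
  have le: "(\<integral>\<^sup>+x. ennreal ((kernel_op \<kappa> F x)\<^sup>2) \<partial>m) \<le> (\<integral>\<^sup>+x. ennreal ((F x)\<^sup>2) \<partial>m)"
  proof -
    have "(\<integral>\<^sup>+x. ennreal ((kernel_op \<kappa> F x)\<^sup>2) \<partial>m) \<le> (\<integral>\<^sup>+x. (\<integral>\<^sup>+y. ennreal ((F y)\<^sup>2) \<partial>\<kappa> x) \<partial>m)"
    proof (rule nn_integral_mono_AE, use AE_square_integrable[OF F] in eventually_elim)
      case (elim x)
      then show ?case using kernel_op_Jensen[of x F]
        by (subst nn_integral_eq_integral) (auto intro: ennreal_leI)
    qed
    then show ?thesis by (simp add: nn_invariant)
  qed
  also have fin: "\<dots> < \<infinity>" using F L2_nn[of F m] by simp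
  finally show T: "kernel_op \<kappa> F \<in> L2 m" by (subst L2_nn) auto
  have sq: "(\<integral>\<^sup>+x. ennreal ((G x)\<^sup>2) \<partial>m) = ennreal (L2_sq m G)" if "G \<in> L2 m" for G
    using L2_D(2)[OF that] by (subst nn_integral_eq_integral) (auto simp: L2_inner_def power2_eq_square)
  show "L2_sq m (kernel_op \<kappa> F) \<le> L2_sq m F"
    using le unfolding sq[OF T] sq[OF F] by (simp add: ennreal_le_iff L2_inner_nonneg)
qed

lemma kernel_op_diff:
  assumes F: "F \<in> L2 m" and G: "G \<in> L2 m"
  shows "AE x in m. kernel_op \<kappa> (\<lambda>y. F y - G y) x = kernel_op \<kappa> F x - kernel_op \<kappa> G x"
  using AE_square_integrable[OF F] AE_square_integrable[OF G]
  by eventually_elim (auto simp: kernel_op_def)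

lemma L2_inner_kernel_op_diff_left:
  assumes "F \<in> L2 m" "F' \<in> L2 m" "G \<in> L2 m"
  shows "L2_inner m (kernel_op \<kappa> (\<lambda>x. F x - F' x)) G
    = L2_inner m (kernel_op \<kappa> F) G - L2_inner m (kernel_op \<kappa> F') G"
proof -
  have "L2_inner m (kernel_op \<kappa> (\<lambda>x. F x - F' x)) G
    = L2_inner m (\<lambda>x. kernel_op \<kappa> F x - kernel_op \<kappa> F' x) G"
    using assms kernel_op_diff[OF assms(1,2)]
    by (intro L2_inner_cong_AE)
      (auto intro!: borel_measurable_diff dest: L2_D simp: kernel_op_contraction L2_diff L2_D(1))
  then show ?thesis using assms by (simp add: L2_inner_diff_left kernel_op_contraction)
qed

lemma kernel_op_tendsto:
  assumes "\<And>n. F n \<in> L2 m" "G \<in> L2 m" "L2_tendsto m F G"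
  shows "L2_tendsto m (\<lambda>n. kernel_op \<kappa> (F n)) (kernel_op \<kappa> G)"
  unfolding L2_tendsto_def
proof (rule tendsto_sandwich[OF _ _ tendsto_const assms(3)[unfolded L2_tendsto_def]])
  have "L2_sq m (\<lambda>x. kernel_op \<kappa> (F n) x - kernel_op \<kappa> G x)
    = L2_sq m (kernel_op \<kappa> (\<lambda>y. F n y - G y))" for n
    using kernel_op_diff[OF assms(1,2), of n]
      L2_D(1)[OF kernel_op_contraction(1)[OF L2_diff[OF assms(1,2)]]]
      L2_D(1)[OF kernel_op_contraction(1)[OF assms(1)]]
        L2_D(1)[OF kernel_op_contraction(1)[OF assms(2)]]
    by (intro L2_inner_cong_AE) auto
  then show "\<forall>\<^sub>F n in sequentially. L2_sq m (\<lambda>x. kernel_op \<kappa> (F n) x - kernel_op \<kappa> G x)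
     \<le> L2_sq m (\<lambda>x. F n x - G x)"
    using kernel_op_contraction(2)[OF L2_diff[OF assms(1,2)]] by simp
qed (simp add: L2_inner_nonneg)

text \<open>The contraction property, applied to the difference, shows that the operator acts on
  classes.\<close>

lemma kernel_op_cong_AE:
  assumes "F \<in> L2 m" "G \<in> L2 m" "AE x in m. F x = G x"
  shows "AE x in m. kernel_op \<kappa> F x = kernel_op \<kappa> G x"
proof -
  let ?D = "\<lambda>x. F x - G x"
  note D = L2_diff[OF assms(1,2)]
  have "L2_sq m ?D = L2_sq m (\<lambda>_. 0)"
    using assms L2_D(1)[OF D] by (intro L2_inner_cong_AE) auto
  then have "L2_sq m (kernel_op \<kappa> ?D) = 0"
    using kernel_op_contraction(2)[OF D] L2_inner_nonneg[of m "kernel_op \<kappa> ?D"]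
    by (auto simp: L2_inner_def intro: antisym)
  then have "(\<integral>x. (kernel_op \<kappa> ?D x)\<^sup>2 \<partial>m) = 0" by (simp add: L2_inner_def power2_eq_square)
  then have "AE x in m. (kernel_op \<kappa> ?D x)\<^sup>2 = 0"
    using L2_D(2)[OF kernel_op_contraction(1)[OF D]] by (subst (asm) integral_nonneg_eq_0_iff_AE) auto
  with kernel_op_diff[OF assms(1,2)] show ?thesis by eventually_elim simp
qed

lemma L2_inner_kernel_op_nonneg:
  assumes F: "F \<in> L2 m" "\<And>x. 0 \<le> F x" and G: "G \<in> L2 m" "\<And>x. 0 \<le> G x"
  shows "L2_inner m (kernel_op \<kappa> F) G = enn2real (\<integral>\<^sup>+x. (\<integral>\<^sup>+y. ennreal (F y) \<partial>\<kappa> x) * ennreal (G x) \<partial>m)"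
    and "(\<integral>\<^sup>+x. (\<integral>\<^sup>+y. ennreal (F y) \<partial>\<kappa> x) * ennreal (G x) \<partial>m) < \<infinity>"
proof -
  note [measurable] = L2_measurable[OF F(1)] L2_measurable[OF G(1)]
  have T: "0 \<le> kernel_op \<kappa> F x" for x unfolding kernel_op_def using F(2) by simp
  have eq: "(\<integral>\<^sup>+x. (\<integral>\<^sup>+y. ennreal (F y) \<partial>\<kappa> x) * ennreal (G x) \<partial>m)
    = (\<integral>\<^sup>+x. ennreal (kernel_op \<kappa> F x * G x) \<partial>m)"
  proof (rule nn_integral_cong_AE, use AE_square_integrable[OF F(1)] in eventually_elim)
    case (elim x)
    then show ?case using F(2) G(2) T
      by (subst nn_integral_eq_integral) (auto simp: kernel_op_def ennreal_mult)
  qed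
  have int: "integrable m (\<lambda>x. kernel_op \<kappa> F x * G x)"
    by (intro L2_integrable_mult kernel_op_contraction F G)
  have eq2: "(\<integral>\<^sup>+x. ennreal (kernel_op \<kappa> F x * G x) \<partial>m) = ennreal (L2_inner m (kernel_op \<kappa> F) G)"
    unfolding L2_inner_def using int T G(2) by (intro nn_integral_eq_integral) auto
  have nn: "0 \<le> L2_inner m (kernel_op \<kappa> F) G" unfolding L2_inner_def using T G(2)
    by (intro integral_nonneg_AE) auto
  show "L2_inner m (kernel_op \<kappa> F) G = enn2real (\<integral>\<^sup>+x. (\<integral>\<^sup>+y. ennreal (F y) \<partial>\<kappa> x) * ennreal (G x) \<partial>m)"
    "(\<integral>\<^sup>+x. (\<integral>\<^sup>+y. ennreal (F y) \<partial>\<kappa> x) * ennreal (G x) \<partial>m) < \<infinity>"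
    unfolding eq eq2 using nn by auto
qed

end

text \<open>\<open>\<kappa>3\<close> is a step of \<open>\<kappa>1\<close> followed by one of
  \<open>\<kappa>2\<close>; symmetry moves the first step to the other factor. For the semigroup
  this reads \<open>(T\<^sub>sT\<^sub>tF,F) = (T\<^sub>sF,T\<^sub>tF)\<close>.\<close>

lemma L2_inner_kernel_op_compose:
  assumes "symmetric_kernel m \<kappa>1" "symmetric_kernel m \<kappa>2" "symmetric_kernel m \<kappa>3"
    and comp: "\<And>f x. f \<in> borel_measurable borel \<Longrightarrow> (\<integral>\<^sup>+y. f y \<partial>\<kappa>3 x) = (\<integral>\<^sup>+y. \<integral>\<^sup>+z. f z \<partial>\<kappa>2 y \<partial>\<kappa>1 x)"
    and FG: "F \<in> L2 m" "G \<in> L2 m"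
  shows "L2_inner m (kernel_op \<kappa>3 F) G = L2_inner m (kernel_op \<kappa>2 F) (kernel_op \<kappa>1 G)"
proof -
  interpret k1: symmetric_kernel m \<kappa>1 by fact
  interpret k2: symmetric_kernel m \<kappa>2 by fact
  interpret k3: symmetric_kernel m \<kappa>3 by fact
  show ?thesis
  proof (rule L2_bilinear_eqI[where A="\<lambda>F G. L2_inner m (kernel_op \<kappa>3 F) G"
        and B="\<lambda>F G. L2_inner m (kernel_op \<kappa>2 F) (kernel_op \<kappa>1 G)", OF _ _ _ _ _ FG])
    fix F F' G assume L: "F \<in> L2 m" "F' \<in> L2 m" "G \<in> L2 m"
    show "L2_inner m (kernel_op \<kappa>3 (\<lambda>x. F x - F' x)) G
      = L2_inner m (kernel_op \<kappa>3 F) G - L2_inner m (kernel_op \<kappa>3 F') G"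
      by (rule k3.L2_inner_kernel_op_diff_left[OF L])
    show "L2_inner m (kernel_op \<kappa>3 G) (\<lambda>x. F x - F' x)
      = L2_inner m (kernel_op \<kappa>3 G) F - L2_inner m (kernel_op \<kappa>3 G) F'"
      by (rule L2_inner_diff_right[OF L(1,2) k3.kernel_op_contraction(1)[OF L(3)]])
    show "L2_inner m (kernel_op \<kappa>2 (\<lambda>x. F x - F' x)) (kernel_op \<kappa>1 G)
      = L2_inner m (kernel_op \<kappa>2 F) (kernel_op \<kappa>1 G) - L2_inner m (kernel_op \<kappa>2 F') (kernel_op \<kappa>1 G)"
      by (rule k2.L2_inner_kernel_op_diff_left[OF L(1,2) k1.kernel_op_contraction(1)[OF L(3)]])
    show "L2_inner m (kernel_op \<kappa>2 G) (kernel_op \<kappa>1 (\<lambda>x. F x - F' x))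
      = L2_inner m (kernel_op \<kappa>2 G) (kernel_op \<kappa>1 F) - L2_inner m (kernel_op \<kappa>2 G) (kernel_op \<kappa>1 F')"
      unfolding L2_inner_commute[of m "kernel_op \<kappa>2 G"]
      by (rule k1.L2_inner_kernel_op_diff_left[OF L(1,2) k2.kernel_op_contraction(1)[OF L(3)]])
  next
    fix F G assume L: "F \<in> L2 m" "G \<in> L2 m" and nn: "\<And>x. 0 \<le> F x" "\<And>x. 0 \<le> G x"
    note [measurable] = k1.L2_measurable[OF L(1)] k1.L2_measurable[OF L(2)]
    have T: "kernel_op \<kappa>2 F \<in> L2 m" "\<And>x. 0 \<le> kernel_op \<kappa>2 F x"
      using k2.kernel_op_contraction(1)[OF L(1)] nn by (auto simp: kernel_op_def)
    have "(\<integral>\<^sup>+x. (\<integral>\<^sup>+y. ennreal (F y) \<partial>\<kappa>3 x) * ennreal (G x) \<partial>m)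
      = (\<integral>\<^sup>+x. (\<integral>\<^sup>+y. (\<integral>\<^sup>+z. ennreal (F z) \<partial>\<kappa>2 y) \<partial>\<kappa>1 x) * ennreal (G x) \<partial>m)"
      by (simp add: comp)
    also have "\<dots> = (\<integral>\<^sup>+x. (\<integral>\<^sup>+z. ennreal (F z) \<partial>\<kappa>2 x) * (\<integral>\<^sup>+y. ennreal (G y) \<partial>\<kappa>1 x) \<partial>m)"
      by (rule k1.symmetric) auto
    also have "\<dots> = (\<integral>\<^sup>+x. (\<integral>\<^sup>+y. ennreal (G y) \<partial>\<kappa>1 x) * ennreal (kernel_op \<kappa>2 F x) \<partial>m)"
    proof (rule nn_integral_cong_AE, use k2.AE_square_integrable[OF L(1)] in eventually_elim)
      case (elim x)
      then show ?case using nn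
        by (subst nn_integral_eq_integral) (auto simp: kernel_op_def mult.commute)
    qed
    finally show "L2_inner m (kernel_op \<kappa>3 F) G = L2_inner m (kernel_op \<kappa>2 F) (kernel_op \<kappa>1 G)"
      unfolding k3.L2_inner_kernel_op_nonneg(1)[OF L(1) nn(1) L(2) nn(2)]
      using k1.L2_inner_kernel_op_nonneg(1)[OF L(2) nn(2) T] by (simp add: L2_inner_commute)
  qed
qed

text \<open>Tonelli for nonnegative functions, which also gives measurability in \<open>t\<close>;
  positive and negative parts do the rest. It is applied with an exponential law for
  \<open>E\<close>, under which the resolvent is a mixture of the semigroup.\<close>

lemma L2_inner_kernel_op_mixture:
  assumes kt: "\<And>t. symmetric_kernel m (\<kappa> t)" and ku: "symmetric_kernel m \<kappa>'" and E: "prob_space E"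
    and meas: "\<And>f. f \<in> borel_measurable borel \<Longrightarrow> (\<lambda>(t, x). \<integral>\<^sup>+y. f y \<partial>\<kappa> t x)
      \<in> borel_measurable (E \<Otimes>\<^sub>M borel)"
    and mix: "\<And>f x. f \<in> borel_measurable borel \<Longrightarrow> (\<integral>\<^sup>+y. f y \<partial>\<kappa>' x) = (\<integral>\<^sup>+t. \<integral>\<^sup>+y. f y \<partial>\<kappa> t x \<partial>E)"
    and FG: "F \<in> L2 m" "G \<in> L2 m"
  shows "L2_inner m (kernel_op \<kappa>' F) G = (\<integral>t. L2_inner m (kernel_op (\<kappa> t) F) G \<partial>E)"
proof -
  interpret E: prob_space E by fact
  interpret ku: symmetric_kernel m \<kappa>' by fact
  interpret kt: symmetric_kernel m "\<kappa> t" for t by (rule kt)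
  interpret pair_sigma_finite E m by unfold_locales
  let ?I = "\<lambda>F G t. L2_inner m (kernel_op (\<kappa> t) F) G"
  have meas': "(\<lambda>(t, x). \<integral>\<^sup>+y. f y \<partial>\<kappa> t x) \<in> borel_measurable (E \<Otimes>\<^sub>M m)" if "f \<in> borel_measurable borel"
    for f
    using meas[OF that] measurable_cong_sets[OF sets_pair_measure_cong[OF refl ku.sets_m, of E] refl]
      by blast
  have nn: "?I F G t = enn2real (\<integral>\<^sup>+x. (\<integral>\<^sup>+y. ennreal (F y) \<partial>\<kappa> t x) * ennreal (G x) \<partial>m)"
    and nn_meas: "(\<lambda>t. \<integral>\<^sup>+x. (\<integral>\<^sup>+y. ennreal (F y) \<partial>\<kappa> t x) * ennreal (G x) \<partial>m) \<in> borel_measurable E"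
    if L: "F \<in> L2 m" "G \<in> L2 m" "\<And>x. 0 \<le> F x" "\<And>x. 0 \<le> G x" for F G t
  proof -
    note [measurable] = ku.L2_measurable[OF L(1)] ku.L2_measurable[OF L(2)]
    show "?I F G t = enn2real (\<integral>\<^sup>+x. (\<integral>\<^sup>+y. ennreal (F y) \<partial>\<kappa> t x) * ennreal (G x) \<partial>m)"
      by (rule kt.L2_inner_kernel_op_nonneg(1)[OF L(1,3,2,4)])
    have [measurable]: "(\<lambda>(t, x). \<integral>\<^sup>+y. ennreal (F y) \<partial>\<kappa> t x) \<in> borel_measurable (E \<Otimes>\<^sub>M m)"
      by (rule meas') simp
    show "(\<lambda>t. \<integral>\<^sup>+x. (\<integral>\<^sup>+y. ennreal (F y) \<partial>\<kappa> t x) * ennreal (G x) \<partial>m) \<in> borel_measurable E"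
      by measurable
  qed
  have diff1: "?I (\<lambda>x. F x - F' x) G t = ?I F G t - ?I F' G t"
    and diff2: "?I G (\<lambda>x. F x - F' x) t = ?I G F t - ?I G F' t"
    if "F \<in> L2 m" "F' \<in> L2 m" "G \<in> L2 m" for F F' G t
    using that by (simp_all add: kt.L2_inner_kernel_op_diff_left L2_inner_diff_right
      kt.kernel_op_contraction(1))
  have I_meas: "?I F G \<in> borel_measurable E" if L: "F \<in> L2 m" "G \<in> L2 m" for F G
  proof -
    note pos = L2_pos_part
    have P: "?I F G \<in> borel_measurable E" if "F \<in> L2 m" "G \<in> L2 m" "\<And>x. 0 \<le> F x" "\<And>x. 0 \<le> G x" for F G
      unfolding nn[OF that] using nn_meas[OF that] by simp
    have half: "?I F' G \<in> borel_measurable E" if F': "F' \<in> L2 m" "\<And>x. 0 \<le> F' x" for F'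
    proof -
      have "(\<lambda>t. ?I F' (\<lambda>x. max (G x) 0 - max (- G x) 0) t) \<in> borel_measurable E"
        unfolding diff2[OF pos[OF L(2)] F'(1)] by (intro borel_measurable_diff P F' pos L) auto
      then show ?thesis by (simp only: pos_part_diff)
    qed
    have "(\<lambda>t. ?I (\<lambda>x. max (F x) 0 - max (- F x) 0) G t) \<in> borel_measurable E"
      unfolding diff1[OF pos[OF L(1)] L(2)] by (intro borel_measurable_diff half pos L) auto
    then show ?thesis by (simp only: pos_part_diff)
  qed
  have I_int: "integrable E (?I F G)" if L: "F \<in> L2 m" "G \<in> L2 m" for F G
  proof (rule E.integrable_const_bound[OF _ I_meas[OF L]])
    show "AE t in E. norm (?I F G t) \<le> sqrt (L2_sq m F) * sqrt (L2_sq m G)"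
    proof (rule AE_I2)
      fix t
      have "\<bar>?I F G t\<bar> \<le> sqrt (L2_sq m (kernel_op (\<kappa> t) F)) * sqrt (L2_sq m G)"
        by (intro L2_inner_Cauchy_Schwarz kt.kernel_op_contraction L)
      also have "\<dots> \<le> sqrt (L2_sq m F) * sqrt (L2_sq m G)"
        using kt.kernel_op_contraction(2)[OF L(1)]
          by (intro mult_right_mono) (auto simp: L2_inner_nonneg)
      finally show "norm (?I F G t) \<le> sqrt (L2_sq m F) * sqrt (L2_sq m G)" by simp
    qed
  qed
  show ?thesis
  proof (rule L2_bilinear_eqI[where A="\<lambda>F G. L2_inner m (kernel_op \<kappa>' F) G"
    and B="\<lambda>F G. \<integral>t. ?I F G t \<partial>E", OF _ _ _ _ _ FG])
    fix F F' G assume L: "F \<in> L2 m" "F' \<in> L2 m" "G \<in> L2 m"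
    show "L2_inner m (kernel_op \<kappa>' (\<lambda>x. F x - F' x)) G
      = L2_inner m (kernel_op \<kappa>' F) G - L2_inner m (kernel_op \<kappa>' F') G"
      by (rule ku.L2_inner_kernel_op_diff_left[OF L])
    show "L2_inner m (kernel_op \<kappa>' G) (\<lambda>x. F x - F' x)
      = L2_inner m (kernel_op \<kappa>' G) F - L2_inner m (kernel_op \<kappa>' G) F'"
      by (rule L2_inner_diff_right[OF L(1,2) ku.kernel_op_contraction(1)[OF L(3)]])
    show "(\<integral>t. ?I (\<lambda>x. F x - F' x) G t \<partial>E) = (\<integral>t. ?I F G t \<partial>E) - (\<integral>t. ?I F' G t \<partial>E)"
      unfolding diff1[OF L] by (intro Bochner_Integration.integral_diff I_int L)
    show "(\<integral>t. ?I G (\<lambda>x. F x - F' x) t \<partial>E) = (\<integral>t. ?I G F t \<partial>E) - (\<integral>t. ?I G F' t \<partial>E)"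
      unfolding diff2[OF L] by (intro Bochner_Integration.integral_diff I_int L)
  next
    fix F G assume L: "F \<in> L2 m" "G \<in> L2 m" and pos: "\<And>x. 0 \<le> F x" "\<And>x. 0 \<le> G x"
    note [measurable] = ku.L2_measurable[OF L(1)] ku.L2_measurable[OF L(2)]
    have [measurable]: "(\<lambda>(t, x). \<integral>\<^sup>+y. ennreal (F y) \<partial>\<kappa> t x) \<in> borel_measurable (E \<Otimes>\<^sub>M m)"
      by (rule meas') simp
    have [measurable]: "(\<lambda>t. \<integral>\<^sup>+y. ennreal (F y) \<partial>\<kappa> t x) \<in> borel_measurable E" for x
    proof -
      have "(\<lambda>t. (t, x)) \<in> E \<rightarrow>\<^sub>M E \<Otimes>\<^sub>M borel" by simp
      from measurable_compose[OF this meas[of "\<lambda>y. ennreal (F y)"]] show ?thesis by simp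
    qed
    have I_nn: "ennreal (?I F G t) = (\<integral>\<^sup>+x. (\<integral>\<^sup>+y. ennreal (F y) \<partial>\<kappa> t x) * ennreal (G x) \<partial>m)" for t
      unfolding nn[OF L pos] using kt.L2_inner_kernel_op_nonneg(2)[OF L(1) pos(1) L(2) pos(2), of t]
        by simp
    have "(\<integral>\<^sup>+x. (\<integral>\<^sup>+y. ennreal (F y) \<partial>\<kappa>' x) * ennreal (G x) \<partial>m)
      = (\<integral>\<^sup>+x. (\<integral>\<^sup>+t. (\<integral>\<^sup>+y. ennreal (F y) \<partial>\<kappa> t x) * ennreal (G x) \<partial>E) \<partial>m)"
      by (simp add: mix nn_integral_multc)
    also have "\<dots> = (\<integral>\<^sup>+t. (\<integral>\<^sup>+x. (\<integral>\<^sup>+y. ennreal (F y) \<partial>\<kappa> t x) * ennreal (G x) \<partial>m) \<partial>E)"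
      by (rule Fubini'[of "\<lambda>t x. (\<integral>\<^sup>+y. ennreal (F y) \<partial>\<kappa> t x) * ennreal (G x)"]) measurable
    also have "\<dots> = (\<integral>\<^sup>+t. ennreal (?I F G t) \<partial>E)" by (simp add: I_nn)
    finally have "L2_inner m (kernel_op \<kappa>' F) G = enn2real (\<integral>\<^sup>+t. ennreal (?I F G t) \<partial>E)"
      unfolding ku.L2_inner_kernel_op_nonneg(1)[OF L(1) pos(1) L(2) pos(2)] by simp
    also have "\<dots> = (\<integral>t. ?I F G t \<partial>E)"
      using I_meas[OF L] nn[OF L pos] by (intro integral_eq_nn_integral[symmetric]) auto
    finally show "L2_inner m (kernel_op \<kappa>' F) G = (\<integral>t. ?I F G t \<partial>E)" .
  qed
qed

section \<open>Convexity in time and difference quotients\<close>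

lemma bounded_convex_seq_decreasing:
  fixes c :: "nat \<Rightarrow> real"
  assumes convex: "\<And>k. 0 \<le> c k - 2 * c (Suc k) + c (Suc (Suc k))" and bdd: "\<And>k. c k \<le> B"
  shows "c 1 \<le> c 0"
proof (rule ccontr)
  assume "\<not> c 1 \<le> c 0"
  define \<delta> where "\<delta> = c 1 - c 0"
  have \<delta>: "\<delta> > 0" using \<open>\<not> c 1 \<le> c 0\<close> by (simp add: \<delta>_def)
  \<comment> \<open>By convexity no increment is smaller than the first one, so a positive first
    increment would force linear growth beyond \<open>B\<close>.\<close>
  have inc: "c (Suc k) - c k \<ge> \<delta>" for k
  proof (induction k)
    case (Suc k)
    then show ?case using convex[of k] by linarith
  qed (simp add: \<delta>_def)
  have "c n \<ge> c 0 + real n * \<delta>" for n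
  proof (induction n)
    case (Suc n)
    have "c (Suc n) \<ge> c n + \<delta>" using inc[of n] by linarith
    with Suc show ?case by (simp add: algebra_simps)
  qed simp
  moreover obtain n where "real n > (B - c 0) / \<delta>" using reals_Archimedean2 by blast
  ultimately show False using bdd[of n] \<delta> by (auto simp: field_simps) (smt (verit, best))
qed

text \<open>
  The function \<open>t \<mapsto> (T\<^sub>tF,F) = |T\<^bsub>t/2\<^esub>F|\<^sup>2\<close> of a symmetric contraction semigroup is convex along
  arithmetic progressions, which replaces the spectral theorem.
\<close>

lemma semigroup_increment:
  fixes \<phi> :: "real \<Rightarrow> real"
  assumes G: "\<And>t. 0 \<le> t \<Longrightarrow> G t \<in> L2 m"
    and \<phi>: "\<And>s t. 0 \<le> s \<Longrightarrow> 0 \<le> t \<Longrightarrow> \<phi> (s + t) = L2_inner m (G s) (G t)"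
    and bdd: "\<And>t. 0 \<le> t \<Longrightarrow> \<phi> t \<le> B"
  shows "0 \<le> s \<Longrightarrow> s \<le> t \<Longrightarrow> \<phi> t \<le> \<phi> s"
    and "0 \<le> t \<Longrightarrow> \<phi> 0 - \<phi> (real n * t) \<le> real n * (\<phi> 0 - \<phi> t)"
proof -
  have convex: "0 \<le> \<phi> s - 2 * \<phi> (s + r) + \<phi> (s + 2 * r)" if "0 \<le> s" "0 \<le> r" for s r
  proof -
    \<comment> \<open>Because the times add up in \<open>\<phi>\<close>, starting both factors at
      \<open>s/2\<close> turns the second difference of \<open>\<phi>\<close> into a squared
      norm.\<close>
    have "0 \<le> L2_sq m (\<lambda>x. G (s/2) x - G (s/2 + r) x)" by (rule L2_inner_nonneg)
    also have "\<dots> = \<phi> (s/2 + s/2) - 2 * \<phi> (s/2 + (s/2 + r)) + \<phi> ((s/2 + r) + (s/2 + r))"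
      using that by (subst (1 2 3) \<phi>) (auto simp: L2_inner_diff_self G)
    also have "\<dots> = \<phi> s - 2 * \<phi> (s + r) + \<phi> (s + 2 * r)" by (simp add: algebra_simps)
    finally show ?thesis .
  qed
  have dec: "\<phi> (s + r) \<le> \<phi> s" if sr: "0 \<le> s" "0 \<le> r" for s r
  proof -
    have "\<phi> (s + real 1 * r) \<le> \<phi> (s + real 0 * r)"
    proof (rule bounded_convex_seq_decreasing[of "\<lambda>k. \<phi> (s + real k * r)" B])
      show "0 \<le> \<phi> (s + real k * r) - 2 * \<phi> (s + real (Suc k) * r) + \<phi> (s + real (Suc (Suc k)) * r)"
        for k
        using convex[of "s + real k * r" r] sr by (simp add: algebra_simps)
    qed (use sr bdd in auto)
    then show ?thesis by simp
  qed
  show "\<phi> t \<le> \<phi> s" if "0 \<le> s" "s \<le> t" using dec[of s "t - s"] that by simp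
  show "\<phi> 0 - \<phi> (real n * t) \<le> real n * (\<phi> 0 - \<phi> t)" if t: "0 \<le> t"
  proof -
    have inc: "\<phi> (real k * t) - \<phi> (real (Suc k) * t) \<le> \<phi> 0 - \<phi> t" for k
    proof (induction k)
      case (Suc k)
      then show ?case using convex[of "real k * t" t] t by (simp add: algebra_simps)
    qed simp
    show ?thesis
    proof (induction n)
      case (Suc n)
      have "\<phi> 0 - \<phi> (real (Suc n) * t)
        = (\<phi> 0 - \<phi> (real n * t)) + (\<phi> (real n * t) - \<phi> (real (Suc n) * t))" by simp
      also have "\<dots> \<le> real n * (\<phi> 0 - \<phi> t) + (\<phi> 0 - \<phi> t)" by (intro add_mono Suc inc)
      also have "\<dots> = real (Suc n) * (\<phi> 0 - \<phi> t)" by (simp add: algebra_simps)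
      finally show ?case .
    qed simp
  qed
qed

text \<open>Modelled on \<open>t \<mapsto> (F - T\<^sub>tF,F)\<close>: monotonicity of the semigroup
  form gives the first two conditions, convexity the third.\<close>

locale subadditive_increment =
  fixes h :: "real \<Rightarrow> real"
  assumes mono: "0 \<le> s \<Longrightarrow> s \<le> t \<Longrightarrow> h s \<le> h t"
    and nonneg: "0 \<le> t \<Longrightarrow> 0 \<le> h t"
    and mult: "0 \<le> t \<Longrightarrow> h (real n * t) \<le> real n * h t"
begin

text \<open>With \<open>n\<close> the integer obtained by rounding \<open>t / s\<close> up,
  \<open>h t \<le> h (n s) \<le> n h s\<close>. Rounding costs the factor \<open>1 + s / t\<close>,
  which tends to 1 as \<open>s\<close> shrinks, so quotients at small times dominate those at larger
  times in the limit.\<close>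

lemma quotient_le:
  assumes "0 < s" "0 < t"
  shows "h t / t \<le> (1 + s / t) * (h s / s)"
proof -
  define n where "n = nat \<lceil>t / s\<rceil>"
  have n: "t / s \<le> real n" "real n \<le> t / s + 1"
    using assms unfolding n_def by (auto simp: of_nat_nat)
  have "h t \<le> h (real n * s)" using n(1) assms by (intro mono) (auto simp: field_simps)
  also have "\<dots> \<le> real n * h s" using assms by (intro mult) auto
  also have "\<dots> \<le> (t / s + 1) * h s" using n(2) assms by (intro mult_right_mono nonneg) auto
  finally have "h t / t \<le> ((t / s + 1) * h s) / t" using assms by (intro divide_right_mono) auto
  also have "\<dots> = (1 + s / t) * (h s / s)" using assms by (simp add: field_simps)
  finally show ?thesis .
qed

lemma factor_tendsto: "((\<lambda>s. 1 + s / t) \<longlongrightarrow> 1) (at_right 0)" for t :: real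
proof -
  have "((\<lambda>s. 1 + s * inverse t) \<longlongrightarrow> 1 + 0 * inverse t) (at_right 0)" by (intro tendsto_intros)
  then show ?thesis by (simp add: divide_inverse)
qed

lemma eventually_pos: "\<forall>\<^sub>F s in at_right 0. (0::real) < s"
  by (simp add: eventually_at_right_less)

lemma quotient_le_limit:
  assumes lim: "((\<lambda>t. h t / t) \<longlongrightarrow> l) (at_right 0)" and t: "0 < t"
  shows "h t / t \<le> l"
proof (rule tendsto_lowerbound)
  show "((\<lambda>s. (1 + s / t) * (h s / s)) \<longlongrightarrow> l) (at_right 0)"
    using tendsto_mult[OF factor_tendsto[of t] lim] by simp
  show "\<forall>\<^sub>F s in at_right 0. h t / t \<le> (1 + s / t) * (h s / s)"
    using eventually_pos by eventually_elim (use quotient_le t in auto)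
qed simp

text \<open>A Fekete argument: the limit is the supremum of the quotients, since each quotient is,
  up to a factor tending to 1, a lower bound for those at sufficiently small times.\<close>

lemma quotient_tendsto:
  assumes bdd: "\<And>t. 0 < t \<Longrightarrow> h t / t \<le> C"
  shows "\<exists>l. ((\<lambda>t. h t / t) \<longlongrightarrow> l) (at_right 0) \<and> l \<le> C"
proof -
  define l where "l = (SUP t\<in>{0<..}. h t / t)"
  have bddA: "bdd_above ((\<lambda>t. h t / t) ` {0<..})" using bdd by (intro bdd_aboveI2[of _ _ C]) auto
  have upper: "h t / t \<le> l" if "0 < t" for t unfolding l_def using that bddA by (intro cSUP_upper) auto
  have "((\<lambda>t. h t / t) \<longlongrightarrow> l) (at_right 0)"
  proof (rule order_tendstoI)
    fix a assume "a < l"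
    then obtain t where t: "0 < t" "a < h t / t"
      unfolding l_def using less_cSUP_iff[OF _ bddA] by auto
    have "((\<lambda>s. (h t / t) / (1 + s / t)) \<longlongrightarrow> (h t / t) / 1) (at_right 0)"
      by (intro tendsto_divide tendsto_const factor_tendsto) simp
    then have "\<forall>\<^sub>F s in at_right 0. a < (h t / t) / (1 + s / t)"
      using t(2) by (intro order_tendstoD(1)) auto
    with eventually_pos show "\<forall>\<^sub>F s in at_right 0. a < h s / s"
    proof eventually_elim
      case (elim s)
      have "0 < 1 + s / t" using elim(1) t(1) by (simp add: add_pos_nonneg)
      then have "(h t / t) / (1 + s / t) \<le> h s / s"
        using quotient_le[OF elim(1) t(1)] by (subst pos_divide_le_eq) (simp_all add: mult.commute)
      with elim(2) show ?case by linarith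
    qed
  next
    fix a assume a: "l < a"
    from eventually_pos show "\<forall>\<^sub>F s in at_right 0. h s / s < a"
      by eventually_elim (use upper a in \<open>auto intro: le_less_trans\<close>)
  qed
  moreover have "l \<le> C" unfolding l_def by (intro cSUP_least) (use bdd in auto)
  ultimately show ?thesis by blast
qed

end

section \<open>Exponential averages of difference quotients\<close>

abbreviation exponential_law :: "real \<Rightarrow> real measure" where
  "exponential_law l \<equiv> density lborel (exponential_density l)"

lemma exponential_moment:
  assumes l: "0 < l"
  shows "integrable (exponential_law l) (\<lambda>x. x ^ i)" "(\<integral>x. x ^ i \<partial>exponential_law l) = fact i / l ^ i"
proof -
  have nn: "(\<integral>\<^sup>+x. ennreal (exponential_density l x * x ^ i) \<partial>lborel) = ennreal (fact i / l ^ i)"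
    using nn_integral_erlang_ith_moment[OF l, of 0 i] by simp
  have pos: "0 \<le> exponential_density l x * x ^ i" for x
    using l by (auto simp: exponential_density_def)
  have bi: "has_bochner_integral lborel (\<lambda>x. exponential_density l x * x ^ i) (fact i / l ^ i)"
    using nn pos l by (intro has_bochner_integral_nn_integral) auto
  show "integrable (exponential_law l) (\<lambda>x. x ^ i)"
    using bi l by (subst integrable_density)
      (auto simp: exponential_density_nonneg has_bochner_integral_iff)
  show "(\<integral>x. x ^ i \<partial>exponential_law l) = fact i / l ^ i"
    using bi l by (subst integral_density)
      (auto simp: exponential_density_nonneg has_bochner_integral_iff)
qed

lemma AE_exponential_law_nonneg: "AE x in exponential_law l. 0 \<le> x"
  by (subst AE_density) (auto simp: exponential_density_def)

context subadditive_increment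
begin

lemma exponential_average_le:
  assumes int: "integrable (exponential_law l) h" and C: "\<And>t. 0 < t \<Longrightarrow> h t / t \<le> C" and l: "0 < l"
  shows "l * (\<integral>t. h t \<partial>exponential_law l) \<le> C"
proof -
  have h0: "h 0 \<le> 0" using mult[of 0 0] by simp
  have "(\<integral>t. h t \<partial>exponential_law l) \<le> (\<integral>t. C * t ^ 1 \<partial>exponential_law l)"
  proof (rule integral_mono_AE[OF int])
    show "integrable (exponential_law l) (\<lambda>t. C * t ^ 1)" using exponential_moment(1)[OF l, of 1]
      by simp
    show "AE t in exponential_law l. h t \<le> C * t ^ 1"
      using AE_exponential_law_nonneg
    proof eventually_elim
      case (elim t)
      show ?case
      proof (cases "t = 0")
        case False
        with elim have "0 < t" by simp
        from C[OF this] \<open>0 < t\<close> show ?thesis by (simp add: pos_divide_le_eq)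
      qed (use h0 in simp)
    qed
  qed
  also have "\<dots> = C / l" using exponential_moment(2)[OF l, of 1] by simp
  finally show ?thesis using l by (simp add: field_simps)
qed

text \<open>The reverse of averaging: with \<open>K = h t / t\<close> the function \<open>h\<close>
  lies above the parabola \<open>K (s - s^2 / t)\<close>. The first two exponential moments turn
  this into \<open>K (1 - 2 / (l t)) \<le> C\<close>, and \<open>l\<close> tends to
  infinity.\<close>

lemma quotient_le_exponential_average:
  assumes int: "\<And>l. 0 < l \<Longrightarrow> integrable (exponential_law l) h"
    and C: "\<And>l. 0 < l \<Longrightarrow> l * (\<integral>t. h t \<partial>exponential_law l) \<le> C" and t: "0 < t"
  shows "h t / t \<le> C"
proof -
  define K where "K = h t / t"
  have K: "0 \<le> K" unfolding K_def using t nonneg by auto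
  \<comment> \<open>For \<open>s \<le> t\<close>, \<open>quotient_le\<close> is multiplied by
    \<open>1 - s / t\<close>, and \<open>(1 + s/t) (1 - s/t) \<le> 1\<close>; for
    \<open>s > t\<close> the parabola is not positive.\<close>
  have lower: "K * (s - s\<^sup>2 / t) \<le> h s" if s: "0 \<le> s" for s
  proof (cases "s = 0")
    case True then show ?thesis using nonneg[of 0] by simp
  next
    case False
    then have s: "0 < s" using s by simp
    have "K * (1 - s / t) \<le> h s / s"
    proof (cases "s \<le> t")
      case True
      have "K * (1 - s / t) \<le> (1 + s / t) * (h s / s) * (1 - s / t)"
        using quotient_le[OF s t] True t unfolding K_def by (intro mult_right_mono) auto
      also have "\<dots> = (1 - (s / t)\<^sup>2) * (h s / s)" by (simp add: power2_eq_square algebra_simps)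
      also have "\<dots> \<le> 1 * (h s / s)" using nonneg[of s] s by (intro mult_right_mono) auto
      finally show ?thesis by simp
    next
      case False
      then have "K * (1 - s / t) \<le> 0" using K t by (intro mult_nonneg_nonpos) auto
      also have "0 \<le> h s / s" using nonneg[of s] s by simp
      finally show ?thesis .
    qed
    then have "K * (1 - s / t) * s \<le> h s" using s by (simp add: pos_le_divide_eq)
    then show ?thesis by (simp add: power2_eq_square algebra_simps)
  qed
  have bound: "K * (1 - 2 / (l * t)) \<le> C" if l: "0 < l" for l
  proof -
    note mom = exponential_moment[OF l, of 1] exponential_moment[OF l, of 2]
    have "l * (\<integral>s. K * (s - s\<^sup>2 / t) \<partial>exponential_law l) \<le> l * (\<integral>s. h s \<partial>exponential_law l)"
    proof (intro mult_left_mono integral_mono_AE int[OF l])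
      show "integrable (exponential_law l) (\<lambda>s. K * (s - s\<^sup>2 / t))" using mom by simp
      show "AE s in exponential_law l. K * (s - s\<^sup>2 / t) \<le> h s"
        using AE_exponential_law_nonneg by eventually_elim (rule lower)
    qed (use l in simp)
    also have "\<dots> \<le> C" by (rule C[OF l])
    also have "(\<integral>s. K * (s - s\<^sup>2 / t) \<partial>exponential_law l) = K * (1 / l - 2 / l\<^sup>2 / t)"
      using mom by (simp add: fact_numeral)
    also have "l * (K * (1 / l - 2 / l\<^sup>2 / t)) = K * (1 - 2 / (l * t))"
      using l t by (simp add: power2_eq_square field_simps)
    finally show ?thesis .
  qed
  have "K \<le> C"
  proof (rule tendsto_upperbound)
    show "((\<lambda>l. K * (1 - 2 / (l * t))) \<longlongrightarrow> K) at_top"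
      using t by real_asymp
    show "\<forall>\<^sub>F l in at_top. K * (1 - 2 / (l * t)) \<le> C"
      using eventually_gt_at_top[of 0] by eventually_elim (rule bound)
  qed simp
  then show ?thesis by (simp add: K_def)
qed

end

section \<open>The killed process\<close>

text \<open>Points below \<open>t\<close> are approached by rationals from the right inside
  \<open>[0,t]\<close>; the inserted \<open>t\<close> covers the endpoint, where this is
  impossible.\<close>

definition dense_times :: "real \<Rightarrow> real set" where
  "dense_times t = insert t (\<rat> \<inter> {0..t})"

lemma countable_dense_times [simp]: "countable (dense_times t)"
  by (simp add: dense_times_def countable_rat)

lemma dense_times_nonneg: "0 \<le> t \<Longrightarrow> r \<in> dense_times t \<Longrightarrow> 0 \<le> r \<and> r \<le> t"
  by (auto simp: dense_times_def)

text \<open>Compactness upgrades positivity to a bound \<open>1 / (k + 1)\<close>, and such a closed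
  condition may be tested at countably many times. Mere positivity at a dense set of times would
  overlook isolated zeros.\<close>

lemma positive_on_Icc_iff:
  fixes g :: "real \<Rightarrow> real"
  assumes cont: "continuous_on {0..} g" and t: "0 \<le> t"
  shows "(\<forall>r\<in>{0..t}. 0 < g r) \<longleftrightarrow> (\<exists>k. \<forall>r\<in>dense_times t. 1 / real (Suc k) \<le> g r)"
proof
  assume pos: "\<forall>r\<in>{0..t}. 0 < g r"
  have "compact {0..t}" "{0..t} \<noteq> {}" "continuous_on {0..t} g"
    using t by (auto intro: continuous_on_subset[OF cont])
  then obtain r0 where r0: "r0 \<in> {0..t}" "\<forall>r\<in>{0..t}. g r0 \<le> g r"
    by (metis continuous_attains_inf)
  obtain k where "inverse (real (Suc k)) < g r0" using pos r0(1) reals_Archimedean by blast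
  then have "\<forall>r\<in>dense_times t. 1 / real (Suc k) \<le> g r"
    using r0(2) dense_times_nonneg[OF t] by (force simp: inverse_eq_divide)
  then show "\<exists>k. \<forall>r\<in>dense_times t. 1 / real (Suc k) \<le> g r" ..
next
  assume "\<exists>k. \<forall>r\<in>dense_times t. 1 / real (Suc k) \<le> g r"
  then obtain k where k: "\<And>r. r \<in> dense_times t \<Longrightarrow> 1 / real (Suc k) \<le> g r" by blast
  show "\<forall>r\<in>{0..t}. 0 < g r"
  proof (rule ballI, rule ccontr)
    fix r assume r: "r \<in> {0..t}" and "\<not> 0 < g r"
    then have gr: "g r \<le> 0" by simp
    have pos: "0 < 1 / real (Suc k)" by simp
    from r cont obtain e where e: "0 < e" "\<And>s. 0 \<le> s \<Longrightarrow> \<bar>s - r\<bar> < e \<Longrightarrow> \<bar>g s - g r\<bar> < 1 / real (Suc k)"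
      unfolding continuous_on_iff dist_real_def using pos by (metis atLeast_iff atLeastAtMost_iff)
    show False
    proof (cases "r = t")
      case True
      then have "1 / real (Suc k) \<le> g r" by (intro k) (simp add: dense_times_def)
      with pos have "0 < g r" by (rule less_le_trans)
      with gr show False by simp
    next
      case False
      with r have "r < min t (r + e)" using e by auto
      then obtain s where s: "s \<in> \<rat>" "r < s" "s < min t (r + e)" using Rats_dense_in_real by blast
      then have "s \<in> dense_times t" using r by (auto simp: dense_times_def)
      from k[OF this] e(2)[of s] s r gr show False by auto
    qed
  qed
qed

lemma pred_countable_Ball:
  assumes "countable D" "\<And>i. i \<in> D \<Longrightarrow> Measurable.pred M (P i)"
  shows "Measurable.pred M (\<lambda>x. \<forall>i\<in>D. P i x)"
  using assms(2) unfolding pred_def by (intro sets.sets_Collect_countable_All' assms(1))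

section \<open>Events of the path and their measurability\<close>

context linear_diffusion
begin

abbreviation "\<N> \<equiv> natural_filtration M X"

lemma space_natural [simp]: "space (\<N> t) = space M"
  unfolding natural_filtration_def by (intro space_measure_of) auto

lemma sets_natural_eq:
  "sets (\<N> t) = sigma_sets (space M) {X s -` B \<inter> space M | s B. 0 \<le> s \<and> ennreal s \<le> t \<and> B \<in> sets borel}"
  unfolding natural_filtration_def by (intro sets_measure_of) auto

lemma sets_natural_subset: "sets (\<N> t) \<subseteq> sets M"
  unfolding sets_natural_eq using measurable_X
  by (intro sets.sigma_sets_subset) (auto intro: measurable_sets)

lemma measurable_X_natural:
  assumes "0 \<le> s" "ennreal s \<le> t"
  shows "X s \<in> borel_measurable (\<N> t)"
proof (rule measurableI)
  fix B :: "real set" assume "B \<in> sets borel"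
  then show "X s -` B \<inter> space (\<N> t) \<in> sets (\<N> t)"
    unfolding sets_natural_eq space_natural using assms by (intro sigma_sets.Basic) blast
qed simp

lemma space_P [simp]: "space (P x) = space M"
  using sets_P by (rule sets_eq_imp_space_eq)

lemma measurable_natural_P: "f \<in> measurable (\<N> t) L \<Longrightarrow> f \<in> measurable (P x) L"
  using sets_natural_subset[of t] sets_P[of x] by (auto simp: measurable_def)

text \<open>\<open>P\<close> is assumed to be a kernel only on the path \<open>\<sigma>\<close>-algebra, hence the restriction.\<close>

definition law :: "real \<Rightarrow> 'w measure" where
  "law x = distr (P x) (\<N> \<infinity>) (\<lambda>\<omega>. \<omega>)"

lemma id_measurable: "(\<lambda>\<omega>. \<omega>) \<in> measurable (P x) (\<N> \<infinity>)"
  by (rule measurable_natural_P[where t=\<infinity>]) simp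

lemma sets_law [simp, measurable_cong]: "sets (law x) = sets (\<N> \<infinity>)"
  by (simp add: law_def)

lemma space_law [simp]: "space (law x) = space M"
  by (simp add: law_def)

lemma prob_space_law: "prob_space (law x)"
  unfolding law_def by (intro prob_space.prob_space_distr prob_space_P id_measurable)

lemma law_measurable [measurable]: "law \<in> borel \<rightarrow>\<^sub>M subprob_algebra (\<N> \<infinity>)"
proof (rule measurable_subprob_algebra)
  show "subprob_space (law x)" for x
    using prob_space_law by (rule prob_space_imp_subprob_space)
  fix A assume A: "A \<in> sets (\<N> \<infinity>)"
  then have "emeasure (law x) A = emeasure (P x) A" for x
    unfolding law_def using sets.sets_into_space[OF A]
    by (subst emeasure_distr[OF id_measurable]) (auto intro!: arg_cong2[where f=emeasure])
  then show "(\<lambda>x. emeasure (law x) A) \<in> borel_measurable borel" using kernel_P[OF A] by simp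
qed simp

lemma nn_integral_law:
  "f \<in> borel_measurable (\<N> \<infinity>) \<Longrightarrow> (\<integral>\<^sup>+\<omega>. f \<omega> \<partial>law x) = (\<integral>\<^sup>+\<omega>. f \<omega> \<partial>P x)"
  unfolding law_def by (intro nn_integral_distr id_measurable) simp

lemma AE_law_start: "AE \<omega> in law x. X 0 \<omega> = x"
proof -
  have [measurable]: "X 0 \<in> borel_measurable (\<N> \<infinity>)" by (rule measurable_X_natural) auto
  have "Measurable.pred (\<N> \<infinity>) (\<lambda>\<omega>. X 0 \<omega> = x)" by measurable
  then show ?thesis unfolding law_def
    by (subst AE_distr_iff[OF id_measurable]) (simp_all add: pred_def start)
qed

lemma path_bounded:
  assumes \<omega>: "\<omega> \<in> space M"
  shows "\<exists>B. \<forall>r\<in>{0..t}. \<bar>X r \<omega>\<bar> \<le> B"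
proof -
  have "compact ((\<lambda>r. X r \<omega>) ` {0..t})"
    by (intro compact_continuous_image continuous_on_subset[OF continuous_paths[OF \<omega>]]) auto
  then have "bounded ((\<lambda>r. X r \<omega>) ` {0..t})" by (rule compact_imp_bounded)
  then show ?thesis by (auto simp: bounded_iff)
qed

text \<open>Strictness is where continuity enters: a path that avoids \<open>y\<close> up to
  \<open>t\<close> also avoids it for a short time afterwards, so the infimum exceeds
  \<open>t\<close>.\<close>

lemma hitting_time_gt_iff:
  assumes \<omega>: "\<omega> \<in> space M" and t: "0 \<le> t"
  shows "ennreal t < hitting_time X y \<omega> \<longleftrightarrow> (\<forall>r\<in>{0..t}. X r \<omega> \<noteq> y)"
proof
  assume lt: "ennreal t < hitting_time X y \<omega>"
  show "\<forall>r\<in>{0..t}. X r \<omega> \<noteq> y"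
  proof (intro ballI notI)
    fix r assume r: "r \<in> {0..t}" "X r \<omega> = y"
    then have "hitting_time X y \<omega> \<le> ennreal r" unfolding hitting_time_def by (intro INF_lower) auto
    also have "\<dots> \<le> ennreal t" using r by (intro ennreal_leI) auto
    finally show False using lt by simp
  qed
next
  assume no: "\<forall>r\<in>{0..t}. X r \<omega> \<noteq> y"
  then have "0 < \<bar>X t \<omega> - y\<bar>" using t by auto
  with continuous_paths[OF \<omega>] t obtain e
    where e: "0 < e" "\<And>s. 0 \<le> s \<Longrightarrow> \<bar>s - t\<bar> < e \<Longrightarrow> \<bar>X s \<omega> - X t \<omega>\<bar> < \<bar>X t \<omega> - y\<bar>"
    unfolding continuous_on_iff dist_real_def by (metis atLeast_iff)
  have "ennreal t < ennreal (t + e)" using t e by (simp add: ennreal_less_iff)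
  also have "ennreal (t + e) \<le> hitting_time X y \<omega>"
    unfolding hitting_time_def
  proof (intro INF_greatest ennreal_leI)
    fix s assume "s \<in> {s. 0 \<le> s \<and> X s \<omega> = y}"
    then have s: "0 \<le> s" "X s \<omega> = y" by auto
    with no have "t < s" by (metis atLeastAtMost_iff not_le)
    moreover have "\<not> \<bar>s - t\<bar> < e" using e(2)[of s] s by auto
    ultimately show "t + e \<le> s" by linarith
  qed
  finally show "ennreal t < hitting_time X y \<omega>" .
qed

lemma hitting_time_measurable [measurable]: "hitting_time X y \<in> borel_measurable (\<N> \<infinity>)"
proof (rule borel_measurableI_le)
  fix c :: ennreal
  show "{\<omega> \<in> space (\<N> \<infinity>). hitting_time X y \<omega> \<le> c} \<in> sets (\<N> \<infinity>)"
  proof (cases c)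
    case (real t)
    have "Measurable.pred (\<N> \<infinity>) (\<lambda>\<omega>. \<exists>k. \<forall>r\<in>dense_times t. 1 / real (Suc k) \<le> \<bar>X r \<omega> - y\<bar>)"
    proof (intro pred_intros_countable pred_countable_Ball countable_dense_times)
      fix k r assume "r \<in> dense_times t"
      then have [measurable]: "X r \<in> borel_measurable (\<N> \<infinity>)"
        using dense_times_nonneg[OF real(1)] by (intro measurable_X_natural) auto
      show "Measurable.pred (\<N> \<infinity>) (\<lambda>\<omega>. 1 / real (Suc k) \<le> \<bar>X r \<omega> - y\<bar>)" by measurable
    qed
    then have "{\<omega> \<in> space (\<N> \<infinity>). \<not> (\<exists>k. \<forall>r\<in>dense_times t. 1 / real (Suc k) \<le> \<bar>X r \<omega> - y\<bar>)} \<in> sets (\<N> \<infinity>)"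
      by measurable
    also have "{\<omega> \<in> space (\<N> \<infinity>). \<not> (\<exists>k. \<forall>r\<in>dense_times t. 1 / real (Suc k) \<le> \<bar>X r \<omega> - y\<bar>)}
      = {\<omega> \<in> space (\<N> \<infinity>). hitting_time X y \<omega> \<le> c}"
    proof (rule Collect_cong, rule conj_cong[OF refl])
      fix \<omega> assume "\<omega> \<in> space (\<N> \<infinity>)"
      then have \<omega>: "\<omega> \<in> space M" by simp
      have "(\<exists>k. \<forall>r\<in>dense_times t. 1 / real (Suc k) \<le> \<bar>X r \<omega> - y\<bar>) \<longleftrightarrow> (\<forall>r\<in>{0..t}. 0 < \<bar>X r \<omega> - y\<bar>)"
        by (intro positive_on_Icc_iff[symmetric] real continuous_intros continuous_paths[OF \<omega>])
      then show "(\<not> (\<exists>k. \<forall>r\<in>dense_times t. 1 / real (Suc k) \<le> \<bar>X r \<omega> - y\<bar>)) = (hitting_time X y \<omega> \<le> c)"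
        unfolding real(2) using hitting_time_gt_iff[OF \<omega> real(1), of y]
          by (auto simp: not_less[symmetric])
    qed
    finally show ?thesis .
  qed (use sets.top[of "\<N> \<infinity>"] in simp)
qed

text \<open>The condition on \<open>X 0\<close> excludes paths that start outside the interval and
  would count as alive until they meet an endpoint.\<close>

definition alive :: "real \<Rightarrow> real \<Rightarrow> real \<Rightarrow> 'w \<Rightarrow> bool" where
  "alive a b t \<omega> \<longleftrightarrow> a < X 0 \<omega> \<and> X 0 \<omega> < b \<and> ennreal t < min (hitting_time X a \<omega>) (hitting_time X b \<omega>)"

lemma alive_iff:
  assumes \<omega>: "\<omega> \<in> space M" and t: "0 \<le> t"
  shows "alive a b t \<omega> \<longleftrightarrow> (\<forall>r\<in>{0..t}. a < X r \<omega> \<and> X r \<omega> < b)"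
proof
  assume "alive a b t \<omega>"
  then have start: "a < X 0 \<omega>" "X 0 \<omega> < b" and no: "\<And>r. r \<in> {0..t} \<Longrightarrow> X r \<omega> \<noteq> a"
    "\<And>r. r \<in> {0..t} \<Longrightarrow> X r \<omega> \<noteq> b"
    by (auto simp: alive_def hitting_time_gt_iff[OF \<omega> t])
  have cont: "continuous_on {0..r} (\<lambda>t. X t \<omega>)" for r
    by (rule continuous_on_subset[OF continuous_paths[OF \<omega>]]) auto
  show "\<forall>r\<in>{0..t}. a < X r \<omega> \<and> X r \<omega> < b"
  proof (intro ballI conjI; rule ccontr)
    fix r assume r: "r \<in> {0..t}" "\<not> a < X r \<omega>"
    then obtain s where "0 \<le> s" "s \<le> r" "X s \<omega> = a"
      using IVT2'[of "\<lambda>t. X t \<omega>" r a 0, OF _ _ _ cont] start by auto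
    with no(1)[of s] r show False by auto
  next
    fix r assume r: "r \<in> {0..t}" "\<not> X r \<omega> < b"
    then obtain s where "0 \<le> s" "s \<le> r" "X s \<omega> = b"
      using IVT'[of "\<lambda>t. X t \<omega>" 0 b r, OF _ _ _ cont] start by auto
    with no(2)[of s] r show False by auto
  qed
next
  assume "\<forall>r\<in>{0..t}. a < X r \<omega> \<and> X r \<omega> < b"
  then show "alive a b t \<omega>"
    using t by (fastforce simp: alive_def hitting_time_gt_iff[OF \<omega> t])
qed

lemma stays_iff_countable:
  assumes \<omega>: "\<omega> \<in> space M" and s: "0 \<le> s" and t: "0 \<le> t"
  shows "(\<forall>r\<in>{0..t}. a < X (s + r) \<omega> \<and> X (s + r) \<omega> < b) \<longleftrightarrow>
    (\<exists>k. \<forall>r\<in>dense_times t. 1 / real (Suc k) \<le> min (X (s + r) \<omega> - a) (b - X (s + r) \<omega>))"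
proof -
  have "continuous_on {0..} (\<lambda>r. X (s + r) \<omega>)"
    by (rule continuous_on_compose2[OF continuous_paths[OF \<omega>]])
      (use s in \<open>auto intro!: continuous_intros\<close>)
  then have "continuous_on {0..} (\<lambda>r. min (X (s + r) \<omega> - a) (b - X (s + r) \<omega>))"
    by (intro continuous_intros)
  from positive_on_Icc_iff[OF this t] show ?thesis by simp
qed

text \<open>Measurability at time \<open>t\<close>, not merely at \<open>\<infinity>\<close>, allows
  survival up to \<open>t\<close> to be the past event in the Markov property.\<close>

lemma alive_adapted:
  assumes t: "0 \<le> t"
  shows "{\<omega> \<in> space M. alive a b t \<omega>} \<in> sets (\<N> (ennreal t))"
proof -
  have "Measurable.pred (\<N> (ennreal t))
    (\<lambda>\<omega>. \<exists>k. \<forall>r\<in>dense_times t. 1 / real (Suc k) \<le> min (X r \<omega> - a) (b - X r \<omega>))"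
  proof (intro pred_intros_countable pred_countable_Ball countable_dense_times)
    fix k r assume "r \<in> dense_times t"
    then have [measurable]: "X r \<in> borel_measurable (\<N> (ennreal t))"
      using dense_times_nonneg[OF t] by (intro measurable_X_natural ennreal_leI) auto
    show "Measurable.pred (\<N> (ennreal t)) (\<lambda>\<omega>. 1 / real (Suc k) \<le> min (X r \<omega> - a) (b - X r \<omega>))"
      by measurable
  qed
  then have "{\<omega> \<in> space (\<N> (ennreal t)). \<exists>k. \<forall>r\<in>dense_times t. 1 / real (Suc k)
    \<le> min (X r \<omega> - a) (b - X r \<omega>)} \<in> sets (\<N> (ennreal t))"
    by (simp add: pred_def)
  also have "{\<omega> \<in> space (\<N> (ennreal t)). \<exists>k. \<forall>r\<in>dense_times t. 1 / real (Suc k)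
    \<le> min (X r \<omega> - a) (b - X r \<omega>)} = {\<omega> \<in> space M. alive a b t \<omega>}"
  proof (rule Collect_cong, unfold space_natural, rule conj_cong[OF refl])
    fix \<omega> assume \<omega>: "\<omega> \<in> space M"
    show "(\<exists>k. \<forall>r\<in>dense_times t. 1 / real (Suc k) \<le> min (X r \<omega> - a) (b - X r \<omega>)) = alive a b t \<omega>"
      using stays_iff_countable[OF \<omega> order_refl t, of a b] alive_iff[OF \<omega> t, of a b]
        by (simp del: of_nat_Suc)
  qed
  finally show ?thesis .
qed

lemma alive_measurable [measurable]:
  assumes [measurable]: "f \<in> L \<rightarrow>\<^sub>M borel" "g \<in> L \<rightarrow>\<^sub>M \<N> \<infinity>"
  shows "Measurable.pred L (\<lambda>z. alive a b (f z) (g z))"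
proof -
  have [measurable]: "X 0 \<in> borel_measurable (\<N> \<infinity>)" by (rule measurable_X_natural) auto
  show ?thesis unfolding alive_def by measurable
qed

text \<open>By continuity of the paths, \<open>X\<close> is the limit of its values at times rounded
  down to multiples of \<open>1 / (n + 1)\<close>, and these times range over a countable
  set.\<close>

lemma X_jointly_measurable: "(\<lambda>p. X (max 0 (fst p)) (snd p)) \<in> borel_measurable (borel \<Otimes>\<^sub>M \<N> \<infinity>)"
proof (rule borel_measurable_LIMSEQ_real)
  let ?d = "\<lambda>n t. max 0 (real_of_int \<lfloor>real (Suc n) * t\<rfloor> / real (Suc n))"
  show "(\<lambda>p. X (?d n (fst p)) (snd p)) \<in> borel_measurable (borel \<Otimes>\<^sub>M \<N> \<infinity>)" for n
  proof -
    have "(\<lambda>p. X (max 0 (real_of_int i / real (Suc n))) (snd p)) \<in> borel_measurable (borel \<Otimes>\<^sub>M \<N> \<infinity>)"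
      for i
      by (rule measurable_compose[OF measurable_snd measurable_X_natural]) auto
    moreover have "(\<lambda>p::real \<times> 'w. \<lfloor>real (Suc n) * fst p\<rfloor>) \<in> (borel \<Otimes>\<^sub>M \<N> \<infinity>) \<rightarrow>\<^sub>M count_space UNIV"
      by measurable
    ultimately show ?thesis by (rule measurable_compose_countable)
  qed
  fix p :: "real \<times> 'w" assume "p \<in> space (borel \<Otimes>\<^sub>M \<N> \<infinity>)"
  then have \<omega>: "snd p \<in> space M" by (auto simp: space_pair_measure)
  have "(\<lambda>n. real_of_int \<lfloor>real (Suc n) * fst p\<rfloor> / real (Suc n)) \<longlonglongrightarrow> fst p"
  proof (rule tendsto_sandwich)
    note inv = LIMSEQ_Suc[OF lim_1_over_n[where 'a=real]]
    show "(\<lambda>n. fst p - 1 / real (Suc n)) \<longlonglongrightarrow> fst p" using tendsto_diff[OF tendsto_const inv] by simp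
    show "\<forall>\<^sub>F n in sequentially. fst p - 1 / real (Suc n)
      \<le> real_of_int \<lfloor>real (Suc n) * fst p\<rfloor> / real (Suc n)"
    proof (intro always_eventually allI)
      fix n
      have "fst p - 1 / real (Suc n) = (real (Suc n) * fst p - 1) / real (Suc n)"
        by (simp add: diff_divide_distrib del: of_nat_Suc)
      also have "\<dots> \<le> real_of_int \<lfloor>real (Suc n) * fst p\<rfloor> / real (Suc n)"
        by (intro divide_right_mono) linarith+
      finally show "fst p - 1 / real (Suc n) \<le> real_of_int \<lfloor>real (Suc n) * fst p\<rfloor> / real (Suc n)" .
    qed
    show "\<forall>\<^sub>F n in sequentially. real_of_int \<lfloor>real (Suc n) * fst p\<rfloor> / real (Suc n) \<le> fst p"
    proof (intro always_eventually allI)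
      fix n
      have "real_of_int \<lfloor>real (Suc n) * fst p\<rfloor> / real (Suc n) \<le> (real (Suc n) * fst p) / real (Suc n)"
        by (intro divide_right_mono) linarith+
      then show "real_of_int \<lfloor>real (Suc n) * fst p\<rfloor> / real (Suc n) \<le> fst p" by (simp del: of_nat_Suc)
    qed
  qed simp
  then have "(\<lambda>n. ?d n (fst p)) \<longlonglongrightarrow> max 0 (fst p)" by (intro tendsto_intros)
  then show "(\<lambda>n. X (?d n (fst p)) (snd p)) \<longlonglongrightarrow> X (max 0 (fst p)) (snd p)"
    by (intro continuous_on_tendsto_compose[OF continuous_paths[OF \<omega>]]) auto
qed

lemma X_measurable' [measurable]:
  assumes "f \<in> L \<rightarrow>\<^sub>M borel" "g \<in> L \<rightarrow>\<^sub>M \<N> \<infinity>"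
  shows "(\<lambda>z. X (max 0 (f z)) (g z)) \<in> borel_measurable L"
  using measurable_compose[OF measurable_Pair[OF assms] X_jointly_measurable] by simp

lemma measurable_law_nn:
  assumes "(\<lambda>(z, \<omega>). f z \<omega>) \<in> borel_measurable (L \<Otimes>\<^sub>M \<N> \<infinity>)" "g \<in> L \<rightarrow>\<^sub>M borel"
  shows "(\<lambda>z. \<integral>\<^sup>+\<omega>. f z \<omega> \<partial>law (g z)) \<in> borel_measurable L"
  by (rule nn_integral_measurable_subprob_algebra2[OF assms(1)
    measurable_compose[OF assms(2) law_measurable]])

text \<open>
  The semigroup of \<open>X\<close> killed at the exit from \<open>(a,b)\<close> and that of \<open>X\<close>. The time \<open>max 0 t\<close>
  makes them jointly measurable in \<open>t\<close> and \<open>x\<close> without a restriction on \<open>t\<close>.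
\<close>

definition killed :: "real \<Rightarrow> real \<Rightarrow> real \<Rightarrow> (real \<Rightarrow> ennreal) \<Rightarrow> real \<Rightarrow> ennreal" where
  "killed a b t f x = (\<integral>\<^sup>+\<omega>. (if alive a b t \<omega> then f (X (max 0 t) \<omega>) else 0) \<partial>law x)"

definition free :: "real \<Rightarrow> (real \<Rightarrow> ennreal) \<Rightarrow> real \<Rightarrow> ennreal" where
  "free t f x = (\<integral>\<^sup>+\<omega>. f (X (max 0 t) \<omega>) \<partial>law x)"

lemma killed_measurable [measurable]:
  assumes [measurable]: "f \<in> borel_measurable borel" "u \<in> L \<rightarrow>\<^sub>M borel" "v \<in> L \<rightarrow>\<^sub>M borel"
  shows "(\<lambda>z. killed a b (u z) f (v z)) \<in> borel_measurable L"
  unfolding killed_def by (rule measurable_law_nn) measurable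

lemma free_measurable [measurable]:
  assumes [measurable]: "f \<in> borel_measurable borel" "u \<in> L \<rightarrow>\<^sub>M borel" "v \<in> L \<rightarrow>\<^sub>M borel"
  shows "(\<lambda>z. free (u z) f (v z)) \<in> borel_measurable L"
  unfolding free_def by (rule measurable_law_nn) measurable

lemma killed_measurable':
  assumes "f \<in> borel_measurable borel"
  shows "killed a b t f \<in> borel_measurable borel"
  by (rule killed_measurable[OF assms borel_measurable_const measurable_ident_sets[OF refl]])

lemma free_measurable':
  assumes "f \<in> borel_measurable borel"
  shows "free t f \<in> borel_measurable borel"
  by (rule free_measurable[OF assms borel_measurable_const measurable_ident_sets[OF refl]])

lemma killed_integrand_measurable:
  assumes f: "f \<in> borel_measurable borel"
  shows "(\<lambda>\<omega>. if alive a b t \<omega> then f (X (max 0 t) \<omega>) else (0::ennreal)) \<in> borel_measurable (\<N> \<infinity>)"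
  by (intro measurable_If measurable_compose[OF X_measurable'[of "\<lambda>_. t" _ "\<lambda>\<omega>. \<omega>"] f]
      alive_measurable[of "\<lambda>_. t" _ "\<lambda>\<omega>. \<omega>", unfolded pred_def]) simp_all

section \<open>Exhaustion by bounded intervals and the semigroup property\<close>

lemma alive_eventually:
  assumes \<omega>: "\<omega> \<in> space M" and t: "0 \<le> t"
  shows "\<exists>n. alive (- real n) (real n) t \<omega>"
proof -
  from path_bounded[OF \<omega>] obtain B where B: "\<And>r. r \<in> {0..t} \<Longrightarrow> \<bar>X r \<omega>\<bar> \<le> B" by blast
  obtain n where "B < real n" using reals_Archimedean2 by blast
  with B have "alive (- real n) (real n) t \<omega>" unfolding alive_iff[OF \<omega> t] by (force simp: abs_le_iff)
  then show ?thesis ..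
qed

lemma alive_mono_interval:
  assumes \<omega>: "\<omega> \<in> space M" and t: "0 \<le> t" and "alive a b t \<omega>" "a' \<le> a" "b \<le> b'"
  shows "alive a' b' t \<omega>"
  using assms unfolding alive_iff[OF \<omega> t] by force

text \<open>A continuous path is bounded on \<open>[0,t]\<close> and so survives in
  \<open>(-n,n)\<close> for large \<open>n\<close>. Monotone convergence through this identity
  transfers the semigroup property and the resolvent from the killed process to
  \<open>X\<close>.\<close>

lemma free_eq_SUP_killed:
  assumes t: "0 \<le> t" and [measurable]: "f \<in> borel_measurable borel"
  shows "free t f x = (SUP n. killed (- real n) (real n) t f x)"
proof -
  have "(SUP n. killed (- real n) (real n) t f x) =
    (\<integral>\<^sup>+\<omega>. (SUP n. if alive (- real n) (real n) t \<omega> then f (X (max 0 t) \<omega>) else 0) \<partial>law x)"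
    unfolding killed_def
  proof (rule nn_integral_monotone_convergence_SUP_AE[symmetric])
    show "AE \<omega> in law x. (if alive (- real n) (real n) t \<omega> then f (X (max 0 t) \<omega>) else 0) \<le>
      (if alive (- real (Suc n)) (real (Suc n)) t \<omega> then f (X (max 0 t) \<omega>) else 0)" for n
      using alive_mono_interval[OF _ t, of _ "- real n" "real n" "- real (Suc n)" "real (Suc n)"]
        by (intro AE_I2) auto
  qed measurable
  also have "\<dots> = free t f x"
    unfolding free_def
  proof (rule nn_integral_cong)
    fix \<omega> assume "\<omega> \<in> space (law x)"
    then have \<omega>: "\<omega> \<in> space M" by simp
    from alive_eventually[OF \<omega> t] obtain n where "alive (- real n) (real n) t \<omega>" ..
    then show "(SUP n. if alive (- real n) (real n) t \<omega> then f (X (max 0 t) \<omega>) else 0)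
      = f (X (max 0 t) \<omega>)"
      by (intro antisym SUP_least SUP_upper2[of n]) auto
  qed
  finally show ?thesis by simp
qed

lemma killed_mono_interval:
  assumes "0 \<le> t" "a' \<le> a" "b \<le> b'"
  shows "killed a b t f x \<le> killed a' b' t f x"
  unfolding killed_def using alive_mono_interval[OF _ assms(1) _ assms(2,3)]
  by (intro nn_integral_mono) auto

lemma killed_mono: "f \<le> g \<Longrightarrow> killed a b t f x \<le> killed a b t g x"
  unfolding killed_def le_fun_def by (intro nn_integral_mono) auto

lemma killed_le_const:
  assumes "\<And>x. f x \<le> c"
  shows "killed a b t f x \<le> c"
proof -
  have "killed a b t f x \<le> (\<integral>\<^sup>+\<omega>. c \<partial>law x)"
    unfolding killed_def using assms by (intro nn_integral_mono) auto
  then show ?thesis using prob_space.emeasure_space_1[OF prob_space_law] by simp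
qed

lemma killed_outside:
  assumes "x \<notin> {a<..<b}"
  shows "killed a b t f x = 0"
proof -
  from AE_law_start[of x] have "killed a b t f x = (\<integral>\<^sup>+\<omega>. 0 \<partial>law x)"
    unfolding killed_def by (intro nn_integral_cong_AE)
      (use assms in \<open>auto elim!: eventually_mono simp: alive_def\<close>)
  then show ?thesis by simp
qed

text \<open>The strong Markov property at a constant time: \<open>A\<close> is survival up to
  \<open>t\<close>, and \<open>B\<close> consists of the paths that survive for a further time
  \<open>s\<close> and end in \<open>C\<close>. Membership of \<open>B\<close> in the product
  sigma-algebra forces the description by countably many coordinates.\<close>

lemma killed_add_time_indicator:
  assumes s: "0 \<le> s" and t: "0 \<le> t" and C: "C \<in> sets borel"
  shows "killed a b (t + s) (indicator C) x = killed a b t (killed a b s (indicator C)) x"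
proof -
  let ?\<Pi> = "PiM {0..} (\<lambda>_::real. borel :: real measure)"
  define B where "B = {p \<in> space ?\<Pi>. (\<exists>k. \<forall>r\<in>dense_times s. 1 / real (Suc k) \<le> min (p r - a) (b - p r))
    \<and> p s \<in> C}"
  define A where "A = {\<omega> \<in> space M. alive a b t \<omega>}"
  have B: "B \<in> sets ?\<Pi>"
  proof -
    have "Measurable.pred ?\<Pi> (\<lambda>p. \<exists>k. \<forall>r\<in>dense_times s. 1 / real (Suc k) \<le> min (p r - a) (b - p r))"
    proof (intro pred_intros_countable pred_countable_Ball countable_dense_times)
      fix k r assume "r \<in> dense_times s"
      then have [measurable]: "(\<lambda>p. p r) \<in> borel_measurable ?\<Pi>"
        using dense_times_nonneg[OF s] by (intro measurable_component_singleton) auto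
      show "Measurable.pred ?\<Pi> (\<lambda>p. 1 / real (Suc k) \<le> min (p r - a) (b - p r))" by measurable
    qed
    moreover have "Measurable.pred ?\<Pi> (\<lambda>p. p s \<in> C)"
      using s C measurable_sets[OF measurable_component_singleton[of s "{0..}" "\<lambda>_. borel"] C]
      by (simp add: pred_def vimage_def Int_def conj_commute)
    ultimately show ?thesis unfolding B_def by (simp add: pred_def[symmetric] pred_intros_logic)
  qed
  have path: "path_from X u \<omega> \<in> B \<longleftrightarrow> (\<forall>r\<in>{0..s}. a < X (u + r) \<omega> \<and> X (u + r) \<omega> < b) \<and> X (u + s) \<omega> \<in> C"
    if "\<omega> \<in> space M" "0 \<le> u" for u \<omega>
  proof -
    have "path_from X u \<omega> \<in> space ?\<Pi>" by (auto simp: path_from_def space_PiM)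
    moreover have "path_from X u \<omega> r = X (u + r) \<omega>" if "0 \<le> r" for r using that
      by (simp add: path_from_def)
    ultimately show ?thesis
      unfolding stays_iff_countable[OF that s] B_def using s dense_times_nonneg[OF s]
        by (simp cong: ball_cong)
  qed
  have path0: "path_from X 0 \<omega> \<in> B \<longleftrightarrow> alive a b s \<omega> \<and> X (max 0 s) \<omega> \<in> C" if "\<omega> \<in> space M" for \<omega>
    using path[OF that, of 0] alive_iff[OF that s] s by simp
  have patht: "\<omega> \<in> A \<and> path_from X t \<omega> \<in> B \<longleftrightarrow> alive a b (t + s) \<omega> \<and> X (max 0 (t + s)) \<omega> \<in> C"
    if \<omega>: "\<omega> \<in> space M" for \<omega>
  proof -
    have "(\<forall>r\<in>{0..t}. Q r) \<and> (\<forall>r\<in>{0..s}. Q (t + r)) \<longleftrightarrow> (\<forall>r\<in>{0..t + s}. Q r)" for Q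
    proof (safe)
      fix r assume Q: "\<forall>r\<in>{0..t}. Q r" "\<forall>r\<in>{0..s}. Q (t + r)" and r: "r \<in> {0..t + s}"
      show "Q r"
      proof (cases "r \<le> t")
        case False
        then show ?thesis using Q(2)[rule_format, of "r - t"] r by simp
      qed (use Q r in auto)
    qed (use s t in auto)
    from this[of "\<lambda>r. a < X r \<omega> \<and> X r \<omega> < b"] show ?thesis
      using path[OF \<omega> t] \<omega> s t by (auto simp: A_def alive_iff)
  qed
  have ev: "{\<omega> \<in> space M. alive a b u \<omega> \<and> X (max 0 u) \<omega> \<in> C} \<in> sets (\<N> \<infinity>)" for u
  proof -
    have "Measurable.pred (\<N> \<infinity>) (\<lambda>\<omega>. alive a b u \<omega> \<and> X (max 0 u) \<omega> \<in> C)"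
      using C by measurable
    then show ?thesis by (simp add: pred_def)
  qed
  have killed_ind: "killed a b u (indicator C) y
    = emeasure (P y) {\<omega> \<in> space M. alive a b u \<omega> \<and> X (max 0 u) \<omega> \<in> C}" for u y
  proof -
    have "killed a b u (indicator C) y
      = (\<integral>\<^sup>+\<omega>. indicator {\<omega> \<in> space M. alive a b u \<omega> \<and> X (max 0 u) \<omega> \<in> C} \<omega> \<partial>law y)"
      unfolding killed_def by (intro nn_integral_cong) (auto simp: indicator_def)
    also have "\<dots> = (\<integral>\<^sup>+\<omega>. indicator {\<omega> \<in> space M. alive a b u \<omega> \<and> X (max 0 u) \<omega> \<in> C} \<omega> \<partial>P y)"
      using ev by (intro nn_integral_law) simp
    also have "\<dots> = emeasure (P y) {\<omega> \<in> space M. alive a b u \<omega> \<and> X (max 0 u) \<omega> \<in> C}"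
      using ev[of u] sets_natural_subset[of \<infinity>] sets_P[of y] by (intro nn_integral_indicator) auto
    finally show ?thesis .
  qed
  have "killed a b (t + s) (indicator C) x
    = emeasure (P x) {\<omega> \<in> A. ennreal t < \<infinity> \<and> path_from X (enn2real (ennreal t)) \<omega> \<in> B}"
    unfolding killed_ind using patht t by (intro arg_cong2[where f=emeasure]) (auto simp: A_def)
  also have "\<dots> = (\<integral>\<^sup>+\<omega>\<in>{\<omega> \<in> A. ennreal t < \<infinity>}. emeasure (P (X (enn2real (ennreal t)) \<omega>))
    {\<omega>' \<in> space M. path_from X 0 \<omega>' \<in> B} \<partial>P x)"
  proof (rule strong_markov[OF stopping_time_const _ B])
    interpret filtration "space M" "right_filtration M X" by (rule filtration_right_filtration)
    show "A \<in> sets (pre_sigma (\<lambda>\<omega>. ennreal t))"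
    proof (rule sets_pre_sigmaI[OF stopping_time_const])
      fix u
      show "{\<omega> \<in> A. ennreal t \<le> u} \<in> sets (right_filtration M X u)"
      proof (cases "ennreal t \<le> u")
        case True
        have "A \<in> sets (\<N> (ennreal t))" unfolding A_def by (rule alive_adapted[OF t])
        moreover have "sets (\<N> (ennreal t)) \<subseteq> sets (\<N> v)" if "v \<in> insert \<infinity> {u<..}" for v
          using that True by (intro sets_natural_filtration_mono) auto
        ultimately show ?thesis using True unfolding sets_right_filtration by auto
      qed simp
    qed
  qed
  also have "\<dots> = (\<integral>\<^sup>+\<omega>. (if alive a b t \<omega> then killed a b s (indicator C) (X (max 0 t) \<omega>) else 0) \<partial>P x)"
    unfolding killed_ind using path0 t
    by (intro nn_integral_cong) (auto simp: A_def indicator_def intro!: arg_cong2[where f=emeasure])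
  also have "\<dots> = killed a b t (killed a b s (indicator C)) x"
  proof -
    have "(\<lambda>\<omega>. if alive a b t \<omega> then killed a b s (indicator C) (X (max 0 t) \<omega>) else 0)
      \<in> borel_measurable (\<N> \<infinity>)"
      by (rule killed_integrand_measurable[OF killed_measurable']) (use C in simp)
    then show ?thesis unfolding killed_def[of a b t] by (rule nn_integral_law[symmetric])
  qed
  finally show ?thesis .
qed

lemma killed_add_time:
  assumes st: "0 \<le> s" "0 \<le> t" and f: "f \<in> borel_measurable borel"
  shows "killed a b (t + s) f x = killed a b t (killed a b s f) x"
  using f
proof (induction f arbitrary: x rule: borel_measurable_induct)
  case (cong f g)
  then have "f = g" by (auto simp: fun_eq_iff)
  with cong show ?case by simp
next
  case (set A)
  then show ?case using killed_add_time_indicator[OF st] by simp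
next
  case (mult u c)
  note [measurable] = mult(1)
  have *: "killed a b r (\<lambda>y. c * h y) y = c * killed a b r h y"
    if [measurable]: "h \<in> borel_measurable borel" for r h y
    unfolding killed_def by (subst nn_integral_cmult[symmetric]) (auto intro!: nn_integral_cong)
  show ?case using mult by (simp add: *)
next
  case (add u v)
  note [measurable] = add(1,3)
  have *: "killed a b r (\<lambda>y. h y + h' y) y = killed a b r h y + killed a b r h' y"
    if [measurable]: "h \<in> borel_measurable borel" "h' \<in> borel_measurable borel" for r h h' y
    unfolding killed_def by (subst nn_integral_add[symmetric]) (auto intro!: nn_integral_cong)
  show ?case using add by (simp add: *)
next
  case (seq U)
  note [measurable] = seq(1)
  have *: "killed a b r (\<lambda>y. SUP i. V i y) y = (SUP i. killed a b r (V i) y)"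
    if [measurable]: "\<And>i. V i \<in> borel_measurable borel" and "incseq V" for r V y
  proof -
    have "(SUP i. killed a b r (V i) y)
      = (\<integral>\<^sup>+\<omega>. (SUP i. if alive a b r \<omega> then V i (X (max 0 r) \<omega>) else 0) \<partial>law y)"
      unfolding killed_def using that(2)
      by (intro nn_integral_monotone_convergence_SUP[symmetric]) (auto simp: incseq_def le_fun_def)
    also have "\<dots> = killed a b r (\<lambda>y. SUP i. V i y) y"
      unfolding killed_def by (intro nn_integral_cong) auto
    finally show ?thesis ..
  qed
  have inc: "incseq (\<lambda>i. killed a b s (U i))"
    using seq(3) by (auto simp: incseq_def le_fun_def[of "killed _ _ _ _"] intro!: killed_mono)
  have "Sup (range U) = (\<lambda>y. SUP i. U i y)" by (auto simp: fun_eq_iff image_image)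
  then show ?case using seq by (simp add: * inc)
qed

text \<open>Both semigroups are exhausted by intervals; by monotonicity the double supremum equals
  the one along the diagonal, where \<open>killed_add_time\<close> applies.\<close>

lemma free_add_time:
  assumes st: "0 \<le> s" "0 \<le> t" and f [measurable]: "f \<in> borel_measurable borel"
  shows "free (t + s) f x = free t (free s f) x"
proof -
  have "free t (free s f) x = (SUP n. killed (- real n) (real n) t (free s f) x)"
    by (rule free_eq_SUP_killed[OF st(2) free_measurable'[OF f]])
  also have "\<dots> = (SUP n. SUP k. killed (- real n) (real n) t (killed (- real k) (real k) s f) x)"
  proof (rule SUP_cong[OF refl])
    fix n :: nat
    have "(SUP k. killed (- real n) (real n) t (killed (- real k) (real k) s f) x) =
      (\<integral>\<^sup>+\<omega>. (SUP k. if alive (- real n) (real n) t \<omega> then killed (- real k) (real k) s f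
        (X (max 0 t) \<omega>) else 0) \<partial>law x)"
      unfolding killed_def[of "- real n" "real n" t]
      by (intro nn_integral_monotone_convergence_SUP[symmetric])
        (auto simp: incseq_def le_fun_def intro!: killed_mono_interval st)
    also have "\<dots> = killed (- real n) (real n) t (free s f) x"
      unfolding killed_def[of "- real n" "real n" t]
      by (intro nn_integral_cong) (auto simp: free_eq_SUP_killed[OF st(1) f])
    finally show "killed (- real n) (real n) t (free s f) x
      = (SUP k. killed (- real n) (real n) t (killed (- real k) (real k) s f) x)" ..
  qed
  also have "\<dots> = (SUP n. killed (- real n) (real n) t (killed (- real n) (real n) s f) x)"
  proof (rule antisym)
    show "(SUP n. SUP k. killed (- real n) (real n) t (killed (- real k) (real k) s f) x) \<le>
      (SUP n. killed (- real n) (real n) t (killed (- real n) (real n) s f) x)"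
    proof (intro SUP_least)
      fix n k :: nat
      let ?N = "max n k"
      have "killed (- real n) (real n) t (killed (- real k) (real k) s f) x
        \<le> killed (- real ?N) (real ?N) t (killed (- real k) (real k) s f) x"
        by (intro killed_mono_interval st) auto
      also have "\<dots> \<le> killed (- real ?N) (real ?N) t (killed (- real ?N) (real ?N) s f) x"
        by (intro killed_mono le_funI killed_mono_interval st) auto
      also have "\<dots> \<le> (SUP n. killed (- real n) (real n) t (killed (- real n) (real n) s f) x)"
        by (rule SUP_upper) simp
      finally show "killed (- real n) (real n) t (killed (- real k) (real k) s f) x \<le>
        (SUP n. killed (- real n) (real n) t (killed (- real n) (real n) s f) x)" .
    qed
    show "(SUP n. killed (- real n) (real n) t (killed (- real n) (real n) s f) x) \<le>
      (SUP n. SUP k. killed (- real n) (real n) t (killed (- real k) (real k) s f) x)"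
    proof (rule SUP_least)
      fix n :: nat
      show "killed (- real n) (real n) t (killed (- real n) (real n) s f) x \<le>
        (SUP n. SUP k. killed (- real n) (real n) t (killed (- real k) (real k) s f) x)"
        by (rule SUP_upper2[of n], simp, rule SUP_upper) simp
    qed
  qed
  also have "\<dots> = (SUP n. killed (- real n) (real n) (t + s) f x)"
    by (simp add: killed_add_time[OF st f])
  also have "\<dots> = free (t + s) f x" using st by (intro free_eq_SUP_killed[symmetric]) auto
  finally show ?thesis ..
qed

end

section \<open>Recurrence and the speed measure\<close>

locale recurrent_diffusion = linear_diffusion M P X + scale S
  for M :: "'w measure" and P :: "real \<Rightarrow> 'w measure" and X :: "real \<Rightarrow> 'w \<Rightarrow> real"
    and S :: "real \<Rightarrow> real" +
  fixes m :: "real measure"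
  assumes recurrent: "positively_recurrent P X"
    and scale_S: "scale_function P X S"
    and speed_m: "speed_measure P X S m"
begin

lemma sets_m [measurable_cong]: "sets m = sets borel"
  using speed_m by (simp add: speed_measure_def)

lemma space_m: "space m = UNIV"
  using sets_eq_imp_space_eq[OF sets_m] by simp

lemma hitting_time_measurable_P [measurable]: "hitting_time X y \<in> borel_measurable (P x)"
  by (rule measurable_natural_P[OF hitting_time_measurable])

lemma AE_hitting_time_finite: "AE \<omega> in P x. hitting_time X y \<omega> \<noteq> \<infinity>"
  using recurrent by (intro nn_integral_PInf_AE) (auto simp: positively_recurrent_def less_top)

section \<open>Occupation times, hitting times and the growth of the scale\<close>

definition potential :: "real \<Rightarrow> real \<Rightarrow> (real \<Rightarrow> ennreal) \<Rightarrow> real \<Rightarrow> ennreal" where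
  "potential a b f x = (\<integral>\<^sup>+t. killed a b t f x * indicator {0..} t \<partial>lborel)"

lemma sigma_finite_law: "sigma_finite_measure (law x)"
  using prob_space_law by (rule prob_space_imp_sigma_finite)

text \<open>Tonelli turns the time integral of the killed semigroup into the occupation integral
  that defines the speed measure. As the path almost surely starts at \<open>x\<close> inside the
  interval, \<open>alive\<close> reduces to its condition on the exit time.\<close>

lemma potential_eq_green:
  assumes f [measurable]: "f \<in> borel_measurable borel" and x: "a < x" "x < b"
  shows "potential a b f x = (\<integral>\<^sup>+y. ennreal (indicator {a<..<b} y * green S a b x y) * f y \<partial>m)"
proof -
  interpret sigma_finite_measure "law x" by (rule sigma_finite_law)
  interpret pair_sigma_finite lborel "law x" by unfold_locales
  let ?\<phi> = "\<lambda>t \<omega>. (if alive a b t \<omega> then f (X (max 0 t) \<omega>) else 0) * indicator {0..} t"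
  have meas [measurable]: "(\<lambda>(t, \<omega>). ?\<phi> t \<omega>) \<in> borel_measurable (lborel \<Otimes>\<^sub>M law x)" by measurable
  have inner: "(\<lambda>\<omega>. \<integral>\<^sup>+t. ?\<phi> t \<omega> \<partial>lborel) \<in> borel_measurable (\<N> \<infinity>)" by measurable
  have "potential a b f x = (\<integral>\<^sup>+t. \<integral>\<^sup>+\<omega>. ?\<phi> t \<omega> \<partial>law x \<partial>lborel)"
    unfolding potential_def killed_def
  proof (intro nn_integral_cong nn_integral_multc[symmetric])
    fix t show "(\<lambda>\<omega>. if alive a b t \<omega> then f (X (max 0 t) \<omega>) else 0) \<in> borel_measurable (law x)"
      using killed_integrand_measurable[OF f, of a b t] by (simp cong: measurable_cong_sets)
  qed
  also have "\<dots> = (\<integral>\<^sup>+\<omega>. \<integral>\<^sup>+t. ?\<phi> t \<omega> \<partial>lborel \<partial>law x)"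
    using Fubini'[OF meas] by simp
  also have "\<dots> = (\<integral>\<^sup>+\<omega>. \<integral>\<^sup>+t. ?\<phi> t \<omega> \<partial>lborel \<partial>P x)" by (rule nn_integral_law[OF inner])
  also have "\<dots> = (\<integral>\<^sup>+\<omega>. (\<integral>\<^sup>+t\<in>{t. 0 \<le> t \<and> ennreal t < min (hitting_time X a \<omega>) (hitting_time X b \<omega>)}.
                 f (X t \<omega>) \<partial>lborel) \<partial>P x)"
  proof (rule nn_integral_cong_AE, use start[of x] in eventually_elim)
    case (elim \<omega>)
    show ?case using elim x by (intro nn_integral_cong) (auto simp: alive_def indicator_def)
  qed
  also have "\<dots> = (\<integral>\<^sup>+y\<in>{a<..<b}. ennreal (green S a b x y) * f y \<partial>m)"
    using speed_m f x by (simp add: speed_measure_def)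
  also have "\<dots> = (\<integral>\<^sup>+y. ennreal (indicator {a<..<b} y * green S a b x y) * f y \<partial>m)"
    by (intro nn_integral_cong) (auto simp: indicator_def)
  finally show ?thesis .
qed

text \<open>The exit time is at most the hitting time of either endpoint. Each bound is finite by
  positive recurrence and does not involve the other endpoint, which can therefore be moved
  away.\<close>

lemma potential_le_hitting_time:
  assumes x: "a < x" "x < b"
  shows "potential a b (\<lambda>_. 1) x \<le> (\<integral>\<^sup>+\<omega>. hitting_time X a \<omega> \<partial>P x)"
    "potential a b (\<lambda>_. 1) x \<le> (\<integral>\<^sup>+\<omega>. hitting_time X b \<omega> \<partial>P x)"
proof -
  have le: "(\<integral>\<^sup>+t\<in>{t. 0 \<le> t \<and> ennreal t < T}. 1 \<partial>lborel) \<le> T" for T :: ennreal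
  proof (cases T)
    case (real c)
    have "(\<integral>\<^sup>+t\<in>{t. 0 \<le> t \<and> ennreal t < T}. 1 \<partial>lborel) \<le> (\<integral>\<^sup>+t\<in>{0..c}. 1 \<partial>lborel)"
      unfolding real(2) using real(1)
        by (intro nn_integral_mono) (auto simp: indicator_def ennreal_less_iff)
    also have "\<dots> = T" using real by (simp add: nn_integral_indicator)
    finally show ?thesis .
  qed simp
  have eq: "potential a b (\<lambda>_. 1) x
    = (\<integral>\<^sup>+\<omega>. (\<integral>\<^sup>+t\<in>{t. 0 \<le> t \<and> ennreal t < min (hitting_time X a \<omega>) (hitting_time X b \<omega>)}. 1 \<partial>lborel) \<partial>P
      x)"
  proof -
    have "(\<integral>\<^sup>+\<omega>. (\<integral>\<^sup>+t\<in>{t. 0 \<le> t \<and> ennreal t < min (hitting_time X a \<omega>) (hitting_time X b \<omega>)}. 1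
      \<partial>lborel) \<partial>P x)
      = (\<integral>\<^sup>+y\<in>{a<..<b}. ennreal (green S a b x y) * 1 \<partial>m)"
      using x by (intro speed_m[unfolded speed_measure_def, THEN conjunct2, rule_format,
        where f="\<lambda>_. 1"]) simp_all
    also have "\<dots> = potential a b (\<lambda>_. 1) x"
      unfolding potential_eq_green[OF borel_measurable_const x]
      by (intro nn_integral_cong) (auto simp: indicator_def)
    finally show ?thesis ..
  qed
  show "potential a b (\<lambda>_. 1) x \<le> (\<integral>\<^sup>+\<omega>. hitting_time X a \<omega> \<partial>P x)"
    "potential a b (\<lambda>_. 1) x \<le> (\<integral>\<^sup>+\<omega>. hitting_time X b \<omega> \<partial>P x)"
    unfolding eq
    by (rule nn_integral_mono[OF order_trans[OF le min.cobounded1]],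
        rule nn_integral_mono[OF order_trans[OF le min.cobounded2]])
qed

text \<open>Recurrence forces \<open>S(\<plusminus>\<infinity>) = \<plusminus>\<infinity>\<close>: far away points are not reached before a fixed one.\<close>

lemma far_points_tendsto:
  assumes y: "filterlim (\<lambda>n. \<bar>y n\<bar>) at_top sequentially"
  shows "(\<lambda>n. measure (P x) {\<omega> \<in> space (P x). hitting_time X (y n) \<omega> \<le> hitting_time X c \<omega>}) \<longlonglongrightarrow> 0"
proof -
  interpret prob_space "P x" by (rule prob_space_P)
  let ?A = "\<lambda>n. {\<omega> \<in> space (P x). hitting_time X (y n) \<omega> \<le> hitting_time X c \<omega>}"
  have A: "?A n \<in> sets (P x)" for n by measurable
  have "(\<lambda>n. \<integral>\<omega>. indicator (?A n) \<omega> \<partial>P x) \<longlonglongrightarrow> (\<integral>\<omega>. (0::real) \<partial>P x)"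
  proof (rule integral_dominated_convergence[where w="\<lambda>_. 1"])
    show "AE \<omega> in P x. (\<lambda>n. indicator (?A n) \<omega> :: real) \<longlonglongrightarrow> 0"
      using AE_hitting_time_finite[of c x] AE_space
    proof eventually_elim
      case (elim \<omega>)
      then have \<omega>: "\<omega> \<in> space M" by simp
      obtain t where t: "0 \<le> t" "hitting_time X c \<omega> = ennreal t"
        using elim(1) by (cases "hitting_time X c \<omega>") auto
      from path_bounded[OF \<omega>] obtain B where B: "\<And>r. r \<in> {0..t} \<Longrightarrow> \<bar>X r \<omega>\<bar> \<le> B" by blast
      have "\<forall>\<^sub>F n in sequentially. B < \<bar>y n\<bar>" using y by (simp add: filterlim_at_top_dense)
      then have "\<forall>\<^sub>F n in sequentially. indicator (?A n) \<omega> = (0::real)"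
      proof eventually_elim
        case (elim n)
        have "ennreal t < hitting_time X (y n) \<omega>"
          unfolding hitting_time_gt_iff[OF \<omega> t(1)] using B elim by force
        then show ?case using t(2) by (auto simp: indicator_def)
      qed
      then show ?case by (rule tendsto_eventually)
    qed
    show "AE \<omega> in P x. norm (indicator (?A n) \<omega> :: real) \<le> 1" for n by (auto simp: indicator_def)
  qed (use A in auto)
  moreover have "(\<integral>\<omega>. indicator (?A n) \<omega> \<partial>P x) = measure (P x) (?A n)" for n
    using A[of n] by (simp add: Int_absorb2[OF sets.sets_into_space[OF A[of n]], simplified])
  ultimately show ?thesis by simp
qed

text \<open>Otherwise \<open>S \<le> c\<close> beyond \<open>x\<close>, and every point
  \<open>x + n\<close> would be reached before \<open>x - 1\<close> with probability at least
  \<open>(S x - S a) / (c - S a) > 0\<close>, contradicting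
  \<open>far_points_tendsto\<close>.\<close>

lemma S_unbounded_above: "\<exists>b>x. c < S b"
proof (rule ccontr)
  assume "\<not> (\<exists>b>x. c < S b)"
  then have le: "\<And>b. x < b \<Longrightarrow> S b \<le> c" by force
  define a where "a = x - 1"
  define \<delta> where "\<delta> = (S x - S a) / (c - S a)"
  have "S x \<le> c" using le[of "x + 1"] S_le_iff[of x "x+1"] by linarith
  moreover have "S a < S x" by (simp add: a_def)
  ultimately have \<delta>: "0 < \<delta>" unfolding \<delta>_def by (intro divide_pos_pos) linarith+
  interpret prob_space "P x" by (rule prob_space_P)
  have "(\<lambda>n. measure (P x) {\<omega> \<in> space (P x). hitting_time X (x + real (Suc n)) \<omega> \<le> hitting_time X a \<omega>})
    \<longlonglongrightarrow> 0"
  proof (rule far_points_tendsto)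
    show "filterlim (\<lambda>n. \<bar>x + real (Suc n)\<bar>) at_top sequentially" by real_asymp
  qed
  moreover have "\<delta> \<le> measure (P x) {\<omega> \<in> space (P x). hitting_time X (x + real (Suc n)) \<omega>
    \<le> hitting_time X a \<omega>}" for n
  proof -
    let ?b = "x + real (Suc n)"
    have "a < x" "x < ?b" by (auto simp: a_def)
    have "S x < S ?b" using \<open>x < ?b\<close> by (simp only: S_less_iff)
    then have "\<delta> \<le> (S x - S a) / (S ?b - S a)"
      unfolding \<delta>_def using le[OF \<open>x < ?b\<close>] \<open>S a < S x\<close>
      by (intro divide_left_mono mult_pos_pos) linarith+
    also have "\<dots> = measure (P x) {\<omega> \<in> space (P x). hitting_time X ?b \<omega> < hitting_time X a \<omega>}"
      using scale_S \<open>a < x\<close> \<open>x < ?b\<close> unfolding scale_function_def by metis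
    also have "\<dots> \<le> measure (P x) {\<omega> \<in> space (P x). hitting_time X ?b \<omega> \<le> hitting_time X a \<omega>}"
    proof (rule finite_measure_mono)
      show "{\<omega> \<in> space (P x). hitting_time X ?b \<omega> \<le> hitting_time X a \<omega>} \<in> sets (P x)" by measurable
    qed (auto intro: less_imp_le)
    finally show ?thesis .
  qed
  ultimately have "\<delta> \<le> 0" by (intro LIMSEQ_le_const) auto
  with \<delta> show False by simp
qed

lemma S_unbounded_below: "\<exists>a<x. S a < c"
proof (rule ccontr)
  assume "\<not> (\<exists>a<x. S a < c)"
  then have le: "\<And>a. a < x \<Longrightarrow> c \<le> S a" by force
  define b where "b = x + 1"
  define \<delta> where "\<delta> = (S b - S x) / (S b - c)"
  have "c \<le> S x" using le[of "x - 1"] S_le_iff[of "x-1" x] by linarith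
  moreover have "S x < S b" by (simp add: b_def)
  ultimately have \<delta>: "0 < \<delta>" unfolding \<delta>_def by (intro divide_pos_pos) linarith+
  interpret prob_space "P x" by (rule prob_space_P)
  have "(\<lambda>n. measure (P x) {\<omega> \<in> space (P x). hitting_time X (x - real (Suc n)) \<omega> \<le> hitting_time X b \<omega>})
    \<longlonglongrightarrow> 0"
  proof (rule far_points_tendsto)
    show "filterlim (\<lambda>n. \<bar>x - real (Suc n)\<bar>) at_top sequentially" by real_asymp
  qed
  moreover have "\<delta> \<le> measure (P x) {\<omega> \<in> space (P x). hitting_time X (x - real (Suc n)) \<omega>
    \<le> hitting_time X b \<omega>}" for n
  proof -
    let ?a = "x - real (Suc n)"
    have ab: "?a < x" "x < b" by (auto simp: b_def)
    then have S: "S ?a < S x" "S x < S b" by simp_all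
    have "\<delta> \<le> (S b - S x) / (S b - S ?a)"
      unfolding \<delta>_def using le[OF ab(1)] S
      by (intro divide_left_mono mult_pos_pos) linarith+
    also have "\<dots> = 1 - (S x - S ?a) / (S b - S ?a)"
    proof -
      have gen: "d \<noteq> 0 \<Longrightarrow> (d - u) / d = 1 - u / d" for d u :: real by (simp add: diff_divide_distrib)
      have nz: "S b - S ?a \<noteq> 0" using S by linarith
      have "S b - S ?a - (S x - S ?a) = S b - S x" by simp
      with gen[OF nz, of "S x - S ?a"] show ?thesis by (simp only:)
    qed
    also have "(S x - S ?a) / (S b - S ?a)
      = measure (P x) {\<omega> \<in> space (P x). hitting_time X b \<omega> < hitting_time X ?a \<omega>}"
      using scale_S ab unfolding scale_function_def by metis
    also have "1 - \<dots> = measure (P x)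
      (space (P x) - {\<omega> \<in> space (P x). hitting_time X b \<omega> < hitting_time X ?a \<omega>})"
      by (intro prob_compl[symmetric]) measurable
    also have "space (P x) - {\<omega> \<in> space (P x). hitting_time X b \<omega> < hitting_time X ?a \<omega>} =
      {\<omega> \<in> space (P x). hitting_time X ?a \<omega> \<le> hitting_time X b \<omega>}" by auto
    finally show ?thesis .
  qed
  ultimately have "\<delta> \<le> 0" by (intro LIMSEQ_le_const) auto
  with \<delta> show False by simp
qed

section \<open>Finiteness and full support of the speed measure\<close>

lemma emeasure_m_half_bounded:
  "\<exists>C<\<infinity>. \<forall>c>0. emeasure m {0..c} \<le> C" "\<exists>C<\<infinity>. \<forall>c>0. emeasure m {-c..0} \<le> C"
proof -
  have div: "E < \<infinity> \<Longrightarrow> ennreal (1 / \<kappa>) * E < \<infinity>" for E :: ennreal and \<kappa> :: real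
    by (simp add: ennreal_mult_less_top)
  \<comment> \<open>A lower bound \<open>\<kappa>\<close> of the Green function on
    \<open>{c..d}\<close> converts the bound \<open>E\<close> on the expected exit time from 0 into
    a bound on the mass of \<open>{c..d}\<close>.\<close>
  have key: "emeasure m {c..d} \<le> ennreal (1 / \<kappa>) * E"
    if ab: "a < 0" "0 < b" and sub: "{c..d} \<subseteq> {a<..<b}"
      and \<kappa>: "0 < \<kappa>" "\<And>y. y \<in> {c..d} \<Longrightarrow> \<kappa> \<le> green S a b 0 y"
      and E: "potential a b (\<lambda>_. 1) 0 \<le> E" for a b c d \<kappa> E
  proof -
    have "ennreal \<kappa> * emeasure m {c..d} = (\<integral>\<^sup>+y. ennreal \<kappa> * indicator {c..d} y \<partial>m)"
      by (simp add: nn_integral_cmult_indicator sets_m)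
    also have "\<dots> \<le> (\<integral>\<^sup>+y. ennreal (indicator {a<..<b} y * green S a b 0 y) * 1 \<partial>m)"
    proof (rule nn_integral_mono)
      fix y
      show "ennreal \<kappa> * indicator {c..d} y \<le> ennreal (indicator {a<..<b} y * green S a b 0 y) * 1"
      proof (cases "y \<in> {c..d}")
        case True
        then have "y \<in> {a<..<b}" using sub by blast
        with True \<kappa>(2)[OF True] show ?thesis by (simp add: ennreal_leI)
      qed simp
    qed
    also have "\<dots> = potential a b (\<lambda>_. 1) 0" using ab by (intro potential_eq_green[symmetric]) auto
    also have "\<dots> \<le> E" by (rule E)
    finally have le: "ennreal \<kappa> * emeasure m {c..d} \<le> E" .
    have "emeasure m {c..d} = ennreal (1 / \<kappa>) * (ennreal \<kappa> * emeasure m {c..d})"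
      using \<kappa>(1) by (simp flip: mult.assoc ennreal_mult)
    also have "\<dots> \<le> ennreal (1 / \<kappa>) * E" by (intro mult_left_mono le) simp
    finally show ?thesis .
  qed
  show "\<exists>C<\<infinity>. \<forall>c>0. emeasure m {0..c} \<le> C"
  proof (intro exI conjI allI impI)
    let ?E = "\<integral>\<^sup>+\<omega>. hitting_time X (-1) \<omega> \<partial>P 0" and ?\<kappa> = "(S 0 - S (-1)) / 2"
    have \<kappa>: "0 < ?\<kappa>" by simp
    show "ennreal (1 / ?\<kappa>) * ?E < \<infinity>" using recurrent unfolding positively_recurrent_def
      by (intro div) auto
    fix c :: real assume c: "0 < c"
    \<comment> \<open>This \<open>b\<close> is far enough that \<open>S b - S y\<close> exceeds half
      of \<open>S b - S (-1)\<close> for all \<open>y \<le> c\<close>, so the Green function is at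
      least \<open>(S 0 - S (-1)) / 2\<close>, a constant independent of \<open>c\<close>.\<close>
    obtain b where b: "c < b" "2 * S c - S (-1) < S b" using S_unbounded_above by blast
    show "emeasure m {0..c} \<le> ennreal (1 / ?\<kappa>) * ?E"
    proof (rule key[of "-1" b])
      fix y assume y: "y \<in> {0..c}"
      have S: "S y \<le> S c" "S (-1) < S 0" "S 0 \<le> S y" using y by simp_all
      have pos: "0 < S b - S (-1)" using b(2) S by linarith
      have "?\<kappa> * (S b - S (-1)) = (S 0 - S (-1)) * ((S b - S (-1)) / 2)" by simp
      also have "\<dots> \<le> (S 0 - S (-1)) * (S b - S y)" using b(2) S by (intro mult_left_mono) argo+
      finally have "?\<kappa> \<le> (S 0 - S (-1)) * (S b - S y) / (S b - S (-1))" using pos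
        by (simp add: pos_le_divide_eq)
      moreover have "max 0 y = y" "min 0 y = 0" using y by auto
      ultimately show "?\<kappa> \<le> green S (-1) b 0 y" by (simp add: green_def mult.commute)
    qed (use b c \<kappa> in \<open>auto intro!: potential_le_hitting_time(1)\<close>)
  qed
  show "\<exists>C<\<infinity>. \<forall>c>0. emeasure m {-c..0} \<le> C"
  proof (intro exI conjI allI impI)
    let ?E = "\<integral>\<^sup>+\<omega>. hitting_time X 1 \<omega> \<partial>P 0" and ?\<kappa> = "(S 1 - S 0) / 2"
    have \<kappa>: "0 < ?\<kappa>" by simp
    show "ennreal (1 / ?\<kappa>) * ?E < \<infinity>" using recurrent unfolding positively_recurrent_def
      by (intro div) auto
    fix c :: real assume c: "0 < c"
    obtain a where a: "a < -c" "S a < 2 * S (-c) - S 1" using S_unbounded_below by blast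
    show "emeasure m {-c..0} \<le> ennreal (1 / ?\<kappa>) * ?E"
    proof (rule key[of a 1])
      fix y assume y: "y \<in> {-c..0}"
      have S: "S (-c) \<le> S y" "S 0 < S 1" "S y \<le> S 0" using y by simp_all
      have pos: "0 < S 1 - S a" using a(2) S by linarith
      have "?\<kappa> * (S 1 - S a) = (S 1 - S 0) * ((S 1 - S a) / 2)" by simp
      also have "\<dots> \<le> (S 1 - S 0) * (S y - S a)" using a(2) S by (intro mult_left_mono) argo+
      finally have "?\<kappa> \<le> (S 1 - S 0) * (S y - S a) / (S 1 - S a)" using pos
        by (simp add: pos_le_divide_eq)
      moreover have "max 0 y = 0" "min 0 y = y" using y by auto
      ultimately show "?\<kappa> \<le> green S a 1 0 y" by (simp add: green_def)
    qed (use a c \<kappa> in \<open>auto intro!: potential_le_hitting_time(2)\<close>)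
  qed
qed

lemma finite_m: "finite_measure m"
proof
  obtain C D where C: "C < \<infinity>" "\<And>c. 0 < c \<Longrightarrow> emeasure m {0..c} \<le> C"
    and D: "D < \<infinity>" "\<And>c. 0 < c \<Longrightarrow> emeasure m {-c..0} \<le> D"
    using emeasure_m_half_bounded by metis
  have "emeasure m UNIV = emeasure m (\<Union>n. {- real (Suc n)..real (Suc n)})"
  proof (rule arg_cong[where f="emeasure m"], intro equalityI subsetI)
    fix x :: real
    obtain n where "\<bar>x\<bar> < real n" using reals_Archimedean2 by blast
    then show "x \<in> (\<Union>n. {- real (Suc n)..real (Suc n)})" by (intro UN_I[of n]) auto
  qed simp
  also have "\<dots> = (SUP n. emeasure m {- real (Suc n)..real (Suc n)})"
    by (intro SUP_emeasure_incseq[symmetric]) (auto simp: incseq_def sets_m)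
  also have "\<dots> \<le> D + C"
  proof (rule SUP_least)
    fix n
    have "emeasure m {- real (Suc n)..real (Suc n)}
      \<le> emeasure m ({- real (Suc n)..0} \<union> {0..real (Suc n)})"
      by (intro emeasure_mono) (auto simp: sets_m)
    also have "\<dots> \<le> emeasure m {- real (Suc n)..0} + emeasure m {0..real (Suc n)}"
      by (intro emeasure_subadditive) (auto simp: sets_m)
    also have "\<dots> \<le> D + C" by (intro add_mono C D) auto
    finally show "emeasure m {- real (Suc n)..real (Suc n)} \<le> D + C" .
  qed
  also have "\<dots> < \<infinity>" using C D by simp
  finally show "emeasure m (space m) \<noteq> \<infinity>" by (simp add: space_m)
qed

text \<open>If \<open>m\<close> did not charge the interval, the expected exit time from its
  midpoint would be 0, although a continuous path needs positive time to leave.\<close>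

lemma emeasure_m_Ioo_pos:
  assumes ab: "a < b"
  shows "emeasure m {a<..<b} \<noteq> 0"
proof
  assume zero: "emeasure m {a<..<b} = 0"
  define x where "x = (a + b) / 2"
  have x: "a < x" "x < b" using ab by (auto simp: x_def)
  have null: "{a<..<b} \<in> null_sets m" using zero by (simp add: null_sets_def sets_m)
  have "potential a b (\<lambda>_. 1) x = (\<integral>\<^sup>+y. 0 \<partial>m)"
    unfolding potential_eq_green[OF borel_measurable_const x]
    by (rule nn_integral_cong_AE) (use AE_not_in[OF null] in \<open>eventually_elim, simp\<close>)
  then have "(\<integral>\<^sup>+t. killed a b t (\<lambda>_. 1) x * indicator {0..} t \<partial>lborel) = 0"
    by (simp add: potential_def)
  then have "AE t in lborel. killed a b t (\<lambda>_. 1) x * indicator {0..} t = 0"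
    by (subst (asm) nn_integral_0_iff_AE) auto
  then have "AE t in lborel. 0 \<le> t \<longrightarrow> (AE \<omega> in law x. \<not> alive a b t \<omega>)"
  proof eventually_elim
    case (elim t)
    show ?case
    proof
      assume "0 \<le> t"
      with elim have "(\<integral>\<^sup>+\<omega>. (if alive a b t \<omega> then 1 else 0) \<partial>law x) = 0" by (simp add: killed_def)
      moreover have "(\<lambda>\<omega>. if alive a b t \<omega> then 1 else 0 :: ennreal) \<in> borel_measurable (law x)"
        using killed_integrand_measurable[of "\<lambda>_. 1" a b t] by (simp cong: measurable_cong_sets)
      ultimately have "AE \<omega> in law x. (if alive a b t \<omega> then 1 else 0 :: ennreal) = 0"
        by (simp add: nn_integral_0_iff_AE)
      then show "AE \<omega> in law x. \<not> alive a b t \<omega>" by eventually_elim (auto split: if_splits)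
    qed
  qed
  then have AE0: "AE t in lborel. 0 \<le> t \<longrightarrow> (AE \<omega> in law x. \<not> alive a b t \<omega>)" .
  \<comment> \<open>Almost every time has this property, so such times exist arbitrarily close to 0;
    a sequence of them leaves only one null set of paths to discard.\<close>
  have "\<exists>t. 0 < t \<and> t < 1 / real (Suc n) \<and> (AE \<omega> in law x. \<not> alive a b t \<omega>)" for n
  proof (rule ccontr)
    assume none: "\<not> ?thesis"
    have "AE t in lborel. t \<notin> {0<..<1 / real (Suc n)}"
      using AE0 by eventually_elim (use none in auto)
    then have "{0<..<1 / real (Suc n)} \<in> null_sets lborel"
      by (subst (asm) AE_iff_null_sets[symmetric]) auto
    then show False by (auto simp: null_sets_def)
  qed
  then obtain t where t: "\<And>n. 0 < t n" "\<And>n. t n < 1 / real (Suc n)"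
    "\<And>n. AE \<omega> in law x. \<not> alive a b (t n) \<omega>"
    by metis
  have "AE \<omega> in law x. \<forall>n. \<not> alive a b (t n) \<omega>" unfolding AE_all_countable using t(3) by blast
  with AE_law_start[of x] AE_space have "AE \<omega> in law x. False"
  proof eventually_elim
    case (elim \<omega>)
    then have \<omega>: "\<omega> \<in> space M" by simp
    have "alive a b 0 \<omega>" unfolding alive_iff[OF \<omega> order_refl] using elim(1) x by simp
    then have lt: "0 < min (hitting_time X a \<omega>) (hitting_time X b \<omega>)" by (simp add: alive_def)
    obtain e where e: "0 < e" "ennreal e \<le> min (hitting_time X a \<omega>) (hitting_time X b \<omega>)"
    proof (cases "min (hitting_time X a \<omega>) (hitting_time X b \<omega>)")
      case (real r)
      with lt show ?thesis by (intro that[of r]) auto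
    next
      case top
      then show ?thesis by (intro that[of 1]) auto
    qed
    obtain n where "inverse (real (Suc n)) < e" using e(1) reals_Archimedean by blast
    with t(2)[of n] have "t n < e" by (simp add: inverse_eq_divide)
    then have "ennreal (t n) < min (hitting_time X a \<omega>) (hitting_time X b \<omega>)"
      using e t(1)[of n] by (intro less_le_trans[OF _ e(2)]) (simp add: ennreal_less_iff less_imp_le)
    with elim(3) \<open>alive a b 0 \<omega>\<close> show ?case by (auto simp: alive_def)
  qed
  then show False using prob_space.AE_False[OF prob_space_law] by blast
qed

end

section \<open>Resolvents\<close>

lemma Laplace_uniqueness:
  fixes h :: "real \<Rightarrow> real"
  assumes cont: "continuous_on {0..} h" and meas [measurable]: "h \<in> borel_measurable borel"
    and bdd: "\<And>t. \<bar>h t\<bar> \<le> B"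
    and zero: "\<And>l. 0 < l \<Longrightarrow> (\<integral>t. h t \<partial>exponential_law l) = 0"
    and t: "0 \<le> t"
  shows "h t = 0"
proof -
  interpret E: prob_space "exponential_law 1" by (rule prob_space_exponential_density) simp
  have B: "0 \<le> B" using bdd[of 0] by linarith
  \<comment> \<open>The law of rate \<open>n + 1\<close> has density
    \<open>(n + 1) exp (- n t)\<close> with respect to the law of rate 1, so integer rates yield the
    moments.\<close>
  have mono: "(\<integral>t. exp (- t) ^ n * h t \<partial>exponential_law 1) = 0" for n :: nat
  proof -
    have "(\<integral>t. h t \<partial>exponential_law (real (Suc n)))
      = (\<integral>t. exponential_density (real (Suc n)) t * h t \<partial>lborel)"
      by (subst integral_density) (auto simp: exponential_density_nonneg)
    also have "\<dots> = (\<integral>t. real (Suc n) * (exponential_density 1 t * (exp (- t) ^ n * h t)) \<partial>lborel)"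
    proof (rule Bochner_Integration.integral_cong[OF refl])
      fix t :: real
      have "exp (- t * real (Suc n)) = exp (- t) * exp (- t) ^ n"
        by (simp add: exp_of_nat_mult[symmetric] exp_add[symmetric] algebra_simps)
      then show "exponential_density (real (Suc n)) t * h t
        = real (Suc n) * (exponential_density 1 t * (exp (- t) ^ n * h t))"
        by (simp add: exponential_density_def del: of_nat_Suc)
    qed
    also have "\<dots> = real (Suc n) * (\<integral>t. exponential_density 1 t * (exp (- t) ^ n * h t) \<partial>lborel)"
      by simp
    also have "(\<integral>t. exponential_density 1 t * (exp (- t) ^ n * h t) \<partial>lborel)
      = (\<integral>t. exp (- t) ^ n * h t \<partial>exponential_law 1)"
      by (subst integral_density) (auto simp: exponential_density_nonneg)
    finally show ?thesis using zero[of "real (Suc n)"] by simp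
  qed
  have int_mono: "integrable (exponential_law 1) (\<lambda>t. exp (- t) ^ n * h t)" for n :: nat
  proof (rule E.integrable_const_bound[where B=B])
    show "AE t in exponential_law 1. norm (exp (- t) ^ n * h t) \<le> B"
      using AE_exponential_law_nonneg
    proof eventually_elim
      case (elim t)
      have "exp (- t) ^ n * \<bar>h t\<bar> \<le> 1 * B" using elim bdd B by (intro mult_mono power_le_one) auto
      then show ?case by (simp add: abs_mult)
    qed
  qed simp
  \<comment> \<open>In the variable \<open>s = exp (-t)\<close> all moments of \<open>h\<close> vanish,
    and \<open>s h(- ln s)\<close> is continuous on \<open>[0,1]\<close>,
    hence a uniform limit of polynomials in \<open>s\<close>.\<close>
  define k where "k s = s * h (- ln s)" for s :: real
  have k_exp: "k (exp (- t)) = exp (- t) * h t" for t by (simp add: k_def)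
  have k_cont: "continuous_on {0..1} k"
    unfolding continuous_on_eq_continuous_within
  proof
    fix s :: real assume s: "s \<in> {0..1}"
    show "continuous (at s within {0..1}) k"
    proof (cases "s = 0")
      case True
      have "((\<lambda>s. k s) \<longlongrightarrow> 0) (at 0 within {0..1})"
      proof (rule Lim_null_comparison)
        show "\<forall>\<^sub>F s in at 0 within {0..1}. norm (k s) \<le> B * \<bar>s\<bar>"
        proof (intro always_eventually allI)
          fix s
          have "\<bar>h (- ln s)\<bar> * \<bar>s\<bar> \<le> B * \<bar>s\<bar>" by (intro mult_right_mono bdd) simp
          then show "norm (k s) \<le> B * \<bar>s\<bar>" by (simp add: k_def abs_mult mult.commute)
        qed
        show "((\<lambda>s. B * \<bar>s\<bar>) \<longlongrightarrow> 0) (at 0 within {0..1})"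
          by (intro tendsto_mult_right_zero tendsto_rabs_zero tendsto_ident_at)
      qed
      moreover have "k 0 = 0" by (simp add: k_def)
      ultimately show ?thesis using True by (simp add: continuous_within)
    next
      case False
      with s have s: "0 < s" "s \<le> 1" by auto
      have "continuous_on {0<..1} k"
        unfolding k_def
        by (intro continuous_intros continuous_on_compose2[OF cont]) auto
      then have "continuous (at s within {0<..1}) k" using s
        by (simp add: continuous_on_eq_continuous_within)
      moreover have "at s within {0<..1} = at s within {0..1}"
        using s by (intro at_within_nhd[of _ "{0<..}"]) auto
      ultimately show ?thesis by (simp add: continuous_within)
    qed
  qed
  have sq_int: "integrable (exponential_law 1) (\<lambda>t. exp (- t) * h t * h t)"
  proof (rule E.integrable_const_bound[where B="B * B"])
    show "AE t in exponential_law 1. norm (exp (- t) * h t * h t) \<le> B * B"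
      using AE_exponential_law_nonneg
    proof eventually_elim
      case (elim t)
      have "exp (- t) * \<bar>h t\<bar> * \<bar>h t\<bar> \<le> 1 * B * B" using elim bdd B by (intro mult_mono) auto
      then show ?case by (simp add: abs_mult)
    qed
  qed simp
  \<comment> \<open>The integrand is \<open>k (exp (- t)) * h t\<close>. Replacing \<open>k\<close>
    by a polynomial makes the integral vanish and changes it by at most
    \<open>e' * B\<close>.\<close>
  have "(\<integral>t. exp (- t) * h t * h t \<partial>exponential_law 1) \<le> 0"
  proof (rule field_le_epsilon)
    fix e :: real assume e: "0 < e"
    define e' where "e' = e / (B + 1)"
    have e': "0 < e'" "e' * B \<le> e" using e B by (auto simp: e'_def field_simps)
    obtain p where p: "real_polynomial_function p" "\<And>x. x \<in> {0..1} \<Longrightarrow> \<bar>k x - p x\<bar> < e'"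
      using Stone_Weierstrass_real_polynomial_function[OF _ k_cont e'(1)] by blast
    obtain a n where pa: "p = (\<lambda>x. \<Sum>i\<le>n. a i * x ^ i)"
      using p(1) unfolding real_polynomial_function_iff_sum by blast
    have p_int: "integrable (exponential_law 1) (\<lambda>t. p (exp (- t)) * h t)"
      unfolding pa sum_distrib_right
        by (intro Bochner_Integration.integrable_sum) (use int_mono in \<open>simp add: mult.assoc\<close>)
    have "(\<integral>t. p (exp (- t)) * h t \<partial>exponential_law 1)
      = (\<Sum>i\<le>n. (\<integral>t. a i * (exp (- t) ^ i * h t) \<partial>exponential_law 1))"
      unfolding pa sum_distrib_right mult.assoc
      by (intro Bochner_Integration.integral_sum) (use int_mono in simp)
    also have "\<dots> = 0" by (simp add: mono)
    finally have p0: "(\<integral>t. p (exp (- t)) * h t \<partial>exponential_law 1) = 0" .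
    have "(\<integral>t. exp (- t) * h t * h t \<partial>exponential_law 1)
      = (\<integral>t. (k (exp (- t)) - p (exp (- t))) * h t \<partial>exponential_law 1)"
      using sq_int p_int p0 by (simp add: k_exp left_diff_distrib)
    also have "\<dots> \<le> (\<integral>t. e' * B \<partial>exponential_law 1)"
    proof (rule integral_mono_AE)
      show "integrable (exponential_law 1) (\<lambda>t. (k (exp (- t)) - p (exp (- t))) * h t)"
        using sq_int p_int by (simp add: k_exp left_diff_distrib)
      show "AE t in exponential_law 1. (k (exp (- t)) - p (exp (- t))) * h t \<le> e' * B"
        using AE_exponential_law_nonneg
      proof eventually_elim
        case (elim t)
        have "\<bar>k (exp (- t)) - p (exp (- t))\<bar> * \<bar>h t\<bar> \<le> e' * B"
          using elim p(2)[of "exp (- t)"] bdd e'(1) by (intro mult_mono) (auto intro: less_imp_le)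
        then show ?case by (metis abs_ge_self abs_mult order_trans)
      qed
    qed simp
    also have "\<dots> \<le> e" using e'(2) E.prob_space by simp
    finally show "(\<integral>t. exp (- t) * h t * h t \<partial>exponential_law 1) \<le> 0 + e" by simp
  qed
  moreover have nn: "AE t in exponential_law 1. 0 \<le> exp (- t) * h t * h t" by (simp add: mult.assoc)
  ultimately have "(\<integral>t. exp (- t) * h t * h t \<partial>exponential_law 1) = 0"
    using integral_nonneg_AE[OF nn] by linarith
  then have "AE t in exponential_law 1. exp (- t) * h t * h t = 0"
    using integral_nonneg_eq_0_iff_AE[OF sq_int nn] by simp
  then have AE0: "AE t in lborel. 0 \<le> t \<longrightarrow> h t = 0"
    by (subst (asm) AE_density)
      (auto simp: exponential_density_def elim!: eventually_mono split: if_splits)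
  show ?thesis
  proof (rule ccontr)
    assume ne: "h t \<noteq> 0"
    then obtain d where d: "0 < d" "\<And>s. 0 \<le> s \<Longrightarrow> \<bar>s - t\<bar> < d \<Longrightarrow> \<bar>h s - h t\<bar> < \<bar>h t\<bar>"
      using cont t unfolding continuous_on_iff dist_real_def by (metis atLeast_iff zero_less_abs_iff)
    have "AE s in lborel. s \<notin> {t<..<t + d}"
      using AE0
    proof eventually_elim
      case (elim s)
      show ?case
      proof
        assume "s \<in> {t<..<t + d}"
        then have "0 \<le> s" "\<bar>s - t\<bar> < d" using t by auto
        with elim d(2)[of s] show False by simp
      qed
    qed
    then have "{t<..<t + d} \<in> null_sets lborel" by (subst (asm) AE_iff_null_sets[symmetric]) auto
    with d(1) show False by (auto simp: null_sets_def)
  qed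
qed

text \<open>Finite measures on the line are determined by half-lines. For fixed \<open>g\<close> the
  two sides of the symmetry relation are the measures \<open>?\<alpha> g\<close> and
  \<open>?\<beta> g\<close> in the other argument; they are identified for \<open>g\<close> a
  half-line, then a Borel set, then any function, and each stage uses the previous one with the two
  arguments exchanged.\<close>

lemma symmetric_kernelI:
  assumes fin: "finite_measure m" and sets_m: "sets m = sets borel"
    and prob: "\<And>x. prob_space (\<kappa> x)" and kernel: "\<kappa> \<in> borel \<rightarrow>\<^sub>M subprob_algebra borel"
    and sym: "\<And>a b. (\<integral>\<^sup>+x. emeasure (\<kappa> x) {a<..} * indicator {b<..} x \<partial>m)
      = (\<integral>\<^sup>+x. emeasure (\<kappa> x) {b<..} * indicator {a<..} x \<partial>m)"
  shows "symmetric_kernel m \<kappa>"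
proof -
  interpret finite_measure m by fact
  note [measurable_cong] = sets_m
  have sp: "space m = UNIV" using sets_eq_imp_space_eq[OF sets_m] by simp
  have sets_\<kappa> [simp]: "sets (\<kappa> x) = sets borel" for x using sets_kernel[OF kernel] by simp
  have meas [measurable]: "(\<lambda>x. \<integral>\<^sup>+y. f y \<partial>\<kappa> x) \<in> borel_measurable borel"
    if "f \<in> borel_measurable borel" for f :: "real \<Rightarrow> ennreal"
    by (rule measurable_compose[OF kernel nn_integral_measurable_subprob_algebra[OF that]])
  let ?I = "\<lambda>f g. \<integral>\<^sup>+x. (\<integral>\<^sup>+y. f y \<partial>\<kappa> x) * g x \<partial>m"
  let ?\<alpha> = "\<lambda>g. density m g \<bind> \<kappa>" and ?\<beta> = "\<lambda>g. density m (\<lambda>x. \<integral>\<^sup>+y. g y \<partial>\<kappa> x)"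
  have k': "\<kappa> \<in> density m g \<rightarrow>\<^sub>M subprob_algebra borel" for g
    using kernel by (simp cong: measurable_cong_sets add: sets_m)
  have \<alpha>: "(\<integral>\<^sup>+y. f y \<partial>?\<alpha> g) = ?I f g" if [measurable]: "f \<in> borel_measurable borel"
    "g \<in> borel_measurable borel" for f g
    by (subst nn_integral_bind[OF _ k']) (auto simp: nn_integral_density mult.commute)
  have \<beta>: "(\<integral>\<^sup>+y. f y \<partial>?\<beta> g) = ?I g f" if [measurable]: "f \<in> borel_measurable borel"
    "g \<in> borel_measurable borel" for f g
    by (simp add: nn_integral_density)
  have sets: "sets (?\<alpha> g) = sets borel" "sets (?\<beta> g) = sets borel" for g
    by (auto simp: sets_bind_measurable[OF k'] sp sets_m)
  have em: "emeasure (?\<alpha> g) A = ?I (indicator A) g" "emeasure (?\<beta> g) A = ?I g (indicator A)"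
    if [measurable]: "A \<in> sets borel" "g \<in> borel_measurable borel" for A g
    using \<alpha>[of "indicator A" g] \<beta>[of "indicator A" g] that sets by simp_all
  have fin_I: "?I (indicator A) (indicator C) < \<infinity>" if "A \<in> sets borel" for A C :: "real set"
  proof -
    have "?I (indicator A) (indicator C) \<le> (\<integral>\<^sup>+x. 1 \<partial>m)"
    proof (rule nn_integral_mono)
      fix x
      have "emeasure (\<kappa> x) A \<le> 1" using prob_space.emeasure_le_1[OF prob] .
      then show "(\<integral>\<^sup>+y. indicator A y \<partial>\<kappa> x) * indicator C x \<le> 1" using that by (cases "x \<in> C") auto
    qed
    also have "\<dots> < \<infinity>" using emeasure_finite[of "space m"] by (simp add: less_top[symmetric])
    finally show ?thesis .
  qed
  have 1: "?\<alpha> (indicator {b<..}) = ?\<beta> (indicator {b<..})" for b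
  proof (rule measure_eqI_lessThan)
    show "emeasure (?\<alpha> (indicator {b<..})) {x<..} < \<infinity>" for x
      using em(1)[of "{x<..}" "indicator {b<..}"] fin_I[of "{x<..}"] by simp
    show "emeasure (?\<alpha> (indicator {b<..})) {x<..} = emeasure (?\<beta> (indicator {b<..})) {x<..}" for x
      using em(1)[of "{x<..}" "indicator {b<..}"] em(2)[of "{x<..}" "indicator {b<..}"] sym[of x b]
        by simp
  qed (simp_all add: sets sets_m)
  have 2: "?\<alpha> (indicator A) = ?\<beta> (indicator A)" if A [measurable]: "A \<in> sets borel" for A
  proof (rule measure_eqI_lessThan)
    show "emeasure (?\<alpha> (indicator A)) {x<..} < \<infinity>" for x
      using em(1)[of "{x<..}" "indicator A"] fin_I[of "{x<..}"] by simp
    show "emeasure (?\<alpha> (indicator A)) {x<..} = emeasure (?\<beta> (indicator A)) {x<..}" for x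
      using em(1)[of "{x<..}" "indicator A"] em(2)[of "{x<..}" "indicator A"]
        \<alpha>[of "indicator A" "indicator {x<..}"] \<beta>[of "indicator A" "indicator {x<..}"] 1[of x] by simp
  qed (simp_all add: sets sets_m)
  have 3: "?\<alpha> g = ?\<beta> g" if [measurable]: "g \<in> borel_measurable borel" for g
  proof (rule measure_eqI)
    fix A assume "A \<in> sets (?\<alpha> g)"
    then have A [measurable]: "A \<in> sets borel" by (simp add: sets)
    show "emeasure (?\<alpha> g) A = emeasure (?\<beta> g) A"
      unfolding em[OF A that] using \<alpha>[of g "indicator A"] \<beta>[of g "indicator A"] 2[OF A] by simp
  qed (simp add: sets sets_m)
  show ?thesis
  proof (intro symmetric_kernel.intro symmetric_kernel_axioms.intro fin sets_m prob kernel)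

    fix f g :: "real \<Rightarrow> ennreal" assume [measurable]: "f \<in> borel_measurable borel"
      "g \<in> borel_measurable borel"
    show "?I f g = (\<integral>\<^sup>+x. f x * (\<integral>\<^sup>+y. g y \<partial>\<kappa> x) \<partial>m)"
      using \<alpha>[of f g] \<beta>[of f g] 3[of g] by (simp add: mult.commute)
  qed
qed

section \<open>Transition and resolvent kernels\<close>

context linear_diffusion
begin

definition transition_kernel :: "real \<Rightarrow> real \<Rightarrow> real measure" where
  "transition_kernel t x = distr (law x) borel (X (max 0 t))"

text \<open>The law of \<open>X\<close> at an independent exponential time of rate \<open>l\<close>:
  the resolvent multiplied by \<open>l\<close>, which makes it a probability kernel.\<close>

definition resolvent_kernel :: "real \<Rightarrow> real \<Rightarrow> real measure" where
  "resolvent_kernel l x = distr (exponential_law l \<Otimes>\<^sub>M law x) borel (\<lambda>p. X (max 0 (fst p)) (snd p))"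

lemma X_measurable_law: "X (max 0 t) \<in> borel_measurable (law x)"
  using measurable_X_natural[of "max 0 t" \<infinity>] by (simp cong: measurable_cong_sets)

lemma nn_integral_transition_kernel:
  "f \<in> borel_measurable borel \<Longrightarrow> (\<integral>\<^sup>+y. f y \<partial>transition_kernel t x) = free t f x"
  unfolding transition_kernel_def free_def by (intro nn_integral_distr X_measurable_law) simp

lemma prob_space_transition_kernel: "prob_space (transition_kernel t x)"
  unfolding transition_kernel_def by (intro prob_space.prob_space_distr prob_space_law X_measurable_law)

lemma sets_transition_kernel [simp]: "sets (transition_kernel t x) = sets borel"
  by (simp add: transition_kernel_def)

lemma transition_kernel_measurable: "transition_kernel t \<in> borel \<rightarrow>\<^sub>M subprob_algebra borel"
proof (rule measurable_subprob_algebra)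
  fix A :: "real set" assume A: "A \<in> sets borel"
  then have "emeasure (transition_kernel t x) A = free t (indicator A) x" for x
    using nn_integral_transition_kernel[of "indicator A" t x] by simp
  then show "(\<lambda>x. emeasure (transition_kernel t x) A) \<in> borel_measurable borel"
    using free_measurable'[of "indicator A" t] A by (simp add: fun_eq_iff[symmetric])
qed (simp_all add: prob_space_transition_kernel prob_space_imp_subprob_space)

lemma resolvent_map_measurable:
  "(\<lambda>p. X (max 0 (fst p)) (snd p)) \<in> borel_measurable (exponential_law l \<Otimes>\<^sub>M law x)"
proof -
  have "sets (exponential_law l \<Otimes>\<^sub>M law x) = sets (borel \<Otimes>\<^sub>M \<N> \<infinity>)"
    by (intro sets_pair_measure_cong) simp_all
  then show ?thesis using X_jointly_measurable by (simp cong: measurable_cong_sets)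
qed

lemma prob_space_resolvent_kernel: "0 < l \<Longrightarrow> prob_space (resolvent_kernel l x)"
  unfolding resolvent_kernel_def
  by (intro prob_space.prob_space_distr resolvent_map_measurable)
    (intro prob_space_pair prob_space_exponential_density prob_space_law)

lemma sets_resolvent_kernel [simp]: "sets (resolvent_kernel l x) = sets borel"
  by (simp add: resolvent_kernel_def)

lemma nn_integral_resolvent_kernel:
  assumes f: "f \<in> borel_measurable borel"
  shows "(\<integral>\<^sup>+y. f y \<partial>resolvent_kernel l x) = (\<integral>\<^sup>+t. free t f x \<partial>exponential_law l)"
proof -
  interpret sigma_finite_measure "law x" using prob_space_law by (rule prob_space_imp_sigma_finite)
  have "(\<integral>\<^sup>+y. f y \<partial>resolvent_kernel l x)
    = (\<integral>\<^sup>+p. f (X (max 0 (fst p)) (snd p)) \<partial>(exponential_law l \<Otimes>\<^sub>M law x))"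
    unfolding resolvent_kernel_def by (intro nn_integral_distr resolvent_map_measurable) (simp add: f)
  also have "\<dots> = (\<integral>\<^sup>+t. free t f x \<partial>exponential_law l)"
    unfolding free_def
    using nn_integral_fst[OF measurable_compose[OF resolvent_map_measurable f], symmetric] by simp
  finally show ?thesis .
qed

lemma resolvent_kernel_measurable:
  assumes l: "0 < l"
  shows "resolvent_kernel l \<in> borel \<rightarrow>\<^sub>M subprob_algebra borel"
proof (rule measurable_subprob_algebra)
  fix A :: "real set" assume A [measurable]: "A \<in> sets borel"
  have "emeasure (resolvent_kernel l x) A = (\<integral>\<^sup>+t. free t (indicator A) x \<partial>exponential_law l)" for x
    using nn_integral_resolvent_kernel[of "indicator A" l x] by simp
  moreover have "(\<lambda>x. \<integral>\<^sup>+t. free t (indicator A) x \<partial>exponential_law l) \<in> borel_measurable borel"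
  proof -
    interpret prob_space "exponential_law l" using l by (rule prob_space_exponential_density)
    have "(\<lambda>(x, t). free t (indicator A) x) \<in> borel_measurable (borel \<Otimes>\<^sub>M exponential_law l)"
      using free_measurable[of "indicator A" snd "borel \<Otimes>\<^sub>M exponential_law l" fst]
      by (simp add: case_prod_unfold measurable_snd'' A)
    then show ?thesis by measurable
  qed
  ultimately show "(\<lambda>x. emeasure (resolvent_kernel l x) A) \<in> borel_measurable borel" by simp
qed (simp_all add: prob_space_resolvent_kernel[OF l] prob_space_imp_subprob_space)

abbreviation trans_op :: "real \<Rightarrow> (real \<Rightarrow> real) \<Rightarrow> real \<Rightarrow> real" where
  "trans_op t \<equiv> kernel_op (transition_kernel t)"

abbreviation res_op :: "real \<Rightarrow> (real \<Rightarrow> real) \<Rightarrow> real \<Rightarrow> real" where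
  "res_op l \<equiv> kernel_op (resolvent_kernel l)"

definition killed_resolvent :: "real \<Rightarrow> real \<Rightarrow> real \<Rightarrow> (real \<Rightarrow> ennreal) \<Rightarrow> real \<Rightarrow> ennreal" where
  "killed_resolvent l a b f x = (\<integral>\<^sup>+t. killed a b t f x \<partial>exponential_law l)"

lemma killed_resolvent_measurable:
  assumes [measurable]: "f \<in> borel_measurable borel"
  shows "killed_resolvent l a b f \<in> borel_measurable borel"
proof -
  have "(\<lambda>(x, t). killed a b t f x * ennreal (exponential_density l t))
    \<in> borel_measurable (borel \<Otimes>\<^sub>M lborel)"
    by measurable
  then have "(\<lambda>x. \<integral>\<^sup>+t. killed a b t f x * ennreal (exponential_density l t) \<partial>lborel)
    \<in> borel_measurable borel"
    by measurable
  also have "(\<lambda>x. \<integral>\<^sup>+t. killed a b t f x * ennreal (exponential_density l t) \<partial>lborel)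
    = killed_resolvent l a b f"
    unfolding killed_resolvent_def fun_eq_iff
    by (auto simp: nn_integral_density mult.commute intro!: nn_integral_density[symmetric]
      nn_integral_cong)
  finally show ?thesis .
qed

lemma killed_resolvent_le:
  assumes "0 < l" "\<And>x. f x \<le> c"
  shows "killed_resolvent l a b f x \<le> c"
proof -
  interpret prob_space "exponential_law l" using assms(1) by (rule prob_space_exponential_density)
  have "killed_resolvent l a b f x \<le> (\<integral>\<^sup>+t. c \<partial>exponential_law l)"
    unfolding killed_resolvent_def by (intro nn_integral_mono killed_le_const assms)
  then show ?thesis using emeasure_space_1 by simp
qed

lemma killed_resolvent_outside: "x \<notin> {a<..<b} \<Longrightarrow> killed_resolvent l a b f x = 0"
  by (simp add: killed_resolvent_def killed_outside)

lemma SUP_killed_resolvent: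
  assumes f [measurable]: "f \<in> borel_measurable borel"
  shows "(SUP n. killed_resolvent l (- real n) (real n) f x) = (\<integral>\<^sup>+y. f y \<partial>resolvent_kernel l x)"
    and "incseq (\<lambda>n. killed_resolvent l (- real n) (real n) f x)"
proof -
  have meas: "(\<lambda>t. killed a b t f x) \<in> borel_measurable (exponential_law l)" for a b by simp
  have AE_mono: "AE t in exponential_law l. killed (- real n) (real n) t f x
    \<le> killed (- real (Suc n)) (real (Suc n)) t f x" for n
    using AE_exponential_law_nonneg by eventually_elim (intro killed_mono_interval; simp)
  have "(SUP n. killed_resolvent l (- real n) (real n) f x)
    = (\<integral>\<^sup>+t. (SUP n. killed (- real n) (real n) t f x) \<partial>exponential_law l)"
    unfolding killed_resolvent_def
    by (rule nn_integral_monotone_convergence_SUP_AE[symmetric]) (use AE_mono meas in auto)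
  also have "\<dots> = (\<integral>\<^sup>+t. free t f x \<partial>exponential_law l)"
    by (rule nn_integral_cong_AE)
      (use AE_exponential_law_nonneg in \<open>eventually_elim, simp add: free_eq_SUP_killed\<close>)
  also have "\<dots> = (\<integral>\<^sup>+y. f y \<partial>resolvent_kernel l x)"
    by (rule nn_integral_resolvent_kernel[OF f, symmetric])
  finally show "(SUP n. killed_resolvent l (- real n) (real n) f x) = (\<integral>\<^sup>+y. f y \<partial>resolvent_kernel l x)"
    .
  show "incseq (\<lambda>n. killed_resolvent l (- real n) (real n) f x)"
    unfolding killed_resolvent_def by (intro incseq_SucI nn_integral_mono_AE AE_mono)
qed

end

context recurrent_diffusion
begin

lemma emeasure_exponential_law_atMost:
  "0 < l \<Longrightarrow> emeasure (exponential_law l) {..r} = ennreal (if 0 \<le> r then 1 - exp (- l * r) else 0)"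
  by (simp add: emeasure_erlang_density erlang_CDF_0)

text \<open>After exchanging integrals both sides integrate \<open>killed a b r f x\<close> over
  \<open>r \<ge> 0\<close>, and the weights satisfy
  \<open>l exp (- l r) + l (1 - exp (- l r)) = l\<close>; here \<open>1 - exp (- l r)\<close> is the
  probability that the exponential time is at most \<open>r\<close>. The additive form avoids
  subtracting possibly infinite values.\<close>

lemma resolvent_equation:
  assumes f [measurable]: "f \<in> borel_measurable borel" and l: "0 < l"
  shows "killed_resolvent l a b f x + ennreal l * potential a b (killed_resolvent l a b f) x
    = ennreal l * potential a b f x"
proof -
  let ?E = "exponential_law l" and ?\<psi> = "\<lambda>r. killed a b r f x"
  interpret E: prob_space ?E using l by (rule prob_space_exponential_density)
  interpret L: sigma_finite_measure "law x" by (rule sigma_finite_law)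
  interpret EL: pair_sigma_finite ?E "law x" by unfold_locales
  interpret EB: pair_sigma_finite lborel ?E by unfold_locales
  have \<psi> [measurable]: "?\<psi> \<in> borel_measurable borel" by simp
  have pull: "killed a b t (killed_resolvent l a b f) x = (\<integral>\<^sup>+s. killed a b t (killed a b s f) x \<partial>?E)"
    for t
  proof -
    let ?\<Phi> = "\<lambda>s \<omega>. if alive a b t \<omega> then killed a b s f (X (max 0 t) \<omega>) else 0"
    have al: "Measurable.pred (\<N> \<infinity>) (alive a b t)"
      using alive_measurable[of "\<lambda>_. t" "\<N> \<infinity>" "\<lambda>\<omega>. \<omega>" a b] by simp
    have Xm: "X (max 0 t) \<in> borel_measurable (\<N> \<infinity>)" by (rule measurable_X_natural) auto
    have "(\<lambda>(s, \<omega>). ?\<Phi> s \<omega>) \<in> borel_measurable (borel \<Otimes>\<^sub>M \<N> \<infinity>)"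
      unfolding case_prod_unfold
      by (intro measurable_If killed_measurable f measurable_fst measurable_const
          measurable_compose[OF measurable_snd Xm]
            measurable_compose[OF measurable_snd al, unfolded pred_def] ) simp
    moreover have "sets (?E \<Otimes>\<^sub>M law x) = sets (borel \<Otimes>\<^sub>M \<N> \<infinity>)"
      by (intro sets_pair_measure_cong) simp_all
    ultimately have meas: "(\<lambda>(s, \<omega>). ?\<Phi> s \<omega>) \<in> borel_measurable (?E \<Otimes>\<^sub>M law x)"
      by (simp cong: measurable_cong_sets)
    have "killed a b t (killed_resolvent l a b f) x = (\<integral>\<^sup>+\<omega>. \<integral>\<^sup>+s. ?\<Phi> s \<omega> \<partial>?E \<partial>law x)"
      unfolding killed_def[of a b t] killed_resolvent_def by (intro nn_integral_cong) auto
    also have "\<dots> = (\<integral>\<^sup>+s. \<integral>\<^sup>+\<omega>. ?\<Phi> s \<omega> \<partial>law x \<partial>?E)" by (rule EL.Fubini'[OF meas])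
    also have "\<dots> = (\<integral>\<^sup>+s. killed a b t (killed a b s f) x \<partial>?E)"
      unfolding killed_def[of a b t] ..
    finally show ?thesis .
  qed
  have "potential a b (killed_resolvent l a b f) x
    = (\<integral>\<^sup>+t. (\<integral>\<^sup>+s. ?\<psi> (t + s) * indicator {0..} t \<partial>?E) \<partial>lborel)"
    unfolding potential_def
  proof (rule nn_integral_cong)
    fix t :: real
    show "killed a b t (killed_resolvent l a b f) x * indicator {0..} t
      = (\<integral>\<^sup>+s. ?\<psi> (t + s) * indicator {0..} t \<partial>?E)"
    proof (cases "0 \<le> t")
      case True
      have "(\<integral>\<^sup>+s. killed a b t (killed a b s f) x \<partial>?E) = (\<integral>\<^sup>+s. ?\<psi> (t + s) \<partial>?E)"
        by (rule nn_integral_cong_AE)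
          (use AE_exponential_law_nonneg in \<open>eventually_elim, use True in \<open>simp add: killed_add_time\<close>\<close>)
      with True show ?thesis by (simp add: pull)
    qed simp
  qed
  also have "\<dots> = (\<integral>\<^sup>+s. (\<integral>\<^sup>+t. ?\<psi> (t + s) * indicator {0..} t \<partial>lborel) \<partial>?E)"
    by (rule EB.Fubini'[symmetric]) measurable
  also have "\<dots> = (\<integral>\<^sup>+s. (\<integral>\<^sup>+r. ?\<psi> r * indicator {s..} r \<partial>lborel) \<partial>?E)"
  proof (rule nn_integral_cong)
    fix s :: real
    have "(\<integral>\<^sup>+r. ?\<psi> r * indicator {s..} r \<partial>lborel)
      = ennreal \<bar>1\<bar> * (\<integral>\<^sup>+t. ?\<psi> (s + 1 * t) * indicator {s..} (s + 1 * t) \<partial>lborel)"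
      by (rule nn_integral_real_affine) auto
    also have "\<dots> = (\<integral>\<^sup>+t. ?\<psi> (t + s) * indicator {0..} t \<partial>lborel)"
      by (simp add: add.commute) (intro nn_integral_cong; simp add: indicator_def)
    finally show "(\<integral>\<^sup>+t. ?\<psi> (t + s) * indicator {0..} t \<partial>lborel)
      = (\<integral>\<^sup>+r. ?\<psi> r * indicator {s..} r \<partial>lborel)" ..
  qed
  also have "\<dots> = (\<integral>\<^sup>+r. (\<integral>\<^sup>+s. ?\<psi> r * indicator {..r} s \<partial>?E) \<partial>lborel)"
  proof -
    have "(\<integral>\<^sup>+s. (\<integral>\<^sup>+r. ?\<psi> r * indicator {s..} r \<partial>lborel) \<partial>?E)
      = (\<integral>\<^sup>+r. (\<integral>\<^sup>+s. ?\<psi> r * indicator {s..} r \<partial>?E) \<partial>lborel)"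
    proof (rule EB.Fubini')
      have "(\<lambda>(r, s). ?\<psi> r * (if s \<le> r then 1 else 0)) \<in> borel_measurable (lborel \<Otimes>\<^sub>M ?E)" by measurable
      then show "(\<lambda>(r, s). ?\<psi> r * indicator {s..} r) \<in> borel_measurable (lborel \<Otimes>\<^sub>M ?E)"
        by (simp add: indicator_def)
    qed
    then show ?thesis by (simp add: indicator_def)
  qed
  also have "\<dots> = (\<integral>\<^sup>+r. ?\<psi> r * ennreal (if 0 \<le> r then 1 - exp (- l * r) else 0) \<partial>lborel)"
    using l by (intro nn_integral_cong)
      (simp add: nn_integral_cmult_indicator emeasure_exponential_law_atMost)
  finally have pot: "potential a b (killed_resolvent l a b f) x
    = (\<integral>\<^sup>+r. ?\<psi> r * ennreal (if 0 \<le> r then 1 - exp (- l * r) else 0) \<partial>lborel)" .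
  have res: "killed_resolvent l a b f x = (\<integral>\<^sup>+r. ?\<psi> r * ennreal (exponential_density l r) \<partial>lborel)"
    unfolding killed_resolvent_def by (subst nn_integral_density) (auto simp: mult.commute)
  have "killed_resolvent l a b f x + ennreal l * potential a b (killed_resolvent l a b f) x
    = (\<integral>\<^sup>+r. ?\<psi> r * ennreal (exponential_density l r) + ennreal l *
      (?\<psi> r * ennreal (if 0 \<le> r then 1 - exp (- l * r) else 0)) \<partial>lborel)"
    unfolding pot res by (subst nn_integral_add) (auto simp: nn_integral_cmult)
  also have "\<dots> = (\<integral>\<^sup>+r. ennreal l * (?\<psi> r * indicator {0..} r) \<partial>lborel)"
  proof (rule nn_integral_cong)
    fix r :: real
    show "?\<psi> r * ennreal (exponential_density l r) + ennreal l *
      (?\<psi> r * ennreal (if 0 \<le> r then 1 - exp (- l * r) else 0))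
      = ennreal l * (?\<psi> r * indicator {0..} r)"
    proof (cases "0 \<le> r")
      case True
      have "?\<psi> r * ennreal (exponential_density l r) + ennreal l * (?\<psi> r * ennreal (1 - exp (- l * r)))
        = ?\<psi> r * (ennreal (l * exp (- r * l)) + ennreal l * ennreal (1 - exp (- l * r)))"
        using True by (simp add: exponential_density_def distrib_left ac_simps)
      also have "ennreal (l * exp (- r * l)) + ennreal l * ennreal (1 - exp (- l * r)) = ennreal l"
        using True l by (simp flip: ennreal_mult ennreal_plus add: algebra_simps)
      finally show ?thesis using True by (simp add: mult.commute)
    qed (simp add: exponential_density_def)
  qed
  also have "\<dots> = ennreal l * potential a b f x"
    unfolding potential_def by (rule nn_integral_cmult) simp
  finally show ?thesis .
qed

end

section \<open>Symmetry of the semigroup\<close>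

lemma kernel_op_bounded:
  assumes prob: "\<And>x. prob_space (\<kappa> x)" and sets: "\<And>x. sets (\<kappa> x) = sets borel"
    and F: "F \<in> borel_measurable borel" "\<And>y. \<bar>F y\<bar> \<le> B"
  shows "kernel_op \<kappa> F x = enn2real (\<integral>\<^sup>+y. ennreal (F y) \<partial>\<kappa> x) - enn2real (\<integral>\<^sup>+y. ennreal (- F y) \<partial>\<kappa> x)"
    and "\<bar>kernel_op \<kappa> F x\<bar> \<le> B" "integrable (\<kappa> x) F"
proof -
  interpret prob_space "\<kappa> x" by (rule prob)
  note [measurable_cong] = sets[of x] and [measurable] = F(1)
  show int: "integrable (\<kappa> x) F"
    by (rule integrable_const_bound[where B=B]) (use F(2) in auto)
  show "kernel_op \<kappa> F x = enn2real (\<integral>\<^sup>+y. ennreal (F y) \<partial>\<kappa> x) - enn2real (\<integral>\<^sup>+y. ennreal (- F y) \<partial>\<kappa> x)"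
    unfolding kernel_op_def by (rule real_lebesgue_integral_def[OF int])
  have "\<bar>kernel_op \<kappa> F x\<bar> \<le> (\<integral>y. \<bar>F y\<bar> \<partial>\<kappa> x)" unfolding kernel_op_def by (rule integral_abs_bound)
  also have "\<dots> \<le> (\<integral>y. B \<partial>\<kappa> x)" using int F(2) by (intro integral_mono) auto
  finally show "\<bar>kernel_op \<kappa> F x\<bar> \<le> B" by (simp add: prob_space)
qed

context recurrent_diffusion
begin

sublocale m: finite_measure m by (rule finite_m)

lemma L2_m_bounded:
  assumes "F \<in> borel_measurable borel" "\<And>x. \<bar>F x\<bar> \<le> B"
  shows "F \<in> L2 m"
  using assms by (intro m.L2_bounded) (simp_all cong: measurable_cong_sets add: sets_m)

lemma L2_tendsto_bounded:
  assumes F: "\<And>n. F n \<in> borel_measurable borel" "G \<in> borel_measurable borel"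
    and bdd: "\<And>n x. \<bar>F n x\<bar> \<le> B" and lim: "\<And>x. (\<lambda>n. F n x) \<longlonglongrightarrow> G x"
  shows "L2_tendsto m F G"
proof (rule L2_tendsto_dominated(3)[where H="\<lambda>_. B"])
  show "(\<lambda>_. B) \<in> L2 m" by (intro L2_m_bounded[where B="\<bar>B\<bar>"]) auto
qed (use assms in \<open>auto cong: measurable_cong_sets simp: sets_m\<close>)

section \<open>Killed resolvents as Green potentials\<close>

lemma green_potential_diff:
  assumes "a < b" "f \<in> borel_measurable borel" "\<And>y. \<bar>f y\<bar> \<le> B" "g \<in> borel_measurable borel"
    "\<And>y. \<bar>g y\<bar> \<le> C"
  shows "green_potential m a b (\<lambda>y. c * (f y - g y)) x
    = c * (green_potential m a b f x - green_potential m a b g x)"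
proof (cases "a < x \<and> x < b")
  case True
  then have x: "x \<in> {a..b}" by simp
  have "green_potential m a b (\<lambda>y. c * (f y - g y)) x
    = (\<integral>y. c * (indicator {a<..<b} y * green S a b x y * f y - indicator {a<..<b} y * green S a b x y *
      g y) \<partial>m)"
    using True by (simp add: green_potential_def algebra_simps)
  also have "\<dots> = c * (green_potential m a b f x - green_potential m a b g x)"
    using green_integrable[OF finite_m sets_m assms(1) x assms(2,3)]
      green_integrable[OF finite_m sets_m assms(1) x assms(4,5)] True
    by (simp add: green_potential_def)
  finally show ?thesis .
qed (simp add: green_potential_def)

lemma potential_eq_green_potential:
  assumes x: "a < x" "x < b" and q: "q \<in> borel_measurable borel" "\<And>y. 0 \<le> q y" "\<And>y. q y \<le> B"
  shows "potential a b (\<lambda>y. ennreal (q y)) x = ennreal (green_potential m a b q x)"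
    "0 \<le> green_potential m a b q x"
proof -
  have ab: "a < b" and x': "x \<in> {a..b}" using x by auto
  have nn: "0 \<le> indicator {a<..<b} y * green S a b x y" for y
    using green_nonneg[OF ab x', of y] by (auto simp: indicator_def)
  have int: "integrable m (\<lambda>y. indicator {a<..<b} y * green S a b x y * q y)"
    by (rule green_integrable[OF finite_m sets_m ab x' q(1), of B]) (use q in auto)
  have "potential a b (\<lambda>y. ennreal (q y)) x
    = (\<integral>\<^sup>+y. ennreal (indicator {a<..<b} y * green S a b x y * q y) \<partial>m)"
    using q(1) nn q(2) by (subst potential_eq_green[OF _ x]) (auto simp: ennreal_mult)
  also have "\<dots> = ennreal (green_potential m a b q x)"
    using int nn q(2) x by (subst nn_integral_eq_integral) (auto simp: green_potential_def)
  finally show "potential a b (\<lambda>y. ennreal (q y)) x = ennreal (green_potential m a b q x)" .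
  show "0 \<le> green_potential m a b q x"
    unfolding green_potential_def using nn q(2) by (intro mult_nonneg_nonneg integral_nonneg_AE) auto
qed

text \<open>The resolvent equation can be read in the reals because the killed resolvent is bounded
  by \<open>B\<close>. The embedding into \<open>ennreal\<close> sends negative values to 0, so the
  source term is the positive part of \<open>F\<close>.\<close>

lemma killed_resolvent_eq_green_potential:
  fixes F :: "real \<Rightarrow> real"
  defines "u l a b \<equiv> \<lambda>x. enn2real (killed_resolvent l a b (\<lambda>y. ennreal (F y)) x)"
  assumes ab: "a < b" and l: "0 < l" and F [measurable]: "F \<in> borel_measurable borel"
    and bdd: "\<And>y. \<bar>F y\<bar> \<le> B"
  shows "u l a b x = l * (green_potential m a b (\<lambda>y. max (F y) 0) x - green_potential m a b (u l a b)
    x)"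
    and "u l a b \<in> borel_measurable borel" "0 \<le> u l a b x" "u l a b x \<le> B"
proof -
  let ?f = "\<lambda>y. ennreal (F y)" and ?u = "u l a b"
  have B: "0 \<le> B" using bdd[of 0] by linarith
  have f: "?f \<in> borel_measurable borel" by simp
  have le: "killed_resolvent l a b ?f y \<le> ennreal B" for y
    using bdd abs_le_D1 by (intro killed_resolvent_le[OF l] ennreal_leI) blast
  then have U: "killed_resolvent l a b ?f y = ennreal (?u y)" for y
    unfolding u_def by (metis ennreal_enn2real ennreal_less_top le_less_trans)
  show meas: "?u \<in> borel_measurable borel"
    unfolding u_def using killed_resolvent_measurable[OF f] by simp
  show nn: "0 \<le> ?u x" for x by (simp add: u_def)
  show uB: "?u x \<le> B" for x using le[of x] unfolding U using B by (simp add: ennreal_le_iff)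
  show "?u x = l * (green_potential m a b (\<lambda>y. max (F y) 0) x - green_potential m a b ?u x)"
  proof (cases "a < x \<and> x < b")
    case True
    then have x: "a < x" "x < b" by auto
    have max: "(\<lambda>y. ennreal (F y)) = (\<lambda>y. ennreal (max (F y) 0))"
      by (auto simp: max_def ennreal_neg fun_eq_iff)
    have mB: "max (F y) 0 \<le> B" for y using bdd[of y] B by auto
    have p1: "potential a b ?f x = ennreal (green_potential m a b (\<lambda>y. max (F y) 0) x)"
      "0 \<le> green_potential m a b (\<lambda>y. max (F y) 0) x"
      unfolding max using potential_eq_green_potential[OF x, of "\<lambda>y. max (F y) 0" B] mB by auto
    have p2: "potential a b (killed_resolvent l a b ?f) x = ennreal (green_potential m a b ?u x)"
      "0 \<le> green_potential m a b ?u x"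
    proof -
      have "killed_resolvent l a b ?f = (\<lambda>y. ennreal (?u y))" by (rule ext, rule U)
      then show "potential a b (killed_resolvent l a b ?f) x = ennreal (green_potential m a b ?u x)"
        by (simp only: potential_eq_green_potential(1)[OF x meas nn uB])
      show "0 \<le> green_potential m a b ?u x" by (rule potential_eq_green_potential(2)[OF x meas nn uB])
    qed
    have "ennreal (?u x + l * green_potential m a b ?u x)
      = ennreal (l * green_potential m a b (\<lambda>y. max (F y) 0) x)"
      using resolvent_equation[OF f l, of a b x] l nn p1 p2
      by (simp add: U[of x] ennreal_mult)
    then have "?u x + l * green_potential m a b ?u x = l * green_potential m a b (\<lambda>y. max (F y) 0) x"
      using l nn p1(2) p2(2) by (subst (asm) ennreal_inj) auto
    then show ?thesis by (simp add: algebra_simps)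
  next
    case False
    then show ?thesis by (simp add: u_def killed_resolvent_outside green_potential_def)
  qed
qed

text \<open>The killed resolvent acts on functions with values in \<open>[0,\<infinity>]\<close>;
  the signed operator treats the positive and the negative part of \<open>F\<close>
  separately.\<close>

definition kres :: "real \<Rightarrow> nat \<Rightarrow> (real \<Rightarrow> real) \<Rightarrow> real \<Rightarrow> real" where
  "kres l n F x = enn2real (killed_resolvent l (- real n) (real n) (\<lambda>y. ennreal (F y)) x)
    - enn2real (killed_resolvent l (- real n) (real n) (\<lambda>y. ennreal (- F y)) x)"

context
  fixes l :: real and n :: nat and F :: "real \<Rightarrow> real" and B :: real
  assumes l: "0 < l" and n: "0 < n" and F [measurable]: "F \<in> borel_measurable borel"
    and bdd: "\<And>y. \<bar>F y\<bar> \<le> B"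
begin

lemma kres_measurable: "kres l n F \<in> borel_measurable borel"
  and abs_kres_le: "\<bar>kres l n F x\<bar> \<le> B"
  and kres_eq: "kres l n F = green_potential m (- real n) (real n) (\<lambda>y. l * (F y - kres l n F y))"
proof -
  let ?a = "- real n" and ?b = "real n"
  let ?p = "\<lambda>x. enn2real (killed_resolvent l ?a ?b (\<lambda>y. ennreal (F y)) x)"
  let ?q = "\<lambda>x. enn2real (killed_resolvent l ?a ?b (\<lambda>y. ennreal (- F y)) x)"
  have ab: "?a < ?b" using n by simp
  note p = killed_resolvent_eq_green_potential[OF ab l F bdd]
  have "(\<lambda>y. - F y) \<in> borel_measurable borel" "\<And>y. \<bar>- F y\<bar> \<le> B" using bdd by auto
  note q = killed_resolvent_eq_green_potential[OF ab l this]
  have k: "kres l n F = (\<lambda>x. ?p x - ?q x)" by (simp add: kres_def fun_eq_iff)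
  show "kres l n F \<in> borel_measurable borel" unfolding k using p(2) q(2) by simp
  show "\<bar>kres l n F x\<bar> \<le> B" unfolding k using p(3,4)[of x] q(3,4)[of x] by linarith
  show "kres l n F = green_potential m ?a ?b (\<lambda>y. l * (F y - kres l n F y))"
  proof
    fix x
    have P: "max (F y) 0 - max (- F y) 0 = F y" for y by auto
    have B: "0 \<le> B" using bdd[of 0] by linarith
    have mb: "\<bar>max (F y) 0\<bar> \<le> B" "\<bar>max (- F y) 0\<bar> \<le> B" "\<bar>?p y\<bar> \<le> B" "\<bar>?q y\<bar> \<le> B" "\<bar>?p y - ?q y\<bar> \<le> B"
      for y
      using bdd[of y] B p(3,4)[of y] q(3,4)[of y] by linarith+
    have "kres l n F x = l * ((green_potential m ?a ?b (\<lambda>y. max (F y) 0) x - green_potential m ?a ?b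
      (\<lambda>y. max (- F y) 0) x)
        - (green_potential m ?a ?b ?p x - green_potential m ?a ?b ?q x))"
      unfolding k p(1)[of x] q(1)[of x] by (simp add: algebra_simps)
    also have "green_potential m ?a ?b (\<lambda>y. max (F y) 0) x - green_potential m ?a ?b (\<lambda>y. max (- F y) 0)
      x
      = green_potential m ?a ?b F x"
      using green_potential_diff[where f="\<lambda>y. max (F y) 0"
        and g="\<lambda>y. max (- F y) 0", OF ab _ mb(1) _ mb(2), where c=1 and x=x] by (simp add: P)
    also have "green_potential m ?a ?b ?p x - green_potential m ?a ?b ?q x
      = green_potential m ?a ?b (\<lambda>y. ?p y - ?q y) x"
      using green_potential_diff[OF ab p(2) mb(3) q(2) mb(4), where c=1 and x=x] by simp
    also have "l * (green_potential m ?a ?b F x - green_potential m ?a ?b (\<lambda>y. ?p y - ?q y) x)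
      = green_potential m ?a ?b (\<lambda>y. l * (F y - (?p y - ?q y))) x"
      using p(2) q(2) by (intro green_potential_diff[OF ab F bdd _ mb(5), symmetric]) simp
    finally show "kres l n F x = green_potential m ?a ?b (\<lambda>y. l * (F y - kres l n F y)) x" unfolding k .
  qed
qed

definition "kres_deriv = green_potential_deriv m (- real n) (real n) (\<lambda>y. l * (F y - kres l n F y))"

lemma kres_source:
  "(\<lambda>y. l * (F y - kres l n F y)) \<in> borel_measurable borel" "\<bar>l * (F y - kres l n F y)\<bar> \<le> l * (B + B)"
proof -
  show "(\<lambda>y. l * (F y - kres l n F y)) \<in> borel_measurable borel" using kres_measurable by simp
  have "\<bar>F y - kres l n F y\<bar> \<le> B + B" using bdd[of y] abs_kres_le[of y] by linarith
  then show "\<bar>l * (F y - kres l n F y)\<bar> \<le> l * (B + B)" using l by (simp add: abs_mult)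
qed

lemma scale_derivative_kres:
  "has_scale_derivative S (kres l n F) kres_deriv" "kres_deriv \<in> L2 dS"
proof -
  have ab: "- real n < real n" using n by simp
  note G = scale_derivative_green_potential[OF finite_m sets_m ab kres_source]
  show "has_scale_derivative S (kres l n F) kres_deriv"
    by (subst kres_eq) (unfold kres_deriv_def, rule G(1))
  show "kres_deriv \<in> L2 dS" unfolding kres_deriv_def by (rule G(2))
qed

lemma energy_kres:
  assumes "has_scale_derivative S v h" "\<And>x. x \<notin> {- real n<..<real n} \<Longrightarrow> v x = 0"
  shows "L2_inner dS kres_deriv h = l * L2_inner m (\<lambda>y. F y - kres l n F y) v"
proof -
  have ab: "- real n < real n" using n by simp
  have "L2_inner dS kres_deriv h = L2_inner m (\<lambda>y. l * (F y - kres l n F y)) v"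
    unfolding kres_deriv_def by (rule energy_green_potential[OF finite_m sets_m ab kres_source assms])
  then show ?thesis by (simp add: L2_inner_scale_left)
qed

lemma kres_outside: "x \<notin> {- real n<..<real n} \<Longrightarrow> kres l n F x = 0"
  by (simp add: kres_def killed_resolvent_outside)

end

text \<open>Both resolvents vanish outside the interval, so each may test the equation of the other.
  The energies agree by symmetry of the L2 product, and the common product of the two resolvents
  cancels.\<close>

lemma kres_symmetric:
  assumes l: "0 < l" and n: "0 < n" and F: "F \<in> borel_measurable borel" "\<And>y. \<bar>F y\<bar> \<le> B"
    and G: "G \<in> borel_measurable borel" "\<And>y. \<bar>G y\<bar> \<le> C"
  shows "L2_inner m (kres l n F) G = L2_inner m F (kres l n G)"
proof -
  note f = l n F and g = l n G
  have L: "F \<in> L2 m" "G \<in> L2 m" "kres l n F \<in> L2 m" "kres l n G \<in> L2 m"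
    using L2_m_bounded[OF F] L2_m_bounded[OF G] L2_m_bounded[OF kres_measurable[OF f] abs_kres_le[OF f]]
      L2_m_bounded[OF kres_measurable[OF g] abs_kres_le[OF g]] by auto
  have 1: "L2_inner dS (kres_deriv l n F) (kres_deriv l n G)
    = l * L2_inner m (\<lambda>y. F y - kres l n F y) (kres l n G)"
    by (rule energy_kres[OF f scale_derivative_kres(1)[OF g]]) (rule kres_outside[OF g])
  have 2: "L2_inner dS (kres_deriv l n G) (kres_deriv l n F)
    = l * L2_inner m (\<lambda>y. G y - kres l n G y) (kres l n F)"
    by (rule energy_kres[OF g scale_derivative_kres(1)[OF f]]) (rule kres_outside[OF f])
  have "l * L2_inner m (\<lambda>y. F y - kres l n F y) (kres l n G)
    = l * L2_inner m (\<lambda>y. G y - kres l n G y) (kres l n F)"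
    using 1 2 L2_inner_commute[of dS "kres_deriv l n F" "kres_deriv l n G"] by linarith
  then have "L2_inner m (\<lambda>y. F y - kres l n F y) (kres l n G)
    = L2_inner m (\<lambda>y. G y - kres l n G y) (kres l n F)"
    using l by simp
  then show ?thesis
    using L by (simp add: L2_inner_diff_left L2_inner_commute[of m "kres l n G"]
      L2_inner_commute[of m G])
qed

lemma kres_tendsto:
  assumes l: "0 < l" and F [measurable]: "F \<in> borel_measurable borel" and bdd: "\<And>y. \<bar>F y\<bar> \<le> B"
  shows "(\<lambda>n. kres l n F x) \<longlonglongrightarrow> res_op l F x"
proof -
  interpret prob_space "resolvent_kernel l x" by (rule prob_space_resolvent_kernel[OF l])
  have lim: "(\<lambda>n. enn2real (killed_resolvent l (- real n) (real n) (\<lambda>y. ennreal (G y)) x))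
    \<longlonglongrightarrow> enn2real (\<integral>\<^sup>+y. ennreal (G y) \<partial>resolvent_kernel l x)"
    if [measurable]: "G \<in> borel_measurable borel" and G: "\<And>y. G y \<le> B" for G
  proof (rule tendsto_enn2real)
    have f: "(\<lambda>y. ennreal (G y)) \<in> borel_measurable borel" by simp
    have "(\<integral>\<^sup>+y. ennreal (G y) \<partial>resolvent_kernel l x) \<le> (\<integral>\<^sup>+y. ennreal B \<partial>resolvent_kernel l x)"
      using G by (intro nn_integral_mono ennreal_leI) auto
    also have "\<dots> < \<infinity>" by (simp add: emeasure_space_1)
    finally have "ennreal (enn2real (\<integral>\<^sup>+y. ennreal (G y) \<partial>resolvent_kernel l x))
      = (\<integral>\<^sup>+y. ennreal (G y) \<partial>resolvent_kernel l x)"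
      by simp
    then show "(\<lambda>n. killed_resolvent l (- real n) (real n) (\<lambda>y. ennreal (G y)) x)
      \<longlonglongrightarrow> ennreal (enn2real (\<integral>\<^sup>+y. ennreal (G y) \<partial>resolvent_kernel l x))"
      using LIMSEQ_SUP[OF SUP_killed_resolvent(2)[OF f, of l x]] SUP_killed_resolvent(1)[OF f, of l x]
        by simp
  qed simp
  have "res_op l F x = enn2real (\<integral>\<^sup>+y. ennreal (F y) \<partial>resolvent_kernel l x) - enn2real
    (\<integral>\<^sup>+y. ennreal (- F y) \<partial>resolvent_kernel l x)"
    by (rule kernel_op_bounded(1)[OF prob_space_resolvent_kernel[OF l] sets_resolvent_kernel F bdd])
  moreover have "F y \<le> B" "- F y \<le> B" for y using bdd[of y] by auto
  ultimately show ?thesis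
    unfolding kres_def by (auto intro!: tendsto_diff lim)
qed

lemma kernel_op_resolvent_measurable:
  assumes "0 < l" "F \<in> borel_measurable borel"
  shows "res_op l F \<in> borel_measurable borel"
  unfolding kernel_op_def
  by (rule measurable_compose[OF resolvent_kernel_measurable integral_measurable_subprob_algebra])
    (use assms in auto)

lemma kernel_op_transition_measurable:
  assumes "F \<in> borel_measurable borel"
  shows "trans_op t F \<in> borel_measurable borel"
  unfolding kernel_op_def
  by (rule measurable_compose[OF transition_kernel_measurable
    integral_measurable_subprob_algebra[OF assms]])

text \<open>The uniform bound on \<open>kres\<close> and the finiteness of \<open>m\<close> turn
  pointwise into L2 convergence. The index is shifted because \<open>(-n,n)\<close> is empty for
  \<open>n = 0\<close>.\<close>

lemma kres_L2_tendsto: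
  assumes l: "0 < l" and F: "F \<in> borel_measurable borel" and bdd: "\<And>y. \<bar>F y\<bar> \<le> B"
  shows "L2_tendsto m (\<lambda>n. kres l (Suc n) F) (res_op l F)"
proof (rule L2_tendsto_bounded)
  show "kres l (Suc n) F \<in> borel_measurable borel" "\<bar>kres l (Suc n) F x\<bar> \<le> B" for n x
    using kres_measurable[OF l _ F bdd] abs_kres_le[OF l _ F bdd] by auto
  show "res_op l F \<in> borel_measurable borel" by (rule kernel_op_resolvent_measurable[OF l F])
  show "(\<lambda>n. kres l (Suc n) F x) \<longlonglongrightarrow> res_op l F x" for x
    by (rule LIMSEQ_Suc[OF kres_tendsto[OF l F bdd]])
qed

lemma resolvent_L2_bounded:
  assumes "0 < l" "F \<in> borel_measurable borel" "\<And>y. \<bar>F y\<bar> \<le> B"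
  shows "res_op l F \<in> L2 m"
  using kernel_op_bounded(2)[OF prob_space_resolvent_kernel[OF assms(1)] sets_resolvent_kernel
    assms(2,3)]
  by (intro L2_m_bounded[of _ B] kernel_op_resolvent_measurable assms)

lemma kres_L2_bounded:
  assumes "0 < l" "F \<in> borel_measurable borel" "\<And>y. \<bar>F y\<bar> \<le> B"
  shows "kres l (Suc n) F \<in> L2 m"
  by (rule L2_m_bounded[OF kres_measurable[OF assms(1) _ assms(2,3)]
    abs_kres_le[OF assms(1) _ assms(2,3)]]) auto

lemma resolvent_symmetric_bounded:
  assumes l: "0 < l" and F: "F \<in> borel_measurable borel" "\<And>y. \<bar>F y\<bar> \<le> B"
    and G: "G \<in> borel_measurable borel" "\<And>y. \<bar>G y\<bar> \<le> C"
  shows "L2_inner m (res_op l F) G = L2_inner m F (res_op l G)"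
proof (rule LIMSEQ_unique)
  show "(\<lambda>n. L2_inner m (kres l (Suc n) F) G) \<longlonglongrightarrow> L2_inner m (res_op l F) G"
    by (intro L2_inner_tendsto_left kres_L2_tendsto[OF l F] kres_L2_bounded[OF l F]
      resolvent_L2_bounded[OF l F] L2_m_bounded[OF G])
  have "(\<lambda>n. L2_inner m (kres l (Suc n) G) F) \<longlonglongrightarrow> L2_inner m (res_op l G) F"
    by (intro L2_inner_tendsto_left kres_L2_tendsto[OF l G] kres_L2_bounded[OF l G]
      resolvent_L2_bounded[OF l G] L2_m_bounded[OF F])
  then show "(\<lambda>n. L2_inner m (kres l (Suc n) F) G) \<longlonglongrightarrow> L2_inner m F (res_op l G)"
    using kres_symmetric[OF l _ F G] by (simp add: L2_inner_commute[of m F])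
qed

section \<open>Symmetry from the resolvents to the semigroup\<close>

lemma kernel_op_transition:
  assumes "F \<in> borel_measurable borel"
  shows "trans_op t F x = (\<integral>\<omega>. F (X (max 0 t) \<omega>) \<partial>law x)"
  unfolding kernel_op_def transition_kernel_def
    by (intro integral_distr X_measurable_law) (simp add: assms)

lemma kernel_op_transition_bounded:
  assumes "F \<in> borel_measurable borel" "\<And>y. \<bar>F y\<bar> \<le> B"
  shows "\<bar>trans_op t F x\<bar> \<le> B"
  by (rule kernel_op_bounded(2)[OF prob_space_transition_kernel sets_transition_kernel assms])

lemma kernel_op_transition_jointly_measurable:
  assumes F [measurable]: "F \<in> borel_measurable borel" and bdd: "\<And>y. \<bar>F y\<bar> \<le> B"
  shows "(\<lambda>(t, x). trans_op t F x) \<in> borel_measurable (borel \<Otimes>\<^sub>M borel)"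
proof -
  have "trans_op t F x = enn2real (free t (\<lambda>y. ennreal (F y)) x) - enn2real
    (free t (\<lambda>y. ennreal (- F y)) x)" for t x
    by (simp add: kernel_op_bounded(1)[OF prob_space_transition_kernel sets_transition_kernel F bdd]
      nn_integral_transition_kernel)
  then show ?thesis
    by (simp add: case_prod_unfold)
qed

lemma kernel_op_resolvent_eq_integral:
  assumes l: "0 < l" and F [measurable]: "F \<in> borel_measurable borel" and bdd: "\<And>y. \<bar>F y\<bar> \<le> B"
  shows "res_op l F x = (\<integral>t. trans_op t F x \<partial>exponential_law l)"
proof -
  interpret E: prob_space "exponential_law l" by (rule prob_space_exponential_density[OF l])
  interpret L: prob_space "law x" by (rule prob_space_law)
  interpret pair_prob_space "exponential_law l" "law x" ..
  have meas: "(\<lambda>p. F (X (max 0 (fst p)) (snd p))) \<in> borel_measurable (exponential_law l \<Otimes>\<^sub>M law x)"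
    by (rule measurable_compose[OF resolvent_map_measurable F])
  have "res_op l F x = (\<integral>p. F (X (max 0 (fst p)) (snd p)) \<partial>(exponential_law l \<Otimes>\<^sub>M law x))"
    unfolding kernel_op_def resolvent_kernel_def by (intro integral_distr resolvent_map_measurable) simp
  also have "\<dots> = (\<integral>t. \<integral>\<omega>. F (X (max 0 t) \<omega>) \<partial>law x \<partial>exponential_law l)"
  proof -
    have "integrable (exponential_law l \<Otimes>\<^sub>M law x) (\<lambda>p. F (X (max 0 (fst p)) (snd p)))"
      by (rule integrable_const_bound[where B=B]) (use bdd meas in auto)
    from integral_fst'[OF this] show ?thesis by simp
  qed
  finally show ?thesis by (simp add: kernel_op_transition[OF F])
qed

text \<open>As functions of \<open>t\<close> both sides are bounded and, because \<open>F\<close>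
  and \<open>G\<close> are continuous along continuous paths, continuous. Their Laplace transforms
  agree by symmetry of the resolvents, and continuity makes the inversion valid at every
  \<open>t\<close>.\<close>

lemma transition_symmetric_continuous:
  assumes F: "continuous_on UNIV F" "\<And>y. \<bar>F y\<bar> \<le> B" and G: "continuous_on UNIV G" "\<And>y. \<bar>G y\<bar> \<le> C"
  shows "L2_inner m (trans_op t F) G = L2_inner m F (trans_op t G)"
proof -
  \<comment> \<open>Stated for arbitrary \<open>H\<close> and \<open>K\<close>, since each fact is
    used for the pair \<open>F\<close>, \<open>G\<close> in both orders.\<close>
  have avg: "(\<integral>s. L2_inner m (trans_op s H) K \<partial>exponential_law l) = L2_inner m (res_op l H) K"
    and cont: "(\<lambda>j. L2_inner m (trans_op ((s j)) H) K) \<longlonglongrightarrow> L2_inner m (trans_op s' H) K"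
    and bound: "\<bar>L2_inner m (trans_op r H) K\<bar> \<le> A * D * measure m (space m)"
    if H: "continuous_on UNIV H" "\<And>y. \<bar>H y\<bar> \<le> A" and K: "continuous_on UNIV K" "\<And>y. \<bar>K y\<bar> \<le> D"
      and l: "0 < l"
      and s: "s \<longlonglongrightarrow> s'" for H K A D l s s' r
  proof -
    have Hm [measurable]: "H \<in> borel_measurable borel" and [measurable]: "K \<in> borel_measurable borel"
      using H K by (auto intro: borel_measurable_continuous_onI)
    have A: "0 \<le> A" and D: "0 \<le> D" using H(2)[of 0] K(2)[of 0] by linarith+
    have T: "\<bar>trans_op r H x * K x\<bar> \<le> A * D" for r x
      unfolding abs_mult using kernel_op_transition_bounded[OF Hm H(2), of r x] K(2)[of x] A
        by (intro mult_mono) auto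
    have Tm [measurable]: "trans_op r H \<in> borel_measurable borel" for r
      by (rule kernel_op_transition_measurable) simp
    interpret E: prob_space "exponential_law l" by (rule prob_space_exponential_density[OF l])
    interpret EM: pair_sigma_finite m "exponential_law l" by unfold_locales
    interpret EMf: finite_measure "m \<Otimes>\<^sub>M exponential_law l"
      by (intro finite_measure_pair_measure finite_m) unfold_locales
    have [measurable]: "(\<lambda>p. trans_op (snd p) H (fst p)) \<in> borel_measurable (borel \<Otimes>\<^sub>M borel)"
    proof -
      have "(\<lambda>p. (snd p, fst p)) \<in> (borel :: real measure) \<Otimes>\<^sub>M (borel :: real measure) \<rightarrow>\<^sub>M borel \<Otimes>\<^sub>M
        borel"
        by measurable
      from measurable_compose[OF this kernel_op_transition_jointly_measurable[OF Hm H(2)]] show ?thesis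
        by simp
    qed
    have int: "integrable (m \<Otimes>\<^sub>M exponential_law l) (\<lambda>p. trans_op (snd p) H (fst p) * K (fst p))"
      by (rule EMf.integrable_const_bound[where B="A * D"]) (use T in \<open>auto simp: abs_mult\<close>)
    have "(\<integral>s. L2_inner m (trans_op s H) K \<partial>exponential_law l)
      = (\<integral>x. \<integral>s. trans_op s H x * K x \<partial>exponential_law l \<partial>m)"
      unfolding L2_inner_def using EM.Fubini_integral[of "\<lambda>x s. trans_op s H x * K x"] int
      by (simp add: case_prod_unfold)
    also have "\<dots> = L2_inner m (res_op l H) K"
      unfolding L2_inner_def by (simp add: kernel_op_resolvent_eq_integral[OF l Hm H(2)])
    finally show "(\<integral>s. L2_inner m (trans_op s H) K \<partial>exponential_law l) = L2_inner m (res_op l H) K" .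
    have "\<bar>L2_inner m (trans_op r H) K\<bar> \<le> (\<integral>x. \<bar>trans_op r H x * K x\<bar> \<partial>m)"
      unfolding L2_inner_def by (rule integral_abs_bound)
    also have "\<dots> \<le> (\<integral>x. A * D \<partial>m)"
      using T A D by (intro integral_mono_AE') auto
    finally show "\<bar>L2_inner m (trans_op r H) K\<bar> \<le> A * D * measure m (space m)" by (simp add: ac_simps)
    show "(\<lambda>j. L2_inner m (trans_op ((s j)) H) K) \<longlonglongrightarrow> L2_inner m (trans_op s' H) K"
      unfolding L2_inner_def
    proof (rule integral_dominated_convergence[where w="\<lambda>_. A * D"])
      show "AE x in m. (\<lambda>j. trans_op ((s j)) H x * K x) \<longlonglongrightarrow> trans_op s' H x * K x"
      proof (intro AE_I2 tendsto_mult tendsto_const)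
        fix x
        interpret L: prob_space "law x" by (rule prob_space_law)
        have Xm [measurable]: "X (max 0 r) \<in> borel_measurable (law x)" for r by (rule X_measurable_law)
        have "(\<lambda>j. \<integral>\<omega>. H (X (max 0 (s j)) \<omega>) \<partial>law x) \<longlonglongrightarrow> (\<integral>\<omega>. H (X (max 0 s') \<omega>) \<partial>law x)"
        proof (rule integral_dominated_convergence[where w="\<lambda>_. A"])
          show "AE \<omega> in law x. (\<lambda>j. H (X (max 0 (s j)) \<omega>)) \<longlonglongrightarrow> H (X (max 0 s') \<omega>)"
          proof (rule AE_I2)
            fix \<omega> assume "\<omega> \<in> space (law x)"
            then have "\<omega> \<in> space M" by simp
            have "(\<lambda>j. max 0 (s j)) \<longlonglongrightarrow> max 0 s'" by (intro tendsto_intros s)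
            then have "(\<lambda>j. X (max 0 (s j)) \<omega>) \<longlonglongrightarrow> X (max 0 s') \<omega>"
              by (intro continuous_on_tendsto_compose[OF continuous_paths[OF \<open>\<omega> \<in> space M\<close>]]) auto
            then show "(\<lambda>j. H (X (max 0 (s j)) \<omega>)) \<longlonglongrightarrow> H (X (max 0 s') \<omega>)"
              by (intro continuous_on_tendsto_compose[OF H(1)]) auto
          qed
        qed (use H(2) in auto)
        then show "(\<lambda>j. trans_op ((s j)) H x) \<longlonglongrightarrow> trans_op s' H x"
          by (simp add: kernel_op_transition)
      qed
    qed (use T in \<open>auto simp: abs_mult\<close>)
  qed
  have Fm: "F \<in> borel_measurable borel" "G \<in> borel_measurable borel"
    using F G by (auto intro: borel_measurable_continuous_onI)
  define h where "h s = L2_inner m (trans_op s F) G - L2_inner m (trans_op s G) F" for s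
  have h_cont: "continuous_on UNIV h"
    unfolding continuous_on_sequentially
  proof (intro allI ballI impI, elim conjE)
    fix s :: "nat \<Rightarrow> real" and s' assume s: "s \<longlonglongrightarrow> s'"
    show "(h \<circ> s) \<longlonglongrightarrow> h s'"
      unfolding h_def o_def
      by (intro tendsto_diff cont[OF F G zero_less_one s] cont[OF G F zero_less_one s])
  qed
  have [measurable]: "h \<in> borel_measurable borel" using h_cont by (rule borel_measurable_continuous_onI)
  have h_bound: "\<bar>h s\<bar> \<le> B * C * measure m (space m) + C * B * measure m (space m)" for s
    unfolding h_def using bound[OF F G zero_less_one tendsto_const, of s]
      bound[OF G F zero_less_one tendsto_const, of s] by linarith
  \<comment> \<open>The Laplace transform sees only nonnegative times, and the kernels at a negative
    time are those at time 0.\<close>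
  have "h (max 0 t) = 0"
  proof (rule Laplace_uniqueness[OF _ _ h_bound])
    show "continuous_on {0..} h" using h_cont by (rule continuous_on_subset) simp
    fix l :: real assume l: "0 < l"
    interpret E: prob_space "exponential_law l" by (rule prob_space_exponential_density[OF l])
    have int: "integrable (exponential_law l) (\<lambda>s. L2_inner m (trans_op s H) K)"
      if HK: "continuous_on UNIV H" "\<And>y. \<bar>H y\<bar> \<le> A" "continuous_on UNIV K" "\<And>y. \<bar>K y\<bar> \<le> D" for H K A D
    proof (rule E.integrable_const_bound[where B="A * D * measure m (space m)"])
      have "continuous_on UNIV (\<lambda>s. L2_inner m (trans_op s H) K)"
        unfolding continuous_on_sequentially o_def
          by (intro allI ballI impI, elim conjE) (rule cont[OF HK zero_less_one])
      then show "(\<lambda>s. L2_inner m (trans_op s H) K) \<in> borel_measurable (exponential_law l)"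
        using borel_measurable_continuous_onI by simp
    qed (use bound[OF HK zero_less_one tendsto_const] in simp)
    have "(\<integral>s. h s \<partial>exponential_law l) = L2_inner m (res_op l F) G - L2_inner m (res_op l G) F"
      unfolding h_def using avg[OF F G l tendsto_const] avg[OF G F l tendsto_const] int[OF F G]
        int[OF G F] by simp
    also have "\<dots> = 0"
      using resolvent_symmetric_bounded[OF l Fm(1) F(2) Fm(2) G(2)]
        by (simp add: L2_inner_commute[of m F])
    finally show "(\<integral>s. h s \<partial>exponential_law l) = 0" .
  qed simp_all
  moreover have "transition_kernel (max 0 t) = transition_kernel t"
    by (simp add: transition_kernel_def fun_eq_iff)
  ultimately show ?thesis by (simp add: h_def L2_inner_commute[of m F])
qed

lemma symmetric_kernel_if_half_lines:
  assumes prob: "\<And>x. prob_space (\<kappa> x)" and kernel: "\<kappa> \<in> borel \<rightarrow>\<^sub>M subprob_algebra borel"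
    and sym: "\<And>a b. L2_inner m (kernel_op \<kappa> (indicator {a<..})) (indicator {b<..})
      = L2_inner m (indicator {a<..}) (kernel_op \<kappa> (indicator {b<..}))"
  shows "symmetric_kernel m \<kappa>"
proof (rule symmetric_kernelI[OF finite_m sets_m prob kernel])
  have sets_\<kappa> [simp]: "sets (\<kappa> x) = sets borel" for x using sets_kernel[OF kernel] by simp
  have space_\<kappa> [simp]: "space (\<kappa> x) = UNIV" for x using sets_eq_imp_space_eq[OF sets_\<kappa>[of x]] by simp
  fix a b :: real
  have eq: "(\<integral>\<^sup>+x. emeasure (\<kappa> x) {a<..} * indicator {b<..} x \<partial>m)
    = ennreal (L2_inner m (kernel_op \<kappa> (indicator {a<..})) (indicator {b<..}))" for a b
  proof -
    interpret k: prob_space "\<kappa> x" for x by (rule prob)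
    have op: "kernel_op \<kappa> (indicator {a<..}) x = measure (\<kappa> x) {a<..}" for x
      by (simp add: kernel_op_def)
    have meas: "(\<lambda>x. measure (\<kappa> x) {a<..}) \<in> borel_measurable borel"
      by (rule measurable_compose[OF kernel measurable_measure_subprob_algebra]) simp
    have "integrable m (\<lambda>x. measure (\<kappa> x) {a<..} * indicator {b<..} x)"
      by (rule m.integrable_const_bound[where B=1])
        (use meas in \<open>auto simp: indicator_def cong: measurable_cong_sets\<close>)
    then have "(\<integral>\<^sup>+x. ennreal (measure (\<kappa> x) {a<..} * indicator {b<..} x) \<partial>m)
      = ennreal (L2_inner m (kernel_op \<kappa> (indicator {a<..})) (indicator {b<..}))"
      unfolding L2_inner_def op by (intro nn_integral_eq_integral) auto
    moreover have "emeasure (\<kappa> x) {a<..} * indicator {b<..} x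
      = ennreal (measure (\<kappa> x) {a<..} * indicator {b<..} x)" for x
      by (simp add: k.emeasure_eq_measure indicator_def)
    ultimately show ?thesis by simp
  qed
  show "(\<integral>\<^sup>+x. emeasure (\<kappa> x) {a<..} * indicator {b<..} x \<partial>m)
    = (\<integral>\<^sup>+x. emeasure (\<kappa> x) {b<..} * indicator {a<..} x \<partial>m)"
    unfolding eq sym[of a b] by (rule arg_cong[OF L2_inner_commute])
qed

text \<open>Half-lines have discontinuous indicators, so these are approximated by the ramps
  \<open>R a k\<close> of slope \<open>k\<close>, for which symmetry is known. Boundedness gives L2
  convergence of the ramps and of their images.\<close>

lemma symmetric_transition_kernel: "symmetric_kernel m (transition_kernel t)"
proof (rule symmetric_kernel_if_half_lines[OF prob_space_transition_kernel
  transition_kernel_measurable])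
  define R where "R a k y = min 1 (max 0 (real k * (y - a)))" for a k and y :: real
  have R_cont: "continuous_on UNIV (R a k)" for a k unfolding R_def by (intro continuous_intros)
  have R_bdd: "\<bar>R a k y\<bar> \<le> 1" for a k y by (auto simp: R_def)
  have R_meas [measurable]: "R a k \<in> borel_measurable borel" for a k using R_cont
    by (rule borel_measurable_continuous_onI)
  have R_lim: "(\<lambda>k. R a k y) \<longlonglongrightarrow> indicator {a<..} y" for a y
  proof (rule tendsto_eventually)
    obtain N where N: "1 / (y - a) < real N" using reals_Archimedean2 by blast
    show "\<forall>\<^sub>F k in sequentially. R a k y = indicator {a<..} y"
      using eventually_ge_at_top[of N]
    proof eventually_elim
      case (elim k)
      show ?case
      proof (cases "a < y")
        case True
        with N elim have "1 / (y - a) < real k" by simp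
        with True have "1 < real k * (y - a)" by (simp add: pos_divide_less_eq)
        with True show ?thesis by (simp add: R_def)
      next
        case False
        then have "real k * (y - a) \<le> 0" by (simp add: mult_nonneg_nonpos)
        with False show ?thesis by (simp add: R_def)
      qed
    qed
  qed
  have I_bdd: "\<bar>indicator {a<..} y :: real\<bar> \<le> 1" for a y :: real by (simp add: indicator_def)
  have I_meas: "(indicator {a<..} :: real \<Rightarrow> real) \<in> borel_measurable borel" for a by simp
  have lim1: "L2_tendsto m (\<lambda>k. R a k) (indicator {a<..})" for a
    by (rule L2_tendsto_bounded[OF R_meas I_meas R_bdd R_lim])
  have lim2: "L2_tendsto m (\<lambda>k. trans_op t (R a k)) (trans_op t (indicator {a<..}))" for a
  proof (rule L2_tendsto_bounded[OF kernel_op_transition_measurable[OF R_meas]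
    kernel_op_transition_measurable[OF I_meas] kernel_op_transition_bounded[OF R_meas R_bdd]])
    fix x
    interpret L: prob_space "law x" by (rule prob_space_law)
    have Xm [measurable]: "X (max 0 r) \<in> borel_measurable (law x)" for r by (rule X_measurable_law)
    show "(\<lambda>k. trans_op t (R a k) x) \<longlonglongrightarrow> trans_op t (indicator {a<..}) x"
      unfolding kernel_op_transition[OF R_meas] kernel_op_transition[OF I_meas]
      by (rule integral_dominated_convergence[where w="\<lambda>_. 1"]) (use R_bdd R_lim in auto)
  qed
  fix a b
  have L2: "R a k \<in> L2 m" "(indicator {a<..} :: real \<Rightarrow> real) \<in> L2 m" "trans_op t (R a k) \<in> L2 m"
    "trans_op t (indicator {a<..}) \<in> L2 m" for a k
    using L2_m_bounded[OF R_meas R_bdd] L2_m_bounded[OF I_meas I_bdd]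
      L2_m_bounded[OF kernel_op_transition_measurable[OF R_meas]
        kernel_op_transition_bounded[OF R_meas R_bdd]]
      L2_m_bounded[OF kernel_op_transition_measurable[OF I_meas]
        kernel_op_transition_bounded[OF I_meas I_bdd]] by auto
  show "L2_inner m (trans_op t (indicator {a<..})) (indicator {b<..})
    = L2_inner m (indicator {a<..}) (trans_op t (indicator {b<..}))"
  proof (rule LIMSEQ_unique)
    show "(\<lambda>k. L2_inner m (trans_op t (R a k)) (R b k))
      \<longlonglongrightarrow> L2_inner m (trans_op t (indicator {a<..})) (indicator {b<..})"
      by (intro L2_inner_tendsto L2 lim1 lim2)
    show "(\<lambda>k. L2_inner m (trans_op t (R a k)) (R b k))
      \<longlonglongrightarrow> L2_inner m (indicator {a<..}) (trans_op t (indicator {b<..}))"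
      unfolding transition_symmetric_continuous[OF R_cont R_bdd R_cont R_bdd]
      by (intro L2_inner_tendsto L2 lim1 lim2)
  qed
qed

lemma symmetric_resolvent_kernel:
  assumes l: "0 < l"
  shows "symmetric_kernel m (resolvent_kernel l)"
  by (rule symmetric_kernel_if_half_lines[OF prob_space_resolvent_kernel[OF l]
    resolvent_kernel_measurable[OF l]])
    (rule resolvent_symmetric_bounded[OF l, where B=1 and C=1], auto simp: indicator_def)

lemma free_eq_P:
  assumes "0 \<le> t" and f: "f \<in> borel_measurable borel"
  shows "free t f x = (\<integral>\<^sup>+\<omega>. f (X t \<omega>) \<partial>P x)"
proof -
  have "(\<lambda>\<omega>. f (X t \<omega>)) \<in> borel_measurable (\<N> \<infinity>)"
    by (rule measurable_compose[OF measurable_X_natural f]) (use assms in auto)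
  from nn_integral_law[OF this] show ?thesis using assms(1) by (simp add: free_def)
qed

lemma m_symmetric_diffusion: "m_symmetric m P X"
  unfolding m_symmetric_def
proof (intro allI impI ballI)
  fix t :: real and f g :: "real \<Rightarrow> ennreal"
  assume t: "0 \<le> t" and f: "f \<in> borel_measurable borel" and g: "g \<in> borel_measurable borel"
  show "(\<integral>\<^sup>+x. (\<integral>\<^sup>+\<omega>. f (X t \<omega>) \<partial>P x) * g x \<partial>m) = (\<integral>\<^sup>+x. f x * (\<integral>\<^sup>+\<omega>. g (X t \<omega>) \<partial>P x) \<partial>m)"
    using symmetric_kernel.symmetric[OF symmetric_transition_kernel[of t] f g]
    by (simp add: nn_integral_transition_kernel f g free_eq_P t)
qed

end

section \<open>The Dirichlet form\<close>

context recurrent_diffusion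
begin

lemma m_nonzero: "emeasure m UNIV \<noteq> 0"
proof
  assume "emeasure m UNIV = 0"
  then have "emeasure m {0<..<1} = 0"
    using emeasure_mono[of "{0<..<1}" UNIV m] by (simp add: sets_m)
  then show False using emeasure_m_Ioo_pos[of 0 1] by simp
qed

lemma L2_m_measurable: "F \<in> L2 m \<Longrightarrow> F \<in> borel_measurable borel"
  using L2_D(1)[of F m] measurable_cong_sets[OF sets_m refl, of borel] by simp

lemma L2_one: "(\<lambda>_. c) \<in> L2 m"
  by (rule L2_m_bounded[where B="\<bar>c\<bar>"]) auto

text \<open>\<open>m\<close> charges every interval, so a class in L2(m) has at most one continuous
  version; this makes \<open>dF/dS\<close> depend on the class alone.\<close>

lemma continuous_AE_eq:
  fixes F G :: "real \<Rightarrow> real"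
  assumes cont: "continuous_on UNIV F" "continuous_on UNIV G" and eq: "AE x in m. F x = G x"
  shows "F x = G x"
proof (rule ccontr)
  assume ne: "F x \<noteq> G x"
  have "open {x. F x \<noteq> G x}" using cont by (rule open_Collect_neq)
  with ne obtain e where e: "0 < e" "\<And>y. \<bar>y - x\<bar> < e \<Longrightarrow> F y \<noteq> G y"
    unfolding open_dist dist_real_def by blast
  have "AE y in m. y \<notin> {x<..<x + e}" using eq by eventually_elim (use e(2) in force)
  then have "{x<..<x + e} \<in> null_sets m"
    by (subst (asm) AE_iff_null_sets[symmetric]) (auto simp: sets_m)
  then show False using emeasure_m_Ioo_pos[of x "x + e"] e(1) by (auto simp: null_sets_def)
qed

text \<open>Versions with a scale derivative are continuous and hence coincide, and derivatives are
  unique up to \<open>dS\<close>-null sets. An energy bound found for one version is thus valid for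
  any other choice of \<open>F'\<close> and \<open>f\<close>.\<close>

lemma energy_unique:
  assumes F: "AE x in m. F x = F' x" "has_scale_derivative S F' f" and le: "energy_le m L F"
  shows "f \<in> L2 dS" "L2_sq dS f \<le> L"
proof -
  obtain G g where G: "AE x in m. F x = G x" "has_scale_derivative S G g" "g \<in> L2 dS" "L2_sq dS g \<le> L"
    using le unfolding energy_le_def by blast
  have "AE x in m. F' x = G x" using F(1) G(1) by eventually_elim simp
  then have "F' = G"
    using continuous_AE_eq[OF scale_derivative_continuous[OF F(2)] scale_derivative_continuous[OF G(2)]]
      by blast
  then have AE: "AE x in dS. f x = g x" using scale_derivative_unique[OF F(2)] G(2) by blast
  have f: "f \<in> borel_measurable dS" using scale_derivative_measurable[OF F(2)] by simp
  show "f \<in> L2 dS" by (rule L2_cong_AE[OF G(3) f]) (use AE in auto)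
  have "L2_sq dS f = L2_sq dS g" using f L2_D(1)[OF G(3)] AE by (intro L2_inner_cong_AE) auto
  then show "L2_sq dS f \<le> L" using G(4) by simp
qed

text \<open>The killed equation tested with its own solution is an exact energy identity. Its right
  side converges as the interval grows, and lower semicontinuity preserves it as an
  inequality.\<close>

lemma resolvent_energy_bounded:
  assumes l: "0 < l" and F: "F \<in> borel_measurable borel" "\<And>y. \<bar>F y\<bar> \<le> B"
  shows "energy_le m (l * L2_inner m (\<lambda>x. F x - res_op l F x) (res_op l F))
    (res_op l F)"
proof (rule energy_le_limit[OF sets_m m_nonzero resolvent_L2_bounded[OF l F] _ kres_L2_tendsto[OF l F]])
  let ?u = "\<lambda>n. kres l (Suc n) F"
  note L = L2_m_bounded[OF F] kres_L2_bounded[OF l F] resolvent_L2_bounded[OF l F]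
  show "energy_le m (l * L2_inner m (\<lambda>x. F x - ?u n x) (?u n)) (?u n)" for n
  proof -
    note k = l zero_less_Suc[of n] F
    have "L2_sq dS (kres_deriv l (Suc n) F) = l * L2_inner m (\<lambda>y. F y - ?u n y) (?u n)"
      by (rule energy_kres[OF k scale_derivative_kres(1)[OF k]]) (rule kres_outside[OF k])
    then show ?thesis
      unfolding energy_le_def using scale_derivative_kres[OF k] L(2)[of n]
      by (intro conjI exI[of _ "?u n"] exI[of _ "kres_deriv l (Suc n) F"]) auto
  qed
  have "L2_tendsto m (\<lambda>n x. F x) F" by (simp add: L2_tendsto_def L2_inner_def)
  then show "(\<lambda>n. l * L2_inner m (\<lambda>x. F x - ?u n x) (?u n))
    \<longlonglongrightarrow> l * L2_inner m (\<lambda>x. F x - res_op l F x) (res_op l F)"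
    by (intro tendsto_mult tendsto_const L2_inner_tendsto L2_tendsto_diff L2_diff L
      kres_L2_tendsto[OF l F])
qed

text \<open>Truncations of \<open>F\<close> converge in L2, and by contraction so do their
  resolvents, so the bound passes from bounded to general functions.\<close>

lemma resolvent_energy:
  assumes l: "0 < l" and F: "F \<in> L2 m"
  shows "energy_le m (l * L2_inner m (\<lambda>x. F x - res_op l F x) (res_op l F))
    (res_op l F)"
proof -
  interpret U: symmetric_kernel m "resolvent_kernel l" by (rule symmetric_resolvent_kernel[OF l])
  let ?U = "res_op l"
  define G where "G k x = (if \<bar>F x\<bar> \<le> real k then F x else 0)" for k x
  have Fm [measurable]: "F \<in> borel_measurable borel" by (rule L2_m_measurable[OF F])
  have Gm: "G k \<in> borel_measurable borel" for k unfolding G_def by measurable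
  have Gb: "\<bar>G k x\<bar> \<le> real k" for k x by (simp add: G_def)
  have lim: "L2_tendsto m G F"
  proof (rule L2_tendsto_dominated(3)[OF _ _ L2_abs[OF F]])
    show "G k \<in> borel_measurable m" "F \<in> borel_measurable m" for k using Gm Fm
      by (simp_all cong: measurable_cong_sets add: sets_m)
    show "AE x in m. (\<lambda>n. G n x) \<longlonglongrightarrow> F x"
    proof (intro AE_I2 tendsto_eventually)
      fix x
      obtain N where "\<bar>F x\<bar> < real N" using reals_Archimedean2 by blast
      then show "\<forall>\<^sub>F n in sequentially. G n x = F x"
        by (intro eventually_sequentiallyI[of N]) (simp add: G_def)
    qed
    show "AE x in m. \<bar>G n x\<bar> \<le> \<bar>F x\<bar>" for n by (simp add: G_def)
  qed
  have L: "G k \<in> L2 m" "?U (G k) \<in> L2 m" for k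
    using L2_m_bounded[OF Gm Gb] U.kernel_op_contraction(1) by auto
  have UF: "?U F \<in> L2 m" by (rule U.kernel_op_contraction(1)[OF F])
  have Ulim: "L2_tendsto m (\<lambda>k. ?U (G k)) (?U F)" by (rule U.kernel_op_tendsto[OF L(1) F lim])
  show ?thesis
    by (rule energy_le_limit[OF sets_m m_nonzero UF resolvent_energy_bounded[OF l Gm Gb] Ulim])
      (intro tendsto_mult tendsto_const L2_inner_tendsto L2_tendsto_diff L2_diff L UF F lim Ulim)
qed

text \<open>\<open>increment F t / t\<close> is the approximating form \<open>\<E>\<^sub>t(F,F)\<close>.\<close>

definition increment :: "(real \<Rightarrow> real) \<Rightarrow> real \<Rightarrow> real" where
  "increment F t = L2_inner m (trans_op 0 F) F - L2_inner m (trans_op t F) F"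

lemma kernel_op_transition_0:
  assumes F [measurable]: "F \<in> borel_measurable borel"
  shows "trans_op 0 F x = F x"
proof -
  interpret L: prob_space "law x" by (rule prob_space_law)
  have [measurable]: "X 0 \<in> borel_measurable (law x)" using X_measurable_law[of 0 x] by simp
  have "trans_op 0 F x = (\<integral>\<omega>. F x \<partial>law x)"
    unfolding kernel_op_transition[OF F]
    by (rule integral_cong_AE) (use AE_law_start[of x] in \<open>auto elim!: eventually_mono\<close>)
  then show ?thesis using L.prob_space by simp
qed

section \<open>Increments of the semigroup and their exponential averages\<close>

context
  fixes F :: "real \<Rightarrow> real"
  assumes F: "F \<in> L2 m"
begin

lemma transition_L2: "trans_op t F \<in> L2 m"
  by (rule symmetric_kernel.kernel_op_contraction(1)[OF symmetric_transition_kernel F])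

lemma resolvent_L2: "0 < l \<Longrightarrow> res_op l F \<in> L2 m"
  by (rule symmetric_kernel.kernel_op_contraction(1)[OF symmetric_resolvent_kernel F])

lemma increment_eq: "increment F t = L2_inner m (\<lambda>x. F x - trans_op t F x) F"
  unfolding increment_def L2_inner_diff_left[OF F transition_L2 F]
  by (simp add: kernel_op_transition_0[OF L2_m_measurable[OF F]] fun_eq_iff[symmetric] L2_inner_def)

lemma transition_inner_le: "L2_inner m (trans_op t F) F \<le> L2_sq m F"
proof -
  have "2 * L2_inner m (trans_op t F) F
    \<le> L2_sq m (trans_op t F) + L2_sq m F"
    by (rule L2_inner_young[OF transition_L2 F])
  also have "\<dots> \<le> 2 * L2_sq m F"
    using symmetric_kernel.kernel_op_contraction(2)[OF symmetric_transition_kernel F, of t] by simp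
  finally show ?thesis by simp
qed

lemma transition_inner_add:
  assumes "0 \<le> s" "0 \<le> t"
  shows "L2_inner m (trans_op (s + t) F) F
    = L2_inner m (trans_op s F) (trans_op t F)"
proof (rule L2_inner_kernel_op_compose[OF symmetric_transition_kernel symmetric_transition_kernel
  symmetric_transition_kernel _ F F])
  fix f :: "real \<Rightarrow> ennreal" and x assume f: "f \<in> borel_measurable borel"
  have "(\<integral>\<^sup>+y. \<integral>\<^sup>+z. f z \<partial>transition_kernel s y \<partial>transition_kernel t x) = free t (free s f) x"
    by (simp add: nn_integral_transition_kernel[OF f]
      nn_integral_transition_kernel[OF free_measurable'[OF f]])
  also have "\<dots> = free (s + t) f x" using free_add_time[OF assms f] by (simp add: add.commute)
  finally show "(\<integral>\<^sup>+y. f y \<partial>transition_kernel (s + t) x)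
    = (\<integral>\<^sup>+y. \<integral>\<^sup>+z. f z \<partial>transition_kernel s y \<partial>transition_kernel t x)"
    by (simp add: nn_integral_transition_kernel[OF f])
qed

lemma subadditive_increment_increment: "subadditive_increment (increment F)"
proof -
  let ?\<phi> = "\<lambda>t. L2_inner m (trans_op t F) F"
  have inc: "?\<phi> t \<le> ?\<phi> s" if "0 \<le> s" "s \<le> t" for s t
    by (rule semigroup_increment(1)[where G="\<lambda>t. trans_op t F" and m=m and B="L2_sq m F"])
      (assumption | rule that transition_L2 transition_inner_add transition_inner_le)+
  have inc': "?\<phi> 0 - ?\<phi> (real n * t) \<le> real n * (?\<phi> 0 - ?\<phi> t)" if "0 \<le> t" for n t
    by (rule semigroup_increment(2)[where G="\<lambda>t. trans_op t F" and m=m and B="L2_sq m F"])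
      (assumption | rule that transition_L2 transition_inner_add transition_inner_le)+
  show ?thesis
  proof
    fix s t :: real
    show "increment F s \<le> increment F t" if "0 \<le> s" "s \<le> t"
      using inc[OF that] by (simp add: increment_def)
    show "0 \<le> increment F t" if "0 \<le> t"
      using inc[OF order_refl that] by (simp add: increment_def)
    show "increment F (real n * t) \<le> real n * increment F t" if "0 \<le> t" for n
      using inc'[OF that] by (simp add: increment_def)
  qed
qed

text \<open>The resolvent is the exponential mixture of the semigroup. Measurability of the
  increment in \<open>t\<close> comes from its monotonicity, which extends to negative times because
  the kernel is constant there.\<close>

lemma increment_average:
  assumes l: "0 < l"
  shows "integrable (exponential_law l) (increment F)"
    and "(\<integral>t. increment F t \<partial>exponential_law l) = L2_inner m (\<lambda>x. F x - res_op l F x) F"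
proof -
  interpret E: prob_space "exponential_law l" by (rule prob_space_exponential_density[OF l])
  interpret I: subadditive_increment "increment F" by (rule subadditive_increment_increment)
  let ?\<phi> = "\<lambda>t. L2_inner m (trans_op t F) F"
  have max0: "increment F t = increment F (max 0 t)" for t
  proof -
    have "transition_kernel (max 0 t) = transition_kernel t"
      by (simp add: transition_kernel_def fun_eq_iff)
    then show ?thesis by (simp only: increment_def)
  qed
  have "mono (increment F)"
    unfolding mono_def
  proof (intro allI impI)
    fix s t :: real assume "s \<le> t"
    then have "increment F (max 0 s) \<le> increment F (max 0 t)" by (intro I.mono) auto
    then show "increment F s \<le> increment F t" using max0 by metis
  qed
  then have meas: "increment F \<in> borel_measurable borel" by (rule borel_measurable_mono)
  have bdd: "\<bar>increment F t\<bar> \<le> 2 * L2_sq m F" for t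
  proof -
    have "\<bar>?\<phi> t\<bar> \<le> sqrt (L2_sq m (trans_op t F)) * sqrt (L2_sq m F)" for t
      by (rule L2_inner_Cauchy_Schwarz[OF transition_L2 F])
    also have "\<dots> t \<le> sqrt (L2_sq m F) * sqrt (L2_sq m F)" for t
      using symmetric_kernel.kernel_op_contraction(2)[OF symmetric_transition_kernel F, of t]
      by (intro mult_right_mono) (auto simp: L2_inner_nonneg)
    finally have "\<bar>?\<phi> t\<bar> \<le> L2_sq m F" for t by (simp add: L2_inner_nonneg)
    from this[of 0] this[of t] show ?thesis unfolding increment_def by linarith
  qed
  show int: "integrable (exponential_law l) (increment F)"
    by (rule E.integrable_const_bound[where B="2 * L2_sq m F"]) (use bdd meas in auto)
  have "L2_inner m (res_op l F) F = (\<integral>t. ?\<phi> t \<partial>exponential_law l)"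
  proof (rule L2_inner_kernel_op_mixture[OF symmetric_transition_kernel symmetric_resolvent_kernel[OF l]
    E.prob_space_axioms _ _ F F])
    fix f :: "real \<Rightarrow> ennreal" assume f [measurable]: "f \<in> borel_measurable borel"
    have "(\<lambda>(t, x). free t f x) \<in> borel_measurable (borel \<Otimes>\<^sub>M borel)" by measurable
    moreover have "sets (exponential_law l \<Otimes>\<^sub>M borel) = sets (borel \<Otimes>\<^sub>M (borel :: real measure))"
      by (intro sets_pair_measure_cong) simp_all
    ultimately show "(\<lambda>(t, x). \<integral>\<^sup>+y. f y \<partial>transition_kernel t x)
      \<in> borel_measurable (exponential_law l \<Otimes>\<^sub>M borel)"
      by (simp add: nn_integral_transition_kernel cong: measurable_cong_sets)
    show "(\<integral>\<^sup>+y. f y \<partial>resolvent_kernel l x)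
      = (\<integral>\<^sup>+t. \<integral>\<^sup>+y. f y \<partial>transition_kernel t x \<partial>exponential_law l)" for x
      by (simp add: nn_integral_resolvent_kernel nn_integral_transition_kernel)
  qed
  also have "(\<integral>t. ?\<phi> t \<partial>exponential_law l) = (\<integral>t. ?\<phi> 0 - increment F t \<partial>exponential_law l)"
    by (simp add: increment_def)
  also have "\<dots> = ?\<phi> 0 - (\<integral>t. increment F t \<partial>exponential_law l)"
    using int E.prob_space by simp
  also have "?\<phi> 0 = L2_sq m F"
    by (simp add: kernel_op_transition_0[OF L2_m_measurable[OF F]] L2_inner_def)
  finally show "(\<integral>t. increment F t \<partial>exponential_law l) = L2_inner m (\<lambda>x. F x - res_op l F x) F"
    using L2_inner_diff_left[OF F resolvent_L2[OF l] F] by simp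
qed

text \<open>Since \<open>\<lambda>|F - U\<^sub>\<lambda>F|\<^sup>2\<close> stays bounded, \<open>U\<^sub>\<lambda>F\<close> converges to \<open>F\<close> and lower semicontinuity applies.\<close>

lemma energy_le_if_increment_le:
  assumes L: "\<And>t. 0 < t \<Longrightarrow> increment F t / t \<le> L"
  shows "energy_le m L F"
proof -
  interpret I: subadditive_increment "increment F" by (rule subadditive_increment_increment)
  let ?U = "\<lambda>l. res_op l F"
  have avg: "l * L2_inner m (\<lambda>x. F x - ?U l x) F \<le> L" if l: "0 < l" for l
    using I.exponential_average_le[OF increment_average(1)[OF l] L l]
      by (simp add: increment_average(2)[OF l])
  \<comment> \<open>This identity serves twice. Multiplied by \<open>l\<close>, its left side bounds
    an energy and is nonnegative, which controls the distance of \<open>?U l\<close> from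
    \<open>F\<close>; and since a square is subtracted, the bound \<open>L\<close> carries over to
    the energy of \<open>?U l\<close>.\<close>
  have split: "L2_inner m (\<lambda>x. F x - ?U l x) (?U l)
    = L2_inner m (\<lambda>x. F x - ?U l x) F - L2_sq m (\<lambda>x. F x - ?U l x)"
    if l: "0 < l" for l
    by (simp add: L2_inner_diff_right[OF F resolvent_L2[OF l] L2_diff[OF F resolvent_L2[OF l]]])
  have en: "energy_le m (l * L2_inner m (\<lambda>x. F x - ?U l x) (?U l)) (?U l)" if l: "0 < l" for l
    by (rule resolvent_energy[OF l F])
  have nonneg: "0 \<le> l * L2_inner m (\<lambda>x. F x - ?U l x) (?U l)" if l: "0 < l" for l
    using en[OF l] L2_inner_nonneg[of dS] unfolding energy_le_def by (meson order_trans)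
  have dist: "l * L2_sq m (\<lambda>x. F x - ?U l x) \<le> L" if l: "0 < l" for l
    using nonneg[OF l] avg[OF l] unfolding split[OF l] by (simp add: right_diff_distrib)
  have en': "energy_le m L (?U l)" if l: "0 < l" for l
  proof (rule energy_le_mono[OF en[OF l]])
    have "0 \<le> l * L2_sq m (\<lambda>x. F x - ?U l x)" using l by (simp add: L2_inner_nonneg)
    then show "l * L2_inner m (\<lambda>x. F x - ?U l x) (?U l) \<le> L"
      using avg[OF l] unfolding split[OF l] by (simp add: right_diff_distrib)
  qed
  have "L2_tendsto m (\<lambda>n. ?U (real (Suc n))) F"
    unfolding L2_tendsto_def
  proof (rule tendsto_sandwich[OF _ _ tendsto_const])
    have "L2_sq m (\<lambda>x. ?U (real (Suc n)) x - F x) \<le> L * (1 / real (Suc n))" for n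
    proof -
      have "L2_sq m (\<lambda>x. ?U (real (Suc n)) x - F x)
        = L2_sq m (\<lambda>x. F x - ?U (real (Suc n)) x)"
        by (simp add: L2_inner_def algebra_simps)
      then show ?thesis using dist[of "real (Suc n)"]
        by (simp add: pos_le_divide_eq mult.commute del: of_nat_Suc)
    qed
    then show "\<forall>\<^sub>F n in sequentially. L2_sq m (\<lambda>x. ?U (real (Suc n)) x - F x) \<le> L * (1 / real (Suc n))"
      by simp
    from tendsto_mult_right_zero[OF LIMSEQ_Suc[OF lim_1_over_n], of L] show
      "(\<lambda>n. L * (1 / real (Suc n))) \<longlonglongrightarrow> 0" .
  qed (simp add: L2_inner_nonneg)
  then show ?thesis
    by (rule energy_le_limit[OF sets_m m_nonzero F en' _ tendsto_const, rotated]) simp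
qed

end

text \<open>For large \<open>n\<close>, \<open>v\<close> is an admissible test function. With
  \<open>u\<close> its killed resolvent, testing with \<open>v\<close> and with \<open>u\<close>
  gives \<open>Q(u,v) = l (v - u,v)\<close> and \<open>Q(u,u) = l (v - u,u) \<le> Q(u,v)\<close>.
  Young's inequality then yields \<open>Q(u,v) \<le> Q(v,v)\<close>, a bound on the exponential
  averages.\<close>

lemma increment_le_energy_compact:
  assumes v: "has_scale_derivative S v h" and h: "h \<in> L2 dS"
    and out: "\<And>x. x \<notin> {- real N<..<real N} \<Longrightarrow> v x = 0"
    and t: "0 < t"
  shows "increment v t / t \<le> L2_sq dS h"
proof -
  have cont: "continuous_on UNIV v" by (rule scale_derivative_continuous[OF v])
  have vm: "v \<in> borel_measurable borel" using cont by (rule borel_measurable_continuous_onI)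
  obtain B where B: "\<And>x. \<bar>v x\<bar> \<le> B"
  proof -
    have "compact (v ` {- real N..real N})"
      by (intro compact_continuous_image continuous_on_subset[OF cont]) auto
    then have "bounded (v ` {- real N..real N})" by (rule compact_imp_bounded)
    then obtain C where C: "\<forall>z\<in>v ` {- real N..real N}. norm z \<le> C" unfolding bounded_iff by blast
    have "\<bar>v x\<bar> \<le> max C 0" for x
    proof (cases "x \<in> {- real N<..<real N}")
      case True
      then have "\<bar>v x\<bar> \<le> C" using C by simp
      then show ?thesis by simp
    qed (simp add: out)
    then show thesis by (rule that)
  qed
  have L2v: "v \<in> L2 m" by (rule L2_m_bounded[OF vm B])
  interpret I: subadditive_increment "increment v" by (rule subadditive_increment_increment[OF L2v])
  show ?thesis
  proof (rule I.quotient_le_exponential_average[OF increment_average(1)[OF L2v] _ t])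
    fix l :: real assume l: "0 < l"
    have "l * L2_inner m (\<lambda>x. v x - res_op l v x) v \<le> L2_sq dS h"
    proof (rule LIMSEQ_le_const2)
      have "L2_tendsto m (\<lambda>n x. v x) v" by (simp add: L2_tendsto_def L2_inner_def)
      then show "(\<lambda>n. l * L2_inner m (\<lambda>x. v x - kres l (Suc n) v x) v)
        \<longlonglongrightarrow> l * L2_inner m (\<lambda>x. v x - res_op l v x) v"
        by (intro tendsto_mult tendsto_const L2_inner_tendsto_left L2_tendsto_diff L2_diff L2v
            kres_L2_bounded[OF l vm B] resolvent_L2_bounded[OF l vm B] kres_L2_tendsto[OF l vm B])
      show "\<exists>n0. \<forall>n\<ge>n0. l * L2_inner m (\<lambda>x. v x - kres l (Suc n) v x) v \<le> L2_sq dS h"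
      proof (intro exI[of _ N] allI impI)
        fix n assume nN: "N \<le> n"
        note k = l zero_less_Suc[of n] vm B
        let ?u = "kres l (Suc n) v" and ?D = "kres_deriv l (Suc n) v"
        have e1: "L2_inner dS ?D h = l * L2_inner m (\<lambda>x. v x - ?u x) v"
          by (rule energy_kres[OF k v]) (use nN in \<open>auto intro!: out\<close>)
        have e2: "L2_sq dS ?D = l * L2_inner m (\<lambda>x. v x - ?u x) ?u"
          by (rule energy_kres[OF k scale_derivative_kres(1)[OF k]]) (rule kres_outside[OF k])
        have uL: "?u \<in> L2 m" by (rule kres_L2_bounded[OF l vm B])
        have "L2_inner m (\<lambda>x. v x - ?u x) v - L2_inner m (\<lambda>x. v x - ?u x) ?u = L2_sq m (\<lambda>x. v x - ?u x)"
          by (simp add: L2_inner_diff_right[OF L2v uL L2_diff[OF L2v uL]])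
        then have "L2_inner m (\<lambda>x. v x - ?u x) ?u \<le> L2_inner m (\<lambda>x. v x - ?u x) v"
          using L2_inner_nonneg[of m "\<lambda>x. v x - ?u x"] by linarith
        then have "L2_sq dS ?D \<le> L2_inner dS ?D h" unfolding e1 e2 using l
          by (intro mult_left_mono) auto
        moreover have "2 * L2_inner dS ?D h \<le> L2_sq dS ?D + L2_sq dS h"
          by (rule L2_inner_young[OF scale_derivative_kres(2)[OF k] h])
        ultimately show "l * L2_inner m (\<lambda>x. v x - ?u x) v \<le> L2_sq dS h" unfolding e1[symmetric]
          by linarith
      qed
    qed
    then show "l * (\<integral>t. increment v t \<partial>exponential_law l) \<le> L2_sq dS h"
      by (simp add: increment_average(2)[OF L2v l])
  qed
qed

text \<open>
  Cut-off: \<open>F\<close> is continued from a near-minimum point \<open>b\<close> of \<open>|F|\<close> on \<open>[k,\<infinity>)\<close> linearly in \<open>S\<close>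
  to \<open>0\<close>. The cut-off costs little energy because \<open>S(\<infinity>) = \<infinity>\<close>, and it stays below \<open>|F| + 1\<close>.
\<close>

lemma compact_approximation:
  assumes F: "has_scale_derivative S F f" and f: "f \<in> L2 dS"
  shows "\<exists>v h N. has_scale_derivative S v h \<and> h \<in> L2 dS \<and> (\<forall>x. x \<notin> {- real N<..<real N} \<longrightarrow> v x = 0) \<and>
    L2_sq dS h \<le> L2_sq dS f + 2 / real (Suc k) \<and> (\<forall>x. \<bar>v x\<bar> \<le> \<bar>F x\<bar> + 1)
      \<and> (\<forall>x. \<bar>x\<bar> < real k \<longrightarrow> v x = F x)"
proof -
  \<comment> \<open>The infimum over an unbounded set need not be attained; the slack 1 returns as
    the summand in \<open>\<bar>F x\<bar> + 1\<close>.\<close>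
  have near: "\<exists>b\<in>A. \<forall>y\<in>A. \<bar>F b\<bar> \<le> \<bar>F y\<bar> + 1" if ne: "A \<noteq> {}" for A
  proof -
    have bdd: "bdd_below ((\<lambda>y. \<bar>F y\<bar>) ` A)" by (rule bdd_belowI2[of _ 0]) simp
    obtain b where b: "b \<in> A" "\<bar>F b\<bar> < (INF y\<in>A. \<bar>F y\<bar>) + 1"
      using cINF_less_iff[OF ne bdd, of "(INF y\<in>A. \<bar>F y\<bar>) + 1"] by auto
    moreover have "(INF y\<in>A. \<bar>F y\<bar>) \<le> \<bar>F y\<bar>" if "y \<in> A" for y using bdd that by (rule cINF_lower)
    ultimately show ?thesis by force
  qed
  obtain b where b: "real k \<le> b" "\<And>y. real k \<le> y \<Longrightarrow> \<bar>F b\<bar> \<le> \<bar>F y\<bar> + 1" using near[of "{real k..}"]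
    by auto
  obtain a where a: "a \<le> - real k" "\<And>y. y \<le> - real k \<Longrightarrow> \<bar>F a\<bar> \<le> \<bar>F y\<bar> + 1" using near[of "{..- real k}"]
    by auto
  have ab: "a \<le> b" using a(1) b(1) by linarith
  \<comment> \<open>The piece descending linearly from \<open>F b\<close> to 0 has energy
    \<open>(F b)^2 / (S c - S b)\<close>; this distance in scale makes it at most
    \<open>1 / (k + 1)\<close>.\<close>
  obtain c where c: "b < c" "S b + real (Suc k) * (F b)\<^sup>2 < S c" using S_unbounded_above by blast
  obtain d where d: "d < a" "S d < S a - real (Suc k) * (F a)\<^sup>2" using S_unbounded_below by blast
  have Sbc: "0 < S c - S b" and Sda: "0 < S a - S d" using c(1) d(1) by auto
  define \<beta> where "\<beta> = F b / (S c - S b)"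
  define \<gamma> where "\<gamma> = F a / (S a - S d)"
  \<comment> \<open>Three clamped pieces are added: \<open>F\<close> on \<open>{a..b}\<close> and a
    linear descent to 0 on each side. The last constant cancels what the two side pieces contribute
    on \<open>{a..b}\<close>.\<close>
  define v where "v x = F (min b (max a x)) + (- \<beta>) * S (min c (max b x)) + \<gamma> * S (min a (max d x)) +
    (\<beta> * S b - \<gamma> * S a)" for x
  define h where "h x = indicator {a<..b} x * f x + (- \<beta>) * (indicator {b<..c} x * 1) + \<gamma> *
    (indicator {d<..a} x * 1)" for x
  have v: "has_scale_derivative S v h"
    unfolding v_def h_def using ab c(1) d(1)
    by (intro scale_derivative_add_const scale_derivative_add scale_derivative_scale
      scale_derivative_clamp
        F scale_derivative_S) auto
  have fm [measurable]: "f \<in> borel_measurable borel" by (rule scale_derivative_measurable[OF F])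
  have hm [measurable]: "h \<in> borel_measurable borel" by (rule scale_derivative_measurable[OF v])
  have sq: "(h x)\<^sup>2 = indicator {a<..b} x * (f x)\<^sup>2 + \<beta>\<^sup>2 * indicator {b<..c} x + \<gamma>\<^sup>2 * indicator
    {d<..a} x" for x
    using ab by (auto simp: h_def indicator_def)
  have intI: "integrable dS (\<lambda>x. e * indicator {p<..q} x)" for e p q :: real
    using emeasure_dS_Ioc by (intro integrable_mult_right integrable_real_indicator) auto
  have intf: "integrable dS (\<lambda>x. indicator {a<..b} x * (f x)\<^sup>2)"
    by (rule Bochner_Integration.integrable_bound[OF L2_D(2)[OF f]]) (auto simp: indicator_def)
  have "integrable dS (\<lambda>x. (h x)\<^sup>2)"
    unfolding sq by (intro Bochner_Integration.integrable_add intI intf)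
  then have h: "h \<in> L2 dS" by (simp add: L2_def)
  have "L2_sq dS h = (\<integral>x. (h x)\<^sup>2 \<partial>dS)" by (simp add: L2_inner_def power2_eq_square)
  also have "\<dots> = (\<integral>x. indicator {a<..b} x * (f x)\<^sup>2 \<partial>dS) + \<beta>\<^sup>2 * (S c - S b) + \<gamma>\<^sup>2 * (S a - S d)"
    unfolding sq using intI intf measure_dS_Ioc[of b c] measure_dS_Ioc[of d a] c(1) d(1) by simp
  also have "\<dots> \<le> L2_sq dS f + 1 / real (Suc k) + 1 / real (Suc k)"
  proof (intro add_mono)
    have "(\<integral>x. indicator {a<..b} x * (f x)\<^sup>2 \<partial>dS) \<le> (\<integral>x. (f x)\<^sup>2 \<partial>dS)"
      by (rule integral_mono[OF intf L2_D(2)[OF f]]) (auto simp: indicator_def)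
    then show "(\<integral>x. indicator {a<..b} x * (f x)\<^sup>2 \<partial>dS) \<le> L2_sq dS f"
      by (simp add: L2_inner_def power2_eq_square)
    have gen: "(w / s)\<^sup>2 * s \<le> 1 / real (Suc k)" if "0 < s" "real (Suc k) * w\<^sup>2 \<le> s" for w s :: real
    proof -
      have "(w / s)\<^sup>2 * s = w\<^sup>2 / s" using that(1) by (simp add: power2_eq_square)
      also have "\<dots> \<le> 1 / real (Suc k)" using that
        by (simp add: divide_le_eq pos_le_divide_eq mult.commute del: of_nat_Suc)
      finally show ?thesis .
    qed
    show "\<beta>\<^sup>2 * (S c - S b) \<le> 1 / real (Suc k)" unfolding \<beta>_def using c(2) by (intro gen Sbc) linarith
    show "\<gamma>\<^sup>2 * (S a - S d) \<le> 1 / real (Suc k)" unfolding \<gamma>_def using d(2) by (intro gen Sda) linarith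
  qed
  finally have en: "L2_sq dS h \<le> L2_sq dS f + 2 / real (Suc k)" by simp
  have \<beta>: "\<beta> * (S c - S b) = F b" and \<gamma>: "\<gamma> * (S a - S d) = F a"
  proof -
    have "0 < s \<Longrightarrow> w / s * s = w" for w s :: real by simp
    from this[OF Sbc] this[OF Sda] show "\<beta> * (S c - S b) = F b" "\<gamma> * (S a - S d) = F a"
      unfolding \<beta>_def \<gamma>_def .
  qed
  have frac: "\<bar>w - w / s * r\<bar> \<le> \<bar>w\<bar>" if "0 < s" "0 \<le> r" "r \<le> s" for w s r :: real
  proof -
    have "w - w / s * r = w * (1 - r / s)" using that by (simp add: algebra_simps)
    moreover have "0 \<le> 1 - r / s" "1 - r / s \<le> 1" using that by auto
    ultimately show ?thesis by (simp add: abs_mult mult_left_le)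
  qed
  have mid: "v x = F x" if "a \<le> x" "x \<le> b" for x
  proof -
    have "min b (max a x) = x" "min c (max b x) = b" "min a (max d x) = a" using that c(1) d(1) by auto
    then show ?thesis by (simp add: v_def algebra_simps)
  qed
  have right: "v x = F b - \<beta> * (S (min c x) - S b)" if "b < x" for x
  proof -
    have "min b (max a x) = b" "min c (max b x) = min c x" "min a (max d x) = a" using that ab c(1) d(1)
      by auto
    then show ?thesis by (simp add: v_def algebra_simps)
  qed
  have left: "v x = F a - \<gamma> * (S a - S (max d x))" if "x < a" for x
  proof -
    have "min b (max a x) = a" "min c (max b x) = b" "min a (max d x) = max d x" using that ab c(1) d(1)
      by auto
    then show ?thesis by (simp add: v_def algebra_simps)
  qed
  have bound: "\<bar>v x\<bar> \<le> \<bar>F x\<bar> + 1" for x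
  proof -
    consider "a \<le> x \<and> x \<le> b" | "b < x" | "x < a" by linarith
    then show ?thesis
    proof cases
      case 2
      have "\<bar>v x\<bar> \<le> \<bar>F b\<bar>" unfolding right[OF 2] \<beta>_def using Sbc 2 c(1)
        by (intro frac) (auto simp: min_def)
      also have "\<dots> \<le> \<bar>F x\<bar> + 1" using b 2 by (intro b(2)) linarith
      finally show ?thesis .
    next
      case 3
      have "\<bar>v x\<bar> \<le> \<bar>F a\<bar>" unfolding left[OF 3] \<gamma>_def using Sda 3 d(1)
        by (intro frac) (auto simp: max_def)
      also have "\<dots> \<le> \<bar>F x\<bar> + 1" using a 3 by (intro a(2)) linarith
      finally show ?thesis .
    qed (simp add: mid)
  qed
  obtain N where N: "max \<bar>c\<bar> \<bar>d\<bar> < real N" using reals_Archimedean2 by blast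
  have out: "v x = 0" if x: "x \<notin> {- real N<..<real N}" for x
  proof -
    have "c \<le> x \<or> x \<le> d" using x N by auto
    then show ?thesis
    proof
      assume "c \<le> x"
      then have "b < x" "min c x = c" using c(1) by auto
      then show ?thesis using right[of x] \<beta> by simp
    next
      assume "x \<le> d"
      then have "x < a" "max d x = d" using d(1) by auto
      then show ?thesis using left[of x] \<gamma> by simp
    qed
  qed
  have inner: "v x = F x" if "\<bar>x\<bar> < real k" for x using that a(1) b(1) by (intro mid) linarith+
  show ?thesis using v h en bound out inner by (intro exI[of _ v] exI[of _ h] exI[of _ N]) auto
qed

text \<open>The cut-offs agree with \<open>F\<close> on growing intervals and are dominated by
  \<open>\<bar>F\<bar> + 1\<close>, which lies in L2 because \<open>m\<close> is finite. Their
  increments therefore converge at the fixed time \<open>t\<close>, while the excess energy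
  \<open>2 / (k + 1)\<close> disappears.\<close>

lemma increment_le_energy:
  assumes FL: "F \<in> L2 m" and F: "has_scale_derivative S F f" and f: "f \<in> L2 dS" and t: "0 < t"
  shows "increment F t / t \<le> L2_sq dS f"
proof -
  obtain v h N where v: "\<And>k. has_scale_derivative S (v k) (h k)" "\<And>k. h k \<in> L2 dS"
      "\<And>k x. x \<notin> {- real (N k)<..<real (N k)} \<Longrightarrow> v k x = 0"
      "\<And>k. L2_sq dS (h k) \<le> L2_sq dS f + 2 / real (Suc k)"
      "\<And>k x. \<bar>v k x\<bar> \<le> \<bar>F x\<bar> + 1" "\<And>k x. \<bar>x\<bar> < real k \<Longrightarrow> v k x = F x"
    using compact_approximation[OF F f] by metis
  interpret T: symmetric_kernel m "transition_kernel t" by (rule symmetric_transition_kernel)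
  have vm: "v k \<in> borel_measurable m" for k
    using borel_measurable_continuous_onI[OF scale_derivative_continuous[OF v(1)], of k]
    by (simp cong: measurable_cong_sets add: sets_m)
  have H: "(\<lambda>x. \<bar>F x\<bar> + 1) \<in> L2 m" by (intro L2_add L2_abs FL L2_one)
  have lim: "AE x in m. (\<lambda>k. v k x) \<longlonglongrightarrow> F x"
  proof (intro AE_I2 tendsto_eventually)
    fix x
    obtain K where "\<bar>x\<bar> < real K" using reals_Archimedean2 by blast
    then show "\<forall>\<^sub>F k in sequentially. v k x = F x" by (intro eventually_sequentiallyI[of K] v(6)) simp
  qed
  have dom: "AE x in m. \<bar>v k x\<bar> \<le> \<bar>F x\<bar> + 1" for k using v(5) by simp
  note D = L2_tendsto_dominated[OF vm L2_D(1)[OF FL] H lim dom]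
  have le: "increment (v k) t / t \<le> L2_sq dS f + 2 / real (Suc k)" for k
    using increment_le_energy_compact[OF v(1) v(2) v(3) t] v(4)[of k] by (rule order_trans)
  have "(\<lambda>k. increment (v k) t / t) \<longlonglongrightarrow> increment F t / t"
    unfolding increment_eq[OF D(1)] increment_eq[OF FL]
    by (intro tendsto_divide tendsto_const L2_inner_tendsto L2_tendsto_diff L2_diff D FL
        T.kernel_op_contraction T.kernel_op_tendsto) (use t in auto)
  moreover have "(\<lambda>k. L2_sq dS f + 2 / real (Suc k)) \<longlonglongrightarrow> L2_sq dS f"
  proof -
    from tendsto_add[OF tendsto_const tendsto_mult_right_zero[OF LIMSEQ_Suc[OF lim_1_over_n], of 2]]
      show ?thesis by simp
  qed
  ultimately show ?thesis using le by (intro LIMSEQ_le) auto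
qed

section \<open>Identification of the form and its domain\<close>

lemma approximating_form_eq:
  assumes FL: "F \<in> L2 m" and t: "0 < t"
  shows "approximating_form m (transition P X) t F F = increment F t / t"
proof -
  have Fm [measurable]: "F \<in> borel_measurable borel" by (rule L2_m_measurable[OF FL])
  have "transition P X t F x = trans_op t F x" for x
  proof -
    have "(\<lambda>\<omega>. F (X t \<omega>)) \<in> borel_measurable (\<N> \<infinity>)"
      by (rule measurable_compose[OF measurable_X_natural Fm]) (use t in auto)
    then have "(\<integral>\<omega>. F (X t \<omega>) \<partial>law x) = (\<integral>\<omega>. F (X t \<omega>) \<partial>P x)"
      unfolding law_def by (intro integral_distr id_measurable)
    then show ?thesis using t by (simp add: transition_def kernel_op_transition[OF Fm])
  qed
  then show ?thesis by (simp add: approximating_form_def increment_eq[OF FL])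
qed

lemma approximating_form_tendsto_iff:
  assumes "F \<in> L2 m"
  shows "((\<lambda>t. approximating_form m (transition P X) t F F) \<longlongrightarrow> l) (at_right 0) \<longleftrightarrow>
    ((\<lambda>t. increment F t / t) \<longlongrightarrow> l) (at_right 0)"
  by (rule tendsto_cong) (use approximating_form_eq[OF assms] in \<open>auto simp: eventually_at_filter\<close>)

lemma increment_cong_AE:
  assumes "F \<in> L2 m" "G \<in> L2 m" "AE x in m. F x = G x"
  shows "increment F t = increment G t"
proof -
  interpret T: symmetric_kernel m "transition_kernel t" by (rule symmetric_transition_kernel)
  note eq = T.kernel_op_cong_AE[OF assms]
  have "AE x in m. F x - trans_op t F x = G x - trans_op t G x"
    using assms(3) eq by eventually_elim simp
  then show ?thesis
    unfolding increment_eq[OF assms(1)] increment_eq[OF assms(2)]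
    using L2_D(1)[OF L2_diff[OF assms(1) transition_L2[OF assms(1)]]]
      L2_D(1)[OF L2_diff[OF assms(2) transition_L2[OF assms(2)]]] L2_D(1)[OF assms(1)]
        L2_D(1)[OF assms(2)] assms(3)
    by (intro L2_inner_cong_AE)
qed

text \<open>The upper bound forces the quotients to converge to some \<open>l \<le> Q(F)\<close>.
  Since every quotient is at most \<open>l\<close>, the lower semicontinuity argument gives
  \<open>Q(F) \<le> l\<close>.\<close>

lemma form_limit:
  assumes FL: "F \<in> L2 m" and eq: "AE x in m. F x = F' x" and F': "has_scale_derivative S F' f"
    and f: "f \<in> L2 dS"
  shows "((\<lambda>t. approximating_form m (transition P X) t F F) \<longlongrightarrow> L2_sq dS f) (at_right 0)"
proof -
  interpret I: subadditive_increment "increment F" by (rule subadditive_increment_increment[OF FL])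
  have F'm: "F' \<in> borel_measurable m"
    using borel_measurable_continuous_onI[OF scale_derivative_continuous[OF F']]
    by (simp cong: measurable_cong_sets add: sets_m)
  have F'L: "F' \<in> L2 m" by (rule L2_cong_AE[OF FL F'm eq])
  have le: "increment F t / t \<le> L2_sq dS f" if "0 < t" for t
    using increment_le_energy[OF F'L F' f that] increment_cong_AE[OF FL F'L eq] by simp
  from I.quotient_tendsto[OF le]
  obtain l where l: "((\<lambda>t. increment F t / t) \<longlongrightarrow> l) (at_right 0)" "l \<le> L2_sq dS f" by blast
  have "energy_le m l F" by (intro energy_le_if_increment_le[OF FL] I.quotient_le_limit[OF l(1)])
  from energy_unique(2)[OF eq F' this] l have "l = L2_sq dS f" by simp
  with l(1) show ?thesis by (simp add: approximating_form_tendsto_iff[OF FL])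
qed

lemma dirichlet_space_eq: "dirichlet_space m P X = scale_space S m"
proof (intro equalityI subsetI)
  fix F assume "F \<in> dirichlet_space m P X"
  then obtain l where FL: "F \<in> L2 m" and lim: "((\<lambda>t. increment F t / t) \<longlongrightarrow> l) (at_right 0)"
    unfolding dirichlet_space_def form_domain_def using approximating_form_tendsto_iff by auto
  interpret I: subadditive_increment "increment F" by (rule subadditive_increment_increment[OF FL])
  have "energy_le m l F" by (intro energy_le_if_increment_le[OF FL] I.quotient_le_limit[OF lim])
  then show "F \<in> scale_space S m" unfolding energy_le_def scale_space_def by blast
next
  fix F assume "F \<in> scale_space S m"
  then obtain F' f where F: "F \<in> L2 m" "AE x in m. F x = F' x" "has_scale_derivative S F' f" "f \<in> L2 dS"
    unfolding scale_space_def by blast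
  from form_limit[OF this] F(1) show "F \<in> dirichlet_space m P X"
    unfolding dirichlet_space_def form_domain_def by blast
qed

lemma dirichlet_form_eq:
  assumes F: "F \<in> scale_space S m" and F': "AE x in m. F x = F' x" "has_scale_derivative S F' f"
  shows "f \<in> L2 dS" "dirichlet_form m P X F F = (\<integral>x. (f x)\<^sup>2 \<partial>dS)"
proof -
  obtain G g where G: "F \<in> L2 m" "AE x in m. F x = G x" "has_scale_derivative S G g" "g \<in> L2 dS"
    using F unfolding scale_space_def by blast
  then have "energy_le m (L2_sq dS g) F" unfolding energy_le_def by blast
  from energy_unique(1)[OF F' this] show f: "f \<in> L2 dS" .
  have "dirichlet_form m P X F F = L2_sq dS f"
    unfolding dirichlet_form_def form_def
    by (rule tendsto_Lim[OF _ form_limit[OF G(1) F' f]]) simp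
  then show "dirichlet_form m P X F F = (\<integral>x. (f x)\<^sup>2 \<partial>dS)" by (simp add: L2_inner_def power2_eq_square)
qed

end

theorem theorem3p1:
  fixes M :: "'w measure"
    and P :: "real \<Rightarrow> 'w measure"
    and X :: "real \<Rightarrow> 'w \<Rightarrow> real"
    and S :: "real \<Rightarrow> real"
    and m :: "real measure"
  assumes "linear_diffusion M P X"
    and "positively_recurrent P X"
    and "scale_function P X S"
    and "speed_measure P X S m"
  shows "m_symmetric m P X \<and>
    dirichlet_space m P X = scale_space S m \<and>
    (\<forall>F \<in> scale_space S m. \<forall>F' f.
       (AE x in m. F x = F' x) \<and> has_scale_derivative S F' f \<longrightarrow>
       f \<in> L2 (interval_measure S) \<and>
       dirichlet_form m P X F F = (\<integral>x. (f x)\<^sup>2 \<partial>interval_measure S))"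
proof -
  interpret linear_diffusion M P X by fact
  interpret recurrent_diffusion M P X S m
    by unfold_locales (use assms in \<open>auto simp: scale_function_def\<close>)
  show ?thesis
    using m_symmetric_diffusion dirichlet_space_eq dirichlet_form_eq by blast
qed

end
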